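(* Let $0<\alpha,\beta<\infty$ and $0<p_1,p_2,q_1,q_2\le\infty$. Then the inclusion $\mathcal F_\alpha^{p_1,q_1}\subset\mathcal F_\beta^{p_2,q_2}$ holds and is continuous if and only if either (i) $\alpha<\beta$, or (ii) $\alpha=\beta$, $q_1\le q_2$, and $\frac1{q_2}-\frac1{p_2}\le\frac1{q_1}-\frac1{p_1}$. Here $\frac1\infty=0$.
   Context: For an entire function $f$ and $r\ge0$, $M_p(f,r):=\left(\frac1{2\pi}\int_0^{2\pi}|f(re^{i\theta})|^p\,d\theta\right)^{1/p}$ for $0<p<\infty$, and $M_\infty(f,r):=\sup_{\theta\in[0,2\pi]}|f(re^{i\theta})|$. For $\alpha>0$ put $$\|f\|_{\mathcal F_\alpha^{p,q}}:=\left(\int_0^\infty M_p(f,r)^q\,\alpha q\,e^{-\frac{\alpha q}{2}r^2}r\,dr\right)^{1/q}\ (0<q<\infty),\qquad \|f\|_{\mathcal F_\alpha^{p,\infty}}:=\sup_{r\ge0}M_p(f,r)e^{-\frac{\alpha}{2}r^2}.$$ The mixed-norm Fock space $\mathcal F_\alpha^{p,q}$ is the (quasi-)normed space of entire functions $f$ on $\mathbb C$ with $\|f\|_{\mathcal F_\alpha^{p,q}}<\infty$. Continuity of the inclusion means $\|f\|_{\mathcal F_\beta^{p_2,q_2}}\le C\|f\|_{\mathcal F_\alpha^{p_1,q_1}}$ for all $f\in\mathcal F_\alpha^{p_1,q_1}$ with a constant $C$ independent of $f$. *)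

theory Defs
  imports "HOL-Analysis.Analysis"
begin

text \<open>
  Exponents in \<open>(0, \<infinity>]\<close> are \<open>p :: ereal\<close> with \<open>0 < p\<close>, so that \<open>1 / \<infinity> = 0\<close> and differences of
  reciprocals may be negative (they are always finite here).
\<close>

text \<open>
  The mean may be real-valued: for entire \<open>f\<close> the integrand is continuous on a compact interval,
  hence integrable and bounded.
\<close>

definition integral_mean :: "ereal \<Rightarrow> (complex \<Rightarrow> complex) \<Rightarrow> real \<Rightarrow> real" where
  "integral_mean p f r =
    (if p = \<infinity> then (SUP \<theta>\<in>{0..2*pi}. norm (f (of_real r * cis \<theta>)))
     else (1 / (2 * pi) * (LBINT \<theta>:{0..2*pi}. norm (f (of_real r * cis \<theta>)) powr real_of_ereal p))
            powr (1 / real_of_ereal p))"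

text \<open>Powers with positive real exponent, extended by \<open>\<infinity>\<^sup>a = \<infinity>\<close>.\<close>

definition ennreal_powr :: "ennreal \<Rightarrow> real \<Rightarrow> ennreal" where
  "ennreal_powr x a = (if x = \<infinity> then \<infinity> else ennreal (enn2real x powr a))"

definition fock_norm :: "real \<Rightarrow> ereal \<Rightarrow> ereal \<Rightarrow> (complex \<Rightarrow> complex) \<Rightarrow> ennreal" where
  "fock_norm \<alpha> p q f =
    (if q = \<infinity> then (SUP r\<in>{0..}. ennreal (integral_mean p f r * exp (- (\<alpha> / 2) * r\<^sup>2)))
     else let s = real_of_ereal q in
       ennreal_powr
         (\<integral>\<^sup>+ r\<in>{0..}. ennreal (integral_mean p f r powr s * \<alpha> * s * exp (- (\<alpha> * s / 2) * r\<^sup>2) * r)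
            \<partial>lborel)
         (1 / s))"

definition fock_space :: "real \<Rightarrow> ereal \<Rightarrow> ereal \<Rightarrow> (complex \<Rightarrow> complex) set" where
  "fock_space \<alpha> p q = {f. f holomorphic_on UNIV \<and> fock_norm \<alpha> p q f < \<infinity>}"

end

theory Submission
  imports Defs "HOL-Complex_Analysis.Complex_Analysis" "HOL-Real_Asymp.Real_Asymp"
begin

text \<open>
  Write \<open>\<phi>\<^sub>p(r) = M\<^sub>p(f, r) exp (- \<alpha> r\<^sup>2 / 2)\<close>. Hardy's three circles theorem for \<open>f(z) / z\<^sup>m\<close> with
  \<open>m \<approx> \<alpha> R\<^sup>2\<close>, together with the fact that \<open>|z|\<^sup>m\<close> and the Gaussian weight agree to first order at \<open>|z| = R\<close>,
  gives \<open>\<phi>\<^sub>p(R) \<le> C max (\<phi>\<^sub>p(R - t)) (\<phi>\<^sub>p(R + t))\<close> for \<open>0 \<le> t \<le> 1\<close> and every \<open>p\<close>; hence \<open>\<phi>\<^sub>p(R)\<^sup>q\<close> is bounded by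
  its integral over an interval of unit length, also for \<open>q < 1\<close>. Taylor coefficient bounds
  on two circles show that passing from \<open>p\<^sub>1\<close> to \<open>p\<^sub>2\<close> costs at most the factor \<open>R\<^sup>\<kappa>\<close> with
  \<open>\<kappa> = max 0 (1/p\<^sub>1 - 1/p\<^sub>2)\<close>. As annuli of unit width carry the measure \<open>r dr \<approx> R\<close>, the norms behave like
  weighted sequence norms of \<open>n powr (1/q) * \<phi>\<^sub>p(n)\<close>, and the stated conditions suffice.
  Conversely, \<open>exp (b z)\<close> has norm of order \<open>exp (b\<^sup>2 / (2 \<alpha>)) * b powr (1/q - 1/p)\<close>, which forces
  \<open>\<alpha> \<le> \<beta>\<close> and the second inequality of (ii), and for \<open>\<alpha> = \<beta>\<close> the monomials, concentrated on annuli of unit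
  width, force \<open>q\<^sub>1 \<le> q\<^sub>2\<close>.
\<close>

section \<open>Convexity of integral means\<close>

text \<open>The obstacle is small exponents: for p < 1 or q < 1 there is no triangle inequality or
  duality to lean on. On the p side the work is done by subharmonicity of |G| powr p, which holds
  for every p > 0. On the q side it is done by bounds through the maximum of two values, since (max
  x y) powr q \<le> x powr q + y powr q for every q > 0. Unit width is the natural scale: over |r -
  R| \<le> 1 the logarithm of the Gaussian weight, as a function of ln r, departs from its tangent
  at ln R by an amount bounded uniformly in R. The loss R powr (1/p1 - 1/p2) is the price of
  concentrating on an arc of angle about 1/R, and the exponentials actually pay it. The two
  inequalities of (ii) say together that \<kappa> \<le> 1/q1 - 1/q2, which is the form used for
  sufficiency.\<close>

lemma entire_has_vector_derivative_line:
  assumes "F holomorphic_on UNIV"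
  shows "((\<lambda>t. F (c + of_real t * d)) has_vector_derivative d * deriv F (c + of_real t * d)) (at t)"
proof -
  have F: "(F has_field_derivative deriv F w) (at w)" for w
    using assms by (metis UNIV_I holomorphic_derivI open_UNIV)
  have "((\<lambda>t. c + of_real t * d) has_vector_derivative d) (at t)"
    unfolding has_vector_derivative_def
    by (auto intro!: derivative_eq_intros simp: scaleR_conv_of_real)
  from field_vector_diff_chain_at[OF this F] show ?thesis by (simp add: o_def mult.commute)
qed

lemma entire_Re_Im_derivative_line:
  assumes "F holomorphic_on UNIV"
  shows "((\<lambda>t. Re (F (c + of_real t * d))) has_real_derivative Re (d * deriv F (c + of_real t * d))) (at t)"
    and "((\<lambda>t. Im (F (c + of_real t * d))) has_real_derivative Im (d * deriv F (c + of_real t * d))) (at t)"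
  using bounded_linear.has_vector_derivative[OF bounded_linear_Re entire_has_vector_derivative_line[OF assms]]
    bounded_linear.has_vector_derivative[OF bounded_linear_Im entire_has_vector_derivative_line[OF assms]]
  by (simp_all add: has_real_derivative_iff_has_vector_derivative)

text \<open>Used with s = p/2 and, in the end, G(w) = f(exp w) exp(- m w): the line Re w = x then
  covers the circle of radius exp x, and one period is one turn. Working with |G|^2 instead of |G|
  gives a polynomial in Re G and Im G.\<close>

locale periodic_entire =
  fixes G :: "complex \<Rightarrow> complex" and \<epsilon> s :: real
  assumes hol: "G holomorphic_on UNIV" and eps: "\<epsilon> > 0" and s: "s > 0"
    and per: "\<And>w. G (w + 2 * of_real pi * \<i>) = G w"
begin

text \<open>\<open>N1 d\<close>, \<open>N2 d\<close> and \<open>U1 d\<close>, \<open>U2 d\<close> are the first and second derivatives of \<open>N\<close> and of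
  \<open>N powr s\<close> in the direction \<open>d\<close>; adding \<open>\<epsilon>\<close> keeps \<open>N powr s\<close> smooth at the zeros of \<open>G\<close>.\<close>

definition "N w = (Re (G w))\<^sup>2 + (Im (G w))\<^sup>2 + \<epsilon>"
definition "N1 d w = 2 * (Re (G w) * Re (d * deriv G w) + Im (G w) * Im (d * deriv G w))"
definition "N2 d w = 2 * ((Re (d * deriv G w))\<^sup>2 + (Im (d * deriv G w))\<^sup>2
    + Re (G w) * Re (d * (d * deriv (deriv G) w)) + Im (G w) * Im (d * (d * deriv (deriv G) w)))"
definition "U1 d w = s * N w powr (s - 1) * N1 d w"
definition "U2 d w = s * N w powr (s - 1) * N2 d w + s * (s - 1) * N w powr (s - 2) * (N1 d w)\<^sup>2"

lemma N_pos: "N w > 0"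
  using eps by (simp add: N_def add_nonneg_pos)

lemma hol': "deriv G holomorphic_on UNIV" "deriv (deriv G) holomorphic_on UNIV"
  using hol by (auto intro!: holomorphic_deriv)

lemma cont: "continuous_on UNIV N" "continuous_on UNIV (N1 d)" "continuous_on UNIV (N2 d)"
  unfolding N_def[abs_def] N1_def[abs_def] N2_def[abs_def]
  by (intro continuous_intros holomorphic_on_imp_continuous_on hol hol')+

lemma contU: "continuous_on UNIV (\<lambda>w. N w powr s)" "continuous_on UNIV (U1 d)" "continuous_on UNIV (U2 d)"
  unfolding U1_def[abs_def] U2_def[abs_def]
  using N_pos by (auto intro!: continuous_intros cont simp: less_imp_neq[symmetric])

lemma N_deriv: "((\<lambda>t. N (c + of_real t * d)) has_real_derivative N1 d (c + of_real t * d)) (at t)"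
  unfolding N_def N1_def
  by (rule derivative_eq_intros entire_Re_Im_derivative_line[OF hol] refl)+ (simp add: algebra_simps)

lemma N1_deriv: "((\<lambda>t. N1 d (c + of_real t * d)) has_real_derivative N2 d (c + of_real t * d)) (at t)"
proof -
  have h: "(\<lambda>w. d * deriv G w) holomorphic_on UNIV" by (intro holomorphic_intros hol')
  have d: "deriv (\<lambda>w. d * deriv G w) w = d * deriv (deriv G) w" for w
    using hol' by (intro deriv_cmult) (simp add: holomorphic_on_def)
  show ?thesis
    unfolding N1_def N2_def
    by (rule derivative_eq_intros entire_Re_Im_derivative_line[OF hol] entire_Re_Im_derivative_line[OF h] refl)+
       (simp add: d algebra_simps power2_eq_square)
qed

lemma U_deriv: "((\<lambda>t. N (c + of_real t * d) powr s) has_real_derivative U1 d (c + of_real t * d)) (at t)"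
  unfolding U1_def
  using DERIV_fun_powr[OF N_deriv N_pos, of c d s t] by simp

lemma U1_deriv: "((\<lambda>t. U1 d (c + of_real t * d)) has_real_derivative U2 d (c + of_real t * d)) (at t)"
proof -
  have "((\<lambda>t. N (c + of_real t * d) powr (s - 1)) has_real_derivative
      (s - 1) * N (c + of_real t * d) powr (s - 2) * N1 d (c + of_real t * d)) (at t)"
    using DERIV_fun_powr[OF N_deriv N_pos, of c d "s - 1" t] by (simp add: algebra_simps)
  note * = this
  show ?thesis unfolding U1_def U2_def
    by (rule derivative_eq_intros * N1_deriv refl)+ (simp add: algebra_simps power2_eq_square)
qed

text \<open>This is subharmonicity of (|G|^2 + \<epsilon>) powr s. In the sum over the directions 1
  and \<open>\<i>\<close> the second derivatives of G cancel because \<open>\<i>\<close> squares to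
  -1. The rest factors as 4 s N powr (s - 2) |G'|^2 (\<epsilon> + s |G|^2), which is nonnegative
  also for s < 1, where the term with s - 1 alone is not.\<close>

lemma laplacian_nonneg: "U2 1 w + U2 \<i> w \<ge> 0"
proof -
  define a b p q where "a = Re (G w)" and "b = Im (G w)" and "p = Re (deriv G w)" and "q = Im (deriv G w)"
  have 1: "N2 1 w + N2 \<i> w = 4 * (p\<^sup>2 + q\<^sup>2)"
    by (simp add: N2_def p_def q_def algebra_simps)
  have 2: "(N1 1 w)\<^sup>2 + (N1 \<i> w)\<^sup>2 = 4 * ((a\<^sup>2 + b\<^sup>2) * (p\<^sup>2 + q\<^sup>2))"
    by (simp add: N1_def a_def b_def p_def q_def) algebra
  have 3: "N w powr (s - 1) = N w * N w powr (s - 2)"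
    using N_pos[of w] powr_add[of "N w" 1 "s - 2"] by simp
  have "U2 1 w + U2 \<i> w = s * N w powr (s - 1) * (N2 1 w + N2 \<i> w)
      + s * (s - 1) * N w powr (s - 2) * ((N1 1 w)\<^sup>2 + (N1 \<i> w)\<^sup>2)"
    by (simp add: U2_def algebra_simps)
  also have "\<dots> = 4 * s * N w powr (s - 2) * (p\<^sup>2 + q\<^sup>2) * (\<epsilon> + s * (a\<^sup>2 + b\<^sup>2))"
    unfolding 1 2 3 by (simp add: N_def a_def b_def algebra_simps)
  also have "\<dots> \<ge> 0" using eps s by (intro mult_nonneg_nonneg add_nonneg_nonneg) auto
  finally show ?thesis .
qed

lemma per_deriv: "deriv G (w + 2 * of_real pi * \<i>) = deriv G w"
proof -
  have "(G has_field_derivative deriv G (w + 2 * of_real pi * \<i>)) (at (w + 2 * of_real pi * \<i>))"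
    using hol by (metis UNIV_I holomorphic_derivI open_UNIV)
  then have "((\<lambda>w. G (w + 2 * of_real pi * \<i>)) has_field_derivative deriv G (w + 2 * of_real pi * \<i>)) (at w)"
    by (simp add: DERIV_shift)
  then show ?thesis using per by (simp add: DERIV_imp_deriv)
qed

text \<open>The second x-derivative of the integral is the integral of the Laplacian minus that of
  the second y-derivative, and the latter vanishes because \<open>U1 \<i>\<close> takes equal values
  at both ends of a period.\<close>

lemma convex_regularized:
  "convex_on UNIV (\<lambda>x::real. integral {0..2*pi} (\<lambda>y. N (Complex x y) powr s))"
proof (rule f''_ge0_imp_convex)
  define V1 where "V1 x = integral {0..2*pi} (\<lambda>y. U1 1 (Complex x y))" for x
  define V2 where "V2 x = integral {0..2*pi} (\<lambda>y. U2 1 (Complex x y))" for x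
  have C: "Complex x y = of_real y * \<i> + of_real x * 1" "Complex x y = of_real x + of_real y * \<i>" for x y
    by (simp_all add: complex_eq_iff)
  have co: "continuous_on X (\<lambda>(x, y). H (Complex x y))" if "continuous_on UNIV H" for X and H :: "complex \<Rightarrow> real"
    unfolding C(2) split_beta
    by (rule continuous_on_compose2[OF that]) (auto intro!: continuous_intros)
  have co1: "continuous_on X (\<lambda>y. H (Complex x y))" if "continuous_on UNIV H" for X x and H :: "complex \<Rightarrow> real"
    unfolding C(2) split_beta
    by (rule continuous_on_compose2[OF that]) (auto intro!: continuous_intros)
  have int: "(\<lambda>y. H (Complex x y)) integrable_on {0..2*pi}" if "continuous_on UNIV H" for x and H :: "complex \<Rightarrow> real"
    by (intro integrable_continuous_interval co1 that)
  show "((\<lambda>x. integral {0..2*pi} (\<lambda>y. N (Complex x y) powr s)) has_real_derivative V1 x) (at x)" for x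
    unfolding V1_def cbox_interval[symmetric]
    using U_deriv[where d = 1, folded C(1)]
    by (intro leibniz_rule_field_derivative[where U = UNIV, simplified]
       co contU[unfolded comp_def] int[unfolded interval_cbox[symmetric], OF contU(1)]) (auto simp: C(1) intro!: int[OF contU(1), unfolded C(1), simplified])
  show "(V1 has_real_derivative V2 x) (at x)" for x
    unfolding V1_def[abs_def] V2_def cbox_interval[symmetric]
    using U1_deriv[where d = 1, folded C(1)]
    by (intro leibniz_rule_field_derivative[where U = UNIV, simplified]
       co contU) (auto simp: C(1) intro!: int[OF contU(2), unfolded C(1), simplified])
  show "V2 x \<ge> 0" for x
  proof -
    have "((\<lambda>y. U2 \<i> (Complex x y)) has_integral (U1 \<i> (Complex x (2*pi)) - U1 \<i> (Complex x 0))) {0..2*pi}"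
      using U1_deriv[where d = \<i> and c = "of_real x", folded C(2)]
      by (intro fundamental_theorem_of_calculus)
        (auto simp: has_real_derivative_iff_has_vector_derivative[symmetric] C(2)
          intro: has_field_derivative_at_within)
    moreover have "Complex x (2*pi) = Complex x 0 + 2 * of_real pi * \<i>" by (simp add: complex_eq_iff)
    ultimately have i0: "((\<lambda>y. U2 \<i> (Complex x y)) has_integral 0) {0..2*pi}"
      by (simp add: U1_def N_def N1_def per per_deriv)
    have "V2 x = integral {0..2*pi} (\<lambda>y. U2 1 (Complex x y) + U2 \<i> (Complex x y))"
      using i0 by (simp add: V2_def integral_add int contU integral_unique)
    also have "\<dots> \<ge> 0"
      by (intro integral_nonneg integrable_add int contU laplacian_nonneg)
    finally show ?thesis .
  qed
qed auto

end

text \<open>Convexity passes to the pointwise limit \<epsilon> -> 0. The regularised integrals are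
  continuous down to \<epsilon> = 0, zeros of G included, because the exponent p/2 is
  positive.\<close>

lemma convex_on_vertical_mean:
  assumes hol: "G holomorphic_on UNIV" and per: "\<And>w. G (w + 2 * of_real pi * \<i>) = G w" and p: "p > 0"
  shows "convex_on UNIV (\<lambda>x::real. integral {0..2*pi} (\<lambda>y. cmod (G (Complex x y)) powr p))"
proof -
  define V where "V e x = integral {0..2*pi} (\<lambda>y. ((cmod (G (Complex x y)))\<^sup>2 + e) powr (p/2))" for e x :: real
  have cG: "continuous_on UNIV G" by (rule holomorphic_on_imp_continuous_on[OF hol])
  have V0: "V 0 x = integral {0..2*pi} (\<lambda>y. cmod (G (Complex x y)) powr p)" for x
    unfolding V_def by (simp add: powr_powr flip: powr_numeral)
  have conv: "convex_on UNIV (V e)" if "e > 0" for e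
  proof -
    interpret periodic_entire G e "p/2" using that assms by unfold_locales auto
    show ?thesis using convex_regularized unfolding V_def[abs_def] N_def cmod_power2 .
  qed
  have co: "continuous_on {0..} (\<lambda>e. V e x)" for x
    unfolding V_def cbox_interval[symmetric]
  proof (rule integral_continuous_on_param)
    have "continuous_on X (\<lambda>z. G (Complex x (snd z)))" for X :: "(real \<times> real) set"
      by (rule continuous_on_compose2[OF cG]) (auto simp: Complex_eq intro!: continuous_intros)
    then show "continuous_on ({0..} \<times> cbox 0 (2 * pi)) (\<lambda>(e, y). ((cmod (G (Complex x y)))\<^sup>2 + e) powr (p/2))"
      unfolding split_beta using p
      by (intro continuous_on_powr' continuous_intros) auto
  qed
  have lim: "((\<lambda>e. V e x) \<longlongrightarrow> V 0 x) (at_right 0)" for x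
    using co[of x] by (auto simp: continuous_on_def intro: tendsto_within_subset)
  have "convex_on UNIV (V 0)"
  proof (rule convex_onI)
    fix t x y :: real assume t: "0 < t" "t < 1"
    show "V 0 ((1 - t) *\<^sub>R x + t *\<^sub>R y) \<le> (1 - t) * V 0 x + t * V 0 y"
    proof (rule tendsto_le[OF trivial_limit_at_right_real])
      show "((\<lambda>e. V e ((1 - t) *\<^sub>R x + t *\<^sub>R y)) \<longlongrightarrow> V 0 ((1 - t) *\<^sub>R x + t *\<^sub>R y)) (at_right 0)"
        by (rule lim)
      show "((\<lambda>e. (1 - t) * V e x + t * V e y) \<longlongrightarrow> (1 - t) * V 0 x + t * V 0 y) (at_right 0)"
        by (intro tendsto_intros lim)
      show "\<forall>\<^sub>F e in at_right 0. V e ((1 - t) *\<^sub>R x + t *\<^sub>R y) \<le> (1 - t) * V e x + t * V e y"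
        using t convex_onD[OF conv, of _ t x y] by (auto simp: eventually_at_filter intro!: always_eventually)
    qed
  qed auto
  then show ?thesis unfolding V0[abs_def] .
qed

text \<open>Root and normalisation are left out because the convexity in ln r is proved for the
  integral itself.\<close>

definition circle_mean :: "real \<Rightarrow> (complex \<Rightarrow> complex) \<Rightarrow> real \<Rightarrow> real" where
  "circle_mean p f r = integral {0..2*pi} (\<lambda>\<theta>. cmod (f (of_real r * cis \<theta>)) powr p)"

text \<open>Division by z^m becomes multiplication by exp(- m w) in the coordinate w = ln z, which
  respects the period because m is an integer. Convexity in ln r then bounds the value at an
  intermediate radius by a convex combination, hence by the maximum.\<close>

lemma circle_mean_three_circles:
  assumes hol: "f holomorphic_on UNIV" and p: "p > 0" and r: "0 < r1" "r1 \<le> R" "R \<le> r2"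
  shows "circle_mean p f R / R powr (m * p) \<le> max (circle_mean p f r1 / r1 powr (real m * p)) (circle_mean p f r2 / r2 powr (m * p))"
proof -
  define G where "G w = f (exp w) * exp (- (of_nat m * w))" for w
  have h: "G holomorphic_on UNIV"
    unfolding G_def[abs_def]
    by (intro holomorphic_intros holomorphic_on_compose_gen[OF _ hol, unfolded o_def]) auto
  have per: "G (w + 2 * of_real pi * \<i>) = G w" for w
  proof -
    have "exp (- (of_nat m * (w + 2 * of_real pi * \<i>))) = exp (- (of_nat m * w)) * (exp (- (2 * of_real pi * \<i>))) ^ m"
      unfolding exp_of_nat_mult[symmetric] exp_add[symmetric] by (simp add: algebra_simps)
    also have "exp (- (2 * of_real pi * \<i>)) = 1"
      by (simp add: exp_minus)
    finally show ?thesis by (simp add: G_def exp_add)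
  qed
  have V: "integral {0..2*pi} (\<lambda>y. cmod (G (Complex (ln r) y)) powr p) = circle_mean p f r / r powr (m * p)"
    if "r > 0" for r
  proof -
    have e: "exp (Complex (ln r) y) = of_real r * cis y" for y
      using that by (simp add: Complex_eq exp_add cis_conv_exp exp_of_real mult.commute)
    have "cmod (exp (- (of_nat m * Complex (ln r) y))) = r powr (- real m)" for y
      using that by (simp add: powr_def)
    then have "cmod (G (Complex (ln r) y)) powr p = cmod (f (of_real r * cis y)) powr p * r powr (- (m * p))" for y
      using that by (simp add: G_def norm_mult e powr_mult powr_powr)
    then show ?thesis by (simp add: circle_mean_def powr_minus divide_inverse)
  qed
  have R: "R > 0" and r2: "r2 > 0" using r by auto
  define K where "K = max (circle_mean p f r1 / r1 powr (m * p)) (circle_mean p f r2 / r2 powr (m * p))"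
  have "ln R \<in> closed_segment (ln r1) (ln r2)"
    using r R r2 by (auto simp: closed_segment_eq_real_ivl)
  \<comment> \<open>R is the weighted geometric mean of r1 and r2.\<close>
  then obtain t where t: "0 \<le> t" "t \<le> 1" "ln R = (1 - t) *\<^sub>R ln r1 + t *\<^sub>R ln r2"
    by (auto simp: closed_segment_def)
  have "circle_mean p f R / R powr (m * p) \<le> (1 - t) * (circle_mean p f r1 / r1 powr (m * p)) + t * (circle_mean p f r2 / r2 powr (m * p))"
    using convex_onD[OF convex_on_vertical_mean[OF h per p] t(1,2), of "ln r1" "ln r2"]
    unfolding t(3)[symmetric] V[OF R] V[OF r2] V[OF r(1)] by simp
  also have "\<dots> \<le> (1 - t) * K + t * K"
    using t by (intro add_mono mult_left_mono) (auto simp: K_def)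
  finally show ?thesis by (simp add: K_def algebra_simps)
qed

section \<open>Growth on circles\<close>

lemma continuous_circle:
  assumes "f holomorphic_on UNIV"
  shows "continuous_on X (\<lambda>\<theta>. f (of_real r * cis \<theta>))"
  by (rule continuous_on_compose2[OF holomorphic_on_imp_continuous_on[OF assms]])
     (auto intro!: continuous_intros)

lemma norm_taylor_coeff_le:
  assumes hol: "f holomorphic_on UNIV" and r: "r > 0"
  shows "cmod ((deriv ^^ n) f 0 / fact n) * r ^ n \<le> circle_mean 1 f r / (2 * pi)"
proof -
  have "((\<lambda>u. f u / (u - 0) ^ Suc n) has_contour_integral (2 * pi * \<i>) / fact n * (deriv ^^ n) f 0) (circlepath 0 r)"
    using hol r by (intro Cauchy_has_contour_integral_higher_derivative_circlepath)
      (auto intro: holomorphic_on_subset holomorphic_on_imp_continuous_on)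
  then have I: "((\<lambda>t. f (r * cis t) / (r * cis t) ^ Suc n * r * \<i> * cis t) has_integral
      (2 * pi * \<i>) / fact n * (deriv ^^ n) f 0) {0..2*pi}"
    unfolding circlepath_def by (subst (asm) has_contour_integral_part_circlepath_iff) auto
  have J: "((\<lambda>\<theta>. cmod (f (r * cis \<theta>)) / r ^ n) has_integral (circle_mean 1 f r / r ^ n)) {0..2*pi}"
    unfolding circle_mean_def
    by (intro has_integral_divide) (auto intro!: integrable_integral integrable_continuous_interval continuous_intros continuous_circle hol)
  have "cmod ((2 * pi * \<i>) / fact n * (deriv ^^ n) f 0) \<le> circle_mean 1 f r / r ^ n"
    using r by (intro integral_norm_bound_integral[OF has_integral_integrable[OF I] has_integral_integrable[OF J], unfolded integral_unique[OF I] integral_unique[OF J]])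
      (auto simp: norm_mult norm_divide norm_power field_simps)
  then show ?thesis using r
    by (simp add: norm_mult norm_divide field_simps)
qed

text \<open>The Taylor terms of degree at least \<open>m\<close> are estimated on the larger circle, the remaining ones on
  the smaller circle; after division by \<open>R ^ m\<close> both parts are geometric series.\<close>

lemma norm_le_two_circles:
  assumes hol: "f holomorphic_on UNIV" and r: "0 < r1" "r1 < R" "R < r2" and z: "cmod z = R"
  shows "cmod (f z) / R ^ m \<le> (r2 / (r2 - R) * (circle_mean 1 f r2 / r2 ^ m)
      + R / (R - r1) * (circle_mean 1 f r1 / r1 ^ m)) / (2 * pi)"
proof -
  define a where "a n = (deriv ^^ n) f 0 / fact n" for n
  define M where "M r = circle_mean 1 f r / (2 * pi)" for r
  have R: "R > 0" "r2 > 0" using r by auto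
  have M0: "M r \<ge> 0" for r unfolding M_def circle_mean_def by (auto intro!: divide_nonneg_pos integral_nonneg
     integrable_continuous_interval continuous_intros continuous_circle hol)
  have aM: "cmod (a n) * r ^ n \<le> M r" if "r > 0" for n r
    using norm_taylor_coeff_le[OF hol that] by (simp add: a_def M_def)
  have sums: "(\<lambda>n. a n * z ^ n) sums f z"
    using holomorphic_power_series[of f 0 "R + 1" z] hol z
    by (auto simp: a_def intro: holomorphic_on_subset)
  have g: "(\<lambda>n. M r2 / r2 ^ m * (R / r2) ^ n) sums (M r2 / r2 ^ m * (1 / (1 - R / r2)))"
    using r R by (intro sums_mult geometric_sums) auto
  have tail: "cmod (a (n + m) * z ^ (n + m)) \<le> R ^ m * (M r2 / r2 ^ m * (R / r2) ^ n)" for n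
    using aM[of r2 "n + m"] R by (simp add: norm_mult norm_power z power_add field_simps) 
  have sg: "summable (\<lambda>n. R ^ m * (M r2 / r2 ^ m * (R / r2) ^ n))"
    by (rule summable_mult[OF sums_summable[OF g]])
  have sn: "summable (\<lambda>n. cmod (a (n + m) * z ^ (n + m)))"
    by (rule summable_comparison_test'[OF sg, of 0]) (use tail in auto)
  have "cmod (f z) \<le> cmod (\<Sum>n. a (n + m) * z ^ (n + m)) + cmod (\<Sum>n<m. a n * z ^ n)"
    using suminf_split_initial_segment[OF sums_summable[OF sums], of m] sums_unique[OF sums]
    by (simp add: norm_triangle_ineq)
  also have "cmod (\<Sum>n. a (n + m) * z ^ (n + m)) \<le> (\<Sum>n. R ^ m * (M r2 / r2 ^ m * (R / r2) ^ n))"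
    using sn sg tail by (intro order_trans[OF summable_norm] suminf_le) auto
  also have "\<dots> = R ^ m * (r2 / (r2 - R) * (M r2 / r2 ^ m))"
    using R r by (simp only: suminf_mult[OF sums_summable[OF g]] sums_unique[OF g, symmetric]) (simp add: field_simps)
  also have "cmod (\<Sum>n<m. a n * z ^ n) \<le> (\<Sum>n<m. M r1 / r1 ^ n * R ^ n)"
    using aM[OF r(1)] r R by (intro sum_norm_le) (auto simp: norm_mult norm_power z field_simps)
  also have "\<dots> = M r1 * (\<Sum>n<m. (R / r1) ^ n)"
    by (simp add: sum_distrib_left power_divide)
  also have "\<dots> = M r1 * (((R / r1) ^ m - 1) / (R / r1 - 1))"
    using r by (subst geometric_sum) auto
  also have "\<dots> \<le> M r1 * ((R / r1) ^ m / (R / r1 - 1))"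
    using r M0 by (intro mult_left_mono divide_right_mono) auto
  also have "\<dots> = R ^ m * (r1 / (R - r1) * (M r1 / r1 ^ m))"
    using r by (simp add: field_simps)
  also have "\<dots> \<le> R ^ m * (R / (R - r1) * (M r1 / r1 ^ m))"
    using r M0 R by (intro mult_left_mono mult_right_mono divide_right_mono) (auto intro!: divide_nonneg_pos)
  finally have "cmod (f z) \<le> R ^ m * (r2 / (r2 - R) * (M r2 / r2 ^ m)) + R ^ m * (R / (R - r1) * (M r1 / r1 ^ m))"
    by simp
  then have "cmod (f z) \<le> (r2 / (r2 - R) * (M r2 / r2 ^ m) + R / (R - r1) * (M r1 / r1 ^ m)) * R ^ m"
    by (metis distrib_left mult.commute)
  then have "cmod (f z) / R ^ m \<le> r2 / (r2 - R) * (M r2 / r2 ^ m) + R / (R - r1) * (M r1 / r1 ^ m)"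
    using R by (simp only: pos_divide_le_eq[OF zero_less_power])
  also have "\<dots> = (r2 / (r2 - R) * (circle_mean 1 f r2 / r2 ^ m)
      + R / (R - r1) * (circle_mean 1 f r1 / r1 ^ m)) / (2 * pi)"
    by (simp add: M_def add_divide_distrib mult_ac)
  finally show ?thesis .
qed

text \<open>The supremum version of the three circles estimate: the maximum modulus principle for
  f(z) / z^m on the annulus, whose closure avoids 0.\<close>

lemma norm_le_max_two_circles:
  assumes hol: "f holomorphic_on UNIV" and r: "0 < r1" "r1 \<le> R" "R \<le> r2" and z: "cmod z = R"
    and B1: "\<And>z. cmod z = r1 \<Longrightarrow> cmod (f z) / r1 ^ m \<le> B"
    and B2: "\<And>z. cmod z = r2 \<Longrightarrow> cmod (f z) / r2 ^ m \<le> B"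
  shows "cmod (f z) / R ^ m \<le> B"
proof (cases "R = r1 \<or> R = r2")
  case True
  then show ?thesis using B1[of z] B2[of z] z by auto
next
  case False
  define S where "S = ball 0 r2 - cball (0::complex) r1"
  have o: "open S" unfolding S_def by auto
  have cl: "closure S \<subseteq> cball 0 r2 - ball 0 r1"
    using r by (intro closure_minimal) (auto simp: S_def)
  have nz: "w \<noteq> 0" if "w \<in> closure S" for w using that cl r by auto
  have "cmod (f z / z ^ m) \<le> B"
  proof (rule maximum_modulus_frontier[where f = "\<lambda>z. f z / z ^ m" and S = S and \<xi> = z])
    have h: "(\<lambda>z. f z / z ^ m) holomorphic_on closure S"
      using hol nz by (auto intro!: holomorphic_intros intro: holomorphic_on_subset)
    then show "(\<lambda>z. f z / z ^ m) holomorphic_on interior S"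
      by (rule holomorphic_on_subset) (meson closure_subset dual_order.trans interior_subset)
    show "continuous_on (closure S) (\<lambda>z. f z / z ^ m)"
      using h by (rule holomorphic_on_imp_continuous_on)
    show "bounded S" unfolding S_def by (auto intro: bounded_diff)
    show "z \<in> S" using False z r by (auto simp: S_def)
    fix w assume "w \<in> frontier S"
    then have "w \<in> cball 0 r2 - ball 0 r1" "w \<notin> ball 0 r2 - cball 0 r1"
      using cl o by (auto simp: frontier_def interior_open S_def)
    then have "cmod w = r1 \<or> cmod w = r2" by auto
    then show "cmod (f w / w ^ m) \<le> B" using B1[of w] B2[of w] by (auto simp: norm_divide norm_power)
  qed
  then show ?thesis by (simp add: norm_divide norm_power z)
qed

section \<open>Integral means: positivity, monotonicity, measurability, comparison of
  exponents\<close>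

lemma circle_mean_integrable:
  assumes "f holomorphic_on UNIV" "p > 0"
  shows "(\<lambda>\<theta>. cmod (f (of_real r * cis \<theta>)) powr p) integrable_on {0..2*pi}"
  using assms by (intro integrable_continuous_interval continuous_on_powr' continuous_intros continuous_circle) auto

lemma circle_mean_nonneg: 
  assumes "f holomorphic_on UNIV" "p > 0"
  shows "circle_mean p f r \<ge> 0"
  unfolding circle_mean_def by (intro integral_nonneg circle_mean_integrable assms) auto

lemma integral_mean_finite:
  assumes hol: "f holomorphic_on UNIV" and p: "p > 0"
  shows "integral_mean (ereal p) f r = (circle_mean p f r / (2 * pi)) powr (1 / p)"
proof -
  have "set_integrable lborel {0..2*pi} (\<lambda>\<theta>. cmod (f (of_real r * cis \<theta>)) powr p)"
    using p by (intro borel_integrable_atLeastAtMost' continuous_on_powr' continuous_intros continuous_circle hol) auto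
  from set_borel_integral_eq_integral(2)[OF this] show ?thesis
    by (simp add: integral_mean_def circle_mean_def)
qed

lemma integral_mean_nonneg_finite: "p \<noteq> \<infinity> \<Longrightarrow> integral_mean p f r \<ge> 0"
  by (simp add: integral_mean_def)

lemma integral_mean_powr:
  assumes hol: "f holomorphic_on UNIV" and p: "p > 0"
  shows "integral_mean (ereal p) f r powr p = circle_mean p f r / (2 * pi)"
  using circle_mean_nonneg[OF assms, of r] p by (simp add: integral_mean_finite[OF assms] powr_powr)

lemma norm_le_integral_mean_infinity:
  assumes hol: "f holomorphic_on UNIV" and z: "cmod z = r"
  shows "cmod (f z) \<le> integral_mean \<infinity> f r"
proof -
  have "bdd_above ((\<lambda>\<theta>. cmod (f (of_real r * cis \<theta>))) ` {0..2*pi})"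
    by (intro bounded_imp_bdd_above compact_imp_bounded compact_continuous_image continuous_intros continuous_circle hol) auto
  moreover obtain t where t: "0 \<le> t" "t < 2 * pi" "z = of_real r * cis t"
    using z Arg2pi_ge_0[of z] Arg2pi_lt_2pi[of z] Arg2pi_eq[of z] by (metis cis_conv_exp)
  ultimately show ?thesis
    using cSUP_upper[of t "{0..2*pi}" "\<lambda>\<theta>. cmod (f (of_real r * cis \<theta>))"] by (simp add: integral_mean_def)
qed

lemma integral_mean_infinity_le:
  assumes "\<And>z. cmod z = \<bar>r\<bar> \<Longrightarrow> cmod (f z) \<le> B"
  shows "integral_mean \<infinity> f r \<le> B"
  using assms by (auto simp: integral_mean_def norm_mult intro!: cSUP_least)

lemma integral_mean_nonneg:
  assumes hol: "f holomorphic_on UNIV" and r: "r \<ge> 0"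
  shows "integral_mean p f r \<ge> 0"
proof (cases "p = \<infinity>")
  case True
  then show ?thesis using order_trans[OF norm_ge_zero norm_le_integral_mean_infinity[OF hol, of "of_real r" r]] r by simp
qed (simp add: integral_mean_nonneg_finite)

lemma integral_mean_leI:
  assumes hol: "f holomorphic_on UNIV" and p: "p > 0" and r: "r \<ge> 0"
    and B: "\<And>z. cmod z = r \<Longrightarrow> cmod (f z) \<le> B"
  shows "integral_mean p f r \<le> B"
proof (cases p)
  case (real s)
  have s: "s > 0" using p real by simp
  have B0: "B \<ge> 0" using order_trans[OF norm_ge_zero B[of "of_real r"]] r by simp
  have "circle_mean s f r \<le> integral {0..2*pi} (\<lambda>_. B powr s)"
    unfolding circle_mean_def
    using s r by (intro integral_le circle_mean_integrable hol powr_mono2 B) (auto simp: norm_mult)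
  then have "circle_mean s f r / (2 * pi) \<le> B powr s" by (simp add: field_simps)
  then have "(circle_mean s f r / (2 * pi)) powr (1 / s) \<le> (B powr s) powr (1 / s)"
    using s circle_mean_nonneg[OF hol s] by (intro powr_mono2) auto
  then show ?thesis using s B0 by (simp add: real integral_mean_finite[OF hol s] powr_powr)
next
  case PInf
  then show ?thesis using integral_mean_infinity_le[of r f B] B r by simp
qed (use p in auto)

lemma integral_mean_le_infinity:
  assumes "f holomorphic_on UNIV" "p > 0" "r \<ge> 0"
  shows "integral_mean p f r \<le> integral_mean \<infinity> f r"
  using assms by (intro integral_mean_leI norm_le_integral_mean_infinity)

lemma integral_mean_infinity_mono:
  assumes hol: "f holomorphic_on UNIV" and r: "0 \<le> r" "r \<le> R"
  shows "integral_mean \<infinity> f r \<le> integral_mean \<infinity> f R"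
proof (cases "R = 0 \<or> r = R")
  case False
  then have R: "R > 0" "r < R" using r by auto
  show ?thesis
  proof (rule integral_mean_leI[OF hol])
    fix z assume z: "cmod z = r"
    show "cmod (f z) \<le> integral_mean \<infinity> f R"
      using hol R z
      by (intro maximum_modulus_frontier[where f = f and S = "ball 0 R" and \<xi> = z])
        (auto intro: holomorphic_on_subset holomorphic_on_imp_continuous_on norm_le_integral_mean_infinity[OF hol] continuous_on_subset)
  qed (use r in auto)
qed (use r in auto)

lemma integral_mean_three_circles:
  assumes hol: "f holomorphic_on UNIV" and p: "p > 0" and r: "0 < r1" "r1 \<le> R" "R \<le> r2"
  shows "integral_mean p f R / R ^ m \<le> max (integral_mean p f r1 / r1 ^ m) (integral_mean p f r2 / r2 ^ m)" (is "_ \<le> ?B")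
proof (cases p)
  case (real s)
  have s: "s > 0" using p real by simp
  have conv: "integral_mean p f r / r ^ m = (circle_mean s f r / r powr (m * s) / (2 * pi)) powr (1 / s)" if "r > 0" for r
    using that s circle_mean_nonneg[OF hol s]
    by (simp add: real integral_mean_finite[OF hol s] powr_divide powr_powr powr_mult powr_realpow)
  have R: "R > 0" "r2 > 0" using r by auto
  have mx: "max (x powr (1/s)) (y powr (1/s)) = max x y powr (1/s)" if "x \<ge> 0" "y \<ge> 0" for x y
    using that s powr_mono2[of "1/s" x y] powr_mono2[of "1/s" y x] by (auto simp: max_def)
  have aux: "x / (2 * pi) \<le> max (y / (2 * pi)) (z / (2 * pi))" if "x \<le> max y z" for x y z
    using that by (auto simp: le_max_iff_disj divide_right_mono)
  show ?thesis
    unfolding conv[OF R(1)] conv[OF R(2)] conv[OF r(1)]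
    using aux[OF circle_mean_three_circles[OF hol s r, of m]] circle_mean_nonneg[OF hol s] s R r
    by (subst mx) (auto intro!: powr_mono2)
next
  case PInf
  have "integral_mean \<infinity> f R \<le> ?B * R ^ m"
  proof (rule integral_mean_infinity_le)
    fix z assume "cmod z = \<bar>R\<bar>"
    have le: "cmod (f w) / r ^ m \<le> integral_mean \<infinity> f r / r ^ m" if "cmod w = r" for w r
      using norm_le_integral_mean_infinity[OF hol that] that by (auto intro: divide_right_mono)
    note \<open>cmod z = \<bar>R\<bar>\<close>
    then have "cmod (f z) / R ^ m \<le> ?B"
      using r PInf by (intro norm_le_max_two_circles[OF hol r])
        (auto intro: le max.coboundedI1 max.coboundedI2)
    then show "cmod (f z) \<le> ?B * R ^ m" using r by (simp add: field_simps)
  qed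
  then show ?thesis using r PInf by (simp add: field_simps)
qed (use p in auto)

lemma borel_measurable_integral_mean [measurable]:
  assumes hol: "f holomorphic_on UNIV" and p: "p > 0"
  shows "integral_mean p f \<in> borel_measurable borel"
proof (cases p)
  case (real s)
  have s: "s > 0" using p real by simp
  have "continuous_on UNIV (circle_mean s f)"
    unfolding circle_mean_def[abs_def] cbox_interval[symmetric]
  proof (rule integral_continuous_on_param)
    have "continuous_on UNIV (\<lambda>z::real\<times>real. f (of_real (fst z) * cis (snd z)))"
      by (rule continuous_on_compose2[OF holomorphic_on_imp_continuous_on[OF hol]])
         (auto intro!: continuous_intros)
    then show "continuous_on (UNIV \<times> cbox 0 (2 * pi)) (\<lambda>(r, \<theta>). cmod (f (of_real r * cis \<theta>)) powr s)"
      unfolding split_beta using s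
      by (intro continuous_on_powr' continuous_intros) (auto intro: continuous_on_subset)
  qed
  then have [measurable]: "circle_mean s f \<in> borel_measurable borel"
    by (rule borel_measurable_continuous_onI)
  have "(\<lambda>r. (circle_mean s f r / (2 * pi)) powr (1 / s)) \<in> borel_measurable borel"
    by measurable
  then show ?thesis by (simp add: real integral_mean_finite[OF hol s, abs_def])
next
  case PInf
  \<comment> \<open>A supremum of continuous functions of r is lower semicontinuous, so its
    superlevel sets are open.\<close>
  have "open {r. a < integral_mean \<infinity> f r}" for a
  proof -
    have "bdd_above ((\<lambda>\<theta>. cmod (f (of_real r * cis \<theta>))) ` {0..2*pi})" for r
      by (intro bounded_imp_bdd_above compact_imp_bounded compact_continuous_image continuous_intros continuous_circle hol) auto
    then have "{r. a < integral_mean \<infinity> f r} = (\<Union>\<theta>\<in>{0..2*pi}. {r. a < cmod (f (of_real r * cis \<theta>))})"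
      by (auto simp: integral_mean_def less_cSUP_iff)
    also have "open \<dots>"
    proof (intro open_UN ballI)
      fix \<theta> :: real
      have "continuous_on UNIV (\<lambda>r. f (of_real r * cis \<theta>))"
        by (rule continuous_on_compose2[OF holomorphic_on_imp_continuous_on[OF hol]])
           (auto intro!: continuous_intros)
      then show "open {r. a < cmod (f (of_real r * cis \<theta>))}"
        by (intro open_Collect_less continuous_intros)
    qed
    finally show ?thesis .
  qed
  then show ?thesis unfolding PInf borel_measurable_iff_greater by auto
qed (use p in auto)

text \<open>An elementary replacement for Jensen's inequality, at the price of the factor 2 powr
  (1/p): splitting at x = L gives x powr p \<le> L powr p + L powr (p - q) * x powr q, and both
  terms have mean at most L powr p when L is at least the q-mean. The small summand in L keeps it
  positive when f vanishes on the circle.\<close>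

lemma integral_mean_power_mono:
  assumes hol: "f holomorphic_on UNIV" and p: "0 < p" "p \<le> q" and r: "r \<ge> 0"
  shows "integral_mean (ereal p) f r \<le> 2 powr (1 / p) * integral_mean (ereal q) f r"
proof (rule field_le_epsilon)
  fix e :: real assume e: "e > 0"
  define L where "L = integral_mean (ereal q) f r + e / 2 powr (1 / p)"
  have q: "q > 0" using p by simp
  have L: "L > 0" "integral_mean (ereal q) f r \<le> L" 
    using e integral_mean_nonneg[OF hol r, of "ereal q"] by (auto simp: L_def intro!: add_nonneg_pos)
  have "circle_mean q f r / (2 * pi) \<le> L powr q"
    unfolding integral_mean_powr[OF hol q, symmetric] 
    using L q integral_mean_nonneg[OF hol r] by (intro powr_mono2) auto
  then have cL: "circle_mean q f r \<le> 2 * pi * L powr q" by (simp add: field_simps)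
  have pt: "x powr p \<le> L powr p + L powr (p - q) * x powr q" if "x \<ge> 0" for x
  proof (cases "x \<le> L")
    case True
    then show ?thesis using that p by (simp add: powr_mono2 add_increasing2)
  next
    case False
    then have "x powr p = x powr (p - q) * x powr q" using L by (simp flip: powr_add)
    also have "\<dots> \<le> L powr (p - q) * x powr q"
      using False L p by (intro mult_right_mono powr_mono2') auto
    finally show ?thesis by (simp add: add_increasing)
  qed
  have "circle_mean p f r \<le> integral {0..2*pi} (\<lambda>\<theta>. L powr p + L powr (p - q) * cmod (f (of_real r * cis \<theta>)) powr q)"
    unfolding circle_mean_def
    by (intro integral_le circle_mean_integrable hol p pt integrable_add integrable_on_mult_right q) auto
  also have "\<dots> = 2 * pi * L powr p + L powr (p - q) * circle_mean q f r"
    unfolding circle_mean_def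
    by (subst integral_add) (auto intro!: circle_mean_integrable hol q integrable_on_mult_right)
  also have "\<dots> \<le> 2 * pi * L powr p + L powr (p - q) * (2 * pi * L powr q)"
    by (intro add_left_mono mult_left_mono cL) auto
  also have "\<dots> = 2 * pi * (2 * L powr p)"
    using L powr_add[of L "p - q" q] by simp
  finally have "circle_mean p f r / (2 * pi) \<le> 2 * L powr p" by (simp add: field_simps)
  then have "integral_mean (ereal p) f r \<le> (2 * L powr p) powr (1 / p)"
    unfolding integral_mean_finite[OF hol p(1)]
    using p circle_mean_nonneg[OF hol p(1)] by (intro powr_mono2) auto
  also have "\<dots> = 2 powr (1 / p) * L" using L p by (simp add: powr_mult powr_powr)
  finally show "integral_mean (ereal p) f r \<le> 2 powr (1 / p) * integral_mean (ereal q) f r + e"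
    by (simp add: L_def algebra_simps)
qed

lemma circle_mean_interpolation:
  assumes hol: "f holomorphic_on UNIV" and p: "0 < p" "p \<le> q" and r: "r \<ge> 0"
  shows "circle_mean q f r \<le> integral_mean \<infinity> f r powr (q - p) * circle_mean p f r"
proof -
  have "circle_mean q f r \<le> integral {0..2*pi} (\<lambda>\<theta>. integral_mean \<infinity> f r powr (q - p) * cmod (f (of_real r * cis \<theta>)) powr p)"
    unfolding circle_mean_def
  proof (intro integral_le circle_mean_integrable hol integrable_on_mult_right)
    fix \<theta> :: real
    have "cmod (f (of_real r * cis \<theta>)) powr q = cmod (f (of_real r * cis \<theta>)) powr (q - p) * cmod (f (of_real r * cis \<theta>)) powr p"
      by (simp flip: powr_add)
    also have "\<dots> \<le> integral_mean \<infinity> f r powr (q - p) * cmod (f (of_real r * cis \<theta>)) powr p"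
      using p r by (intro mult_right_mono powr_mono2 norm_le_integral_mean_infinity[OF hol]) (auto simp: norm_mult)
    finally show "cmod (f (of_real r * cis \<theta>)) powr q \<le> integral_mean \<infinity> f r powr (q - p) * cmod (f (of_real r * cis \<theta>)) powr p" .
  qed (use p in auto)
  also have "\<dots> = integral_mean \<infinity> f r powr (q - p) * circle_mean p f r"
    by (simp add: circle_mean_def)
  finally show ?thesis .
qed

text \<open>The Taylor coefficient estimates are bounds by the mean of exponent 1; applied to f^k
  they give bounds by the mean of exponent k.\<close>

lemma circle_mean_power: "circle_mean 1 (\<lambda>z. f z ^ k) r = circle_mean (real k) f r" if "k > 0"
proof -
  have "cmod w ^ k = cmod w powr real k" for w
    using that by (cases "w = 0") (auto simp: powr_realpow)
  then show ?thesis by (simp add: circle_mean_def norm_power)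
qed

section \<open>Local estimates for Gaussian-weighted means\<close>

definition fock_mean :: "real \<Rightarrow> ereal \<Rightarrow> (complex \<Rightarrow> complex) \<Rightarrow> real \<Rightarrow> real" where
  "fock_mean \<alpha> p f r = integral_mean p f r * exp (- (\<alpha> / 2) * r\<^sup>2)"

lemma fock_mean_nonneg: "f holomorphic_on UNIV \<Longrightarrow> r \<ge> 0 \<Longrightarrow> fock_mean \<alpha> p f r \<ge> 0"
  by (simp add: fock_mean_def integral_mean_nonneg)

text \<open>Near \<open>|z| = R\<close> the Gaussian weight is comparable to the modulus of the monomial of degree
  \<open>m \<approx> \<alpha> R\<^sup>2\<close>: the logarithms of both sides agree to first order at \<open>r = R\<close>.\<close>

lemma gaussian_monomial_comparison:
  fixes \<alpha> R r :: real
  assumes a: "\<alpha> > 0" and R: "R \<ge> 2" and r: "\<bar>r - R\<bar> \<le> 1"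
  defines "m \<equiv> nat \<lfloor>\<alpha> * R\<^sup>2\<rfloor>"
  shows "R ^ m * exp (- (\<alpha> / 2) * R\<^sup>2) / r ^ m \<le> 2 * exp (5 * \<alpha> / 2) * exp (- (\<alpha> / 2) * r\<^sup>2)"
proof -
  define u where "u = (r - R) / R"
  have rR: "r = R * (1 + u)" using R by (simp add: u_def field_simps)
  have uR: "(R * u)\<^sup>2 \<le> 1" using r R by (simp add: u_def abs_square_le_1)
  have u: "\<bar>u\<bar> \<le> 1 / 2" using r R by (simp add: u_def abs_divide field_simps)
  have pos: "1 + u > 0" "r > 0" "R > 0" using u r R by auto
  \<comment> \<open>The rounding error in the degree; since 1 + u \<le> 2 it costs at most the
    factor 2.\<close>
  define \<tau> where "\<tau> = \<alpha> * R\<^sup>2 - m"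
  have mm: "real m = of_int \<lfloor>\<alpha> * R\<^sup>2\<rfloor>" using a by (simp add: m_def)
  have tau: "0 \<le> \<tau>" "\<tau> \<le> 1" unfolding \<tau>_def mm by linarith+
  have lnu: "ln (1 + u) \<le> ln 2" using u pos by (subst ln_le_cancel_iff) (simp_all add: abs_le_iff)
  have "\<tau> * ln (1 + u) \<le> \<tau> * ln 2"
    using tau lnu by (intro mult_left_mono)
  also have "\<dots> \<le> 1 * ln 2" using tau by (intro mult_right_mono) auto
  finally have 1: "\<tau> * ln (1 + u) \<le> ln 2" by simp
  \<comment> \<open>The terms linear in u cancel against those of r^2. The quadratic remainders are
    2 u^2 from the logarithm and u^2 / 2 from r^2, which is the origin of 5/2.\<close>
  have "- ln (1 + u) \<le> - u + 2 * u\<^sup>2"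
    using abs_ln_one_plus_x_minus_x_bound[OF u] by (simp add: abs_le_iff)
  then have "\<alpha> * R\<^sup>2 * (- ln (1 + u)) \<le> \<alpha> * R\<^sup>2 * (- u + 2 * u\<^sup>2)"
    using a by (intro mult_left_mono) auto
  moreover have "\<alpha> * (5/2 * (R * u)\<^sup>2) \<le> \<alpha> * (5/2 * 1)" using a uR by (intro mult_left_mono) auto
  ultimately have "- (\<alpha> * R\<^sup>2) * ln (1 + u) - \<alpha> / 2 * R\<^sup>2 \<le> 5 * \<alpha> / 2 - \<alpha> / 2 * r\<^sup>2"
    unfolding rR by (simp add: algebra_simps power2_eq_square)
  with 1 have *: "- (m * ln (1 + u)) - \<alpha> / 2 * R\<^sup>2 \<le> ln 2 + 5 * \<alpha> / 2 - \<alpha> / 2 * r\<^sup>2"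
    unfolding \<tau>_def by (simp add: algebra_simps)
  have "R ^ m / r ^ m = (1 + u) powr (- real m)"
    using pos unfolding rR power_mult_distrib by (simp add: powr_minus powr_realpow divide_inverse)
  also have "\<dots> = exp (- (m * ln (1 + u)))"
    using pos by (simp add: powr_def)
  finally have q: "R ^ m / r ^ m = exp (- (m * ln (1 + u)))" .
  have "R ^ m * exp (- (\<alpha> / 2) * R\<^sup>2) / r ^ m = R ^ m / r ^ m * exp (- (\<alpha> / 2) * R\<^sup>2)"
    by simp
  also have "\<dots> = exp (- (m * ln (1 + u)) - \<alpha> / 2 * R\<^sup>2)"
    unfolding q by (simp flip: exp_add)
  also have "\<dots> \<le> exp (ln 2 + 5 * \<alpha> / 2 - \<alpha> / 2 * r\<^sup>2)" using * by simp
  also have "\<dots> = 2 * exp (5 * \<alpha> / 2) * exp (- (\<alpha> / 2) * r\<^sup>2)"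
  proof -
    have "exp (ln 2 + 5 * \<alpha> / 2 - \<alpha> / 2 * r\<^sup>2) = exp (ln 2) * exp (5 * \<alpha> / 2) * exp (- (\<alpha> / 2) * r\<^sup>2)"
      unfolding exp_add[symmetric] by simp
    then show ?thesis by simp
  qed
  finally show ?thesis .
qed

lemma fock_mean_le_max:
  assumes hol: "f holomorphic_on UNIV" and p: "p > 0" and a: "\<alpha> > 0" and R: "R \<ge> 2" and t: "0 \<le> t" "t \<le> 1"
  shows "fock_mean \<alpha> p f R \<le> 2 * exp (5 * \<alpha> / 2) * max (fock_mean \<alpha> p f (R - t)) (fock_mean \<alpha> p f (R + t))"
proof -
  define m where "m = nat \<lfloor>\<alpha> * R\<^sup>2\<rfloor>"
  let ?E = "R ^ m * exp (- (\<alpha> / 2) * R\<^sup>2)" let ?C = "2 * exp (5 * \<alpha> / 2)"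
  have 1: "?E * (integral_mean p f r / r ^ m) \<le> ?C * fock_mean \<alpha> p f r" if "\<bar>r - R\<bar> \<le> 1" for r
  proof -
    have "integral_mean p f r \<ge> 0" using that R by (intro integral_mean_nonneg hol) auto
    from mult_left_mono[OF gaussian_monomial_comparison[OF a R that] this] show ?thesis
      by (simp add: m_def fock_mean_def mult_ac)
  qed
  have "fock_mean \<alpha> p f R = ?E * (integral_mean p f R / R ^ m)"
    using R by (simp add: fock_mean_def)
  also have "\<dots> \<le> ?E * max (integral_mean p f (R - t) / (R - t) ^ m) (integral_mean p f (R + t) / (R + t) ^ m)"
    using R t by (intro mult_left_mono integral_mean_three_circles hol p) auto
  also have "\<dots> = max (?E * (integral_mean p f (R - t) / (R - t) ^ m)) (?E * (integral_mean p f (R + t) / (R + t) ^ m))"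
    using R by (simp add: max_mult_distrib_left)
  also have "\<dots> \<le> max (?C * fock_mean \<alpha> p f (R - t)) (?C * fock_mean \<alpha> p f (R + t))"
    using t by (intro max.mono 1) auto
  also have "\<dots> = ?C * max (fock_mean \<alpha> p f (R - t)) (fock_mean \<alpha> p f (R + t))"
    by (simp add: max_mult_distrib_left)
  finally show ?thesis .
qed

text \<open>\<open>norm_le_two_circles\<close> is applied to f^k, an integer power being again
  entire, and |f|^k is split into |f| powr (k - p), estimated by the supremum, and |f| powr p. The
  factor R / d is the size of the two geometric series. The half-width d stays free so that the
  estimate can be used close to the ends of a window of fixed width.\<close>

lemma fock_mean_infinity_power_le:
  assumes hol: "f holomorphic_on UNIV" and p: "0 < p" "p \<le> real k" and a: "\<alpha> > 0" and R: "R \<ge> 2" and d: "0 < d" "d \<le> 1"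
    and A: "\<And>r. r = R - d \<or> r = R + d \<Longrightarrow> fock_mean \<alpha> \<infinity> f r \<le> A"
    and S: "\<And>r. r = R - d \<or> r = R + d \<Longrightarrow> fock_mean \<alpha> (ereal p) f r \<le> S"
  shows "fock_mean \<alpha> \<infinity> f R ^ k \<le> 8 * exp (5 * (k * \<alpha>) / 2) * (R / d) * (A powr (k - p) * S powr p)"
proof -
  have k: "k > 0" using p by (cases k) auto
  \<comment> \<open>The weight belonging to |f|^k is the k-th power of the weight of f, so the
    comparison degree m is fitted to k \<alpha> R^2.\<close>
  define b where "b = k * \<alpha>"
  have b: "b > 0" using k a by (simp add: b_def)
  define m where "m = nat \<lfloor>b * R\<^sup>2\<rfloor>"
  let ?E = "R ^ m * exp (- (b / 2) * R\<^sup>2)" let ?C = "2 * exp (5 * b / 2)"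
  define Q where "Q = A powr (k - p) * S powr p"
  have 1: "?E * (circle_mean k f r / (2 * pi) / r ^ m) \<le> ?C * Q" if r: "r = R - d \<or> r = R + d" for r
  proof -
    have r0: "r > 0" using r R d by auto
    note nn = integral_mean_nonneg[OF hol less_imp_le[OF r0]]
    have "circle_mean k f r / (2 * pi) \<le> integral_mean \<infinity> f r powr (k - p) * (circle_mean p f r / (2 * pi))"
      using circle_mean_interpolation[OF hol p, of r] r0 by (simp add: divide_right_mono)
    also have "\<dots> = integral_mean \<infinity> f r powr (k - p) * integral_mean p f r powr p"
      by (simp add: integral_mean_powr[OF hol p(1)])
    finally have 2: "circle_mean k f r / (2 * pi) \<le> integral_mean \<infinity> f r powr (k - p) * integral_mean p f r powr p" .
    have "?E * (circle_mean k f r / (2 * pi) / r ^ m) = (?E / r ^ m) * (circle_mean k f r / (2 * pi))"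
      by simp
    also have "\<dots> \<le> (?C * exp (- (b / 2) * r\<^sup>2)) * (integral_mean \<infinity> f r powr (k - p) * integral_mean p f r powr p)"
      unfolding m_def using r r0 R d k circle_mean_nonneg[OF hol, of k r]
      by (intro mult_mono gaussian_monomial_comparison[OF b R] 2) auto
    also have "exp (- (b / 2) * r\<^sup>2) = exp (- (\<alpha> / 2) * r\<^sup>2) powr (k - p) * exp (- (\<alpha> / 2) * r\<^sup>2) powr p"
      by (simp add: b_def powr_def flip: exp_add) (simp add: field_simps)
    also have "?C * (exp (- (\<alpha> / 2) * r\<^sup>2) powr (k - p) * exp (- (\<alpha> / 2) * r\<^sup>2) powr p) *
        (integral_mean \<infinity> f r powr (k - p) * integral_mean p f r powr p)
        = ?C * (fock_mean \<alpha> \<infinity> f r powr (k - p) * fock_mean \<alpha> p f r powr p)"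
      using nn by (simp add: fock_mean_def powr_mult mult_ac)
    also have "\<dots> \<le> ?C * Q" unfolding Q_def
      using p r0 by (intro mult_left_mono mult_mono powr_mono2 A[OF r] S[OF r] fock_mean_nonneg hol) auto
    finally show ?thesis .
  qed
  have Q0: "Q \<ge> 0" by (simp add: Q_def)
  have 2: "integral_mean \<infinity> f R ^ k / R ^ m * ?E \<le> 4 * R / d * (?C * Q)"
  proof -
    have hk: "(\<lambda>z. f z ^ k) holomorphic_on UNIV" by (intro holomorphic_intros hol)
    define T where "T = (R + d) / d * (circle_mean k f (R + d) / (2 * pi) / (R + d) ^ m) +
        R / d * (circle_mean k f (R - d) / (2 * pi) / (R - d) ^ m)"
    have T: "cmod (f z) ^ k / R ^ m \<le> T" if "cmod z = R" for z
      using norm_le_two_circles[OF hk, of "R - d" R "R + d" z m] R d that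
      by (simp add: T_def circle_mean_power[OF k] norm_power add_divide_distrib mult_ac)
    have T0: "T \<ge> 0" unfolding T_def using R d k
      by (intro add_nonneg_nonneg mult_nonneg_nonneg divide_nonneg_nonneg circle_mean_nonneg hol) auto
    have "integral_mean \<infinity> f R \<le> (R ^ m * T) powr (1 / k)"
    proof (rule integral_mean_infinity_le)
      fix z assume "cmod z = \<bar>R\<bar>"
      then have "cmod (f z) ^ k \<le> R ^ m * T" using T[of z] R by (simp add: field_simps)
      then have "(cmod (f z) ^ k) powr (1 / k) \<le> (R ^ m * T) powr (1 / k)"
        by (intro powr_mono2) auto
      then show "cmod (f z) \<le> (R ^ m * T) powr (1 / k)"
        using k by (cases "f z = 0") (auto simp: powr_powr simp flip: powr_realpow)
    qed
    then have "integral_mean \<infinity> f R ^ k \<le> ((R ^ m * T) powr (1 / k)) ^ k"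
      using R by (intro power_mono integral_mean_nonneg hol) auto
    also have "\<dots> = R ^ m * T"
      using k T0 R by (cases "R ^ m * T = 0") (auto simp: powr_powr simp flip: powr_realpow)
    finally have "integral_mean \<infinity> f R ^ k / R ^ m * ?E \<le> T * ?E"
      using R by (intro mult_right_mono) (auto simp: field_simps)
    also have "\<dots> = (R + d) / d * (?E * (circle_mean k f (R + d) / (2 * pi) / (R + d) ^ m)) +
        R / d * (?E * (circle_mean k f (R - d) / (2 * pi) / (R - d) ^ m))"
      by (simp add: T_def algebra_simps)
    also have "\<dots> \<le> (R + d) / d * (?C * Q) + R / d * (?C * Q)"
      using R d by (intro add_mono mult_left_mono 1) auto
    also have "\<dots> = ((R + d) / d + R / d) * (?C * Q)" by (simp add: algebra_simps)
    also have "\<dots> \<le> (4 * R / d) * (?C * Q)"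
      using R d Q0 by (intro mult_right_mono) (auto simp: divide_right_mono simp flip: add_divide_distrib)
    finally show ?thesis .
  qed
  have 3: "fock_mean \<alpha> \<infinity> f R ^ k = integral_mean \<infinity> f R ^ k / R ^ m * ?E"
    using R by (simp add: fock_mean_def power_mult_distrib b_def flip: exp_of_nat_mult)
  have 4: "4 * R / d * (?C * Q) = 8 * exp (5 * (k * \<alpha>) / 2) * (R / d) * (A powr (k - p) * S powr p)"
    by (simp add: Q_def b_def)
  show ?thesis unfolding 3 4[symmetric] by (rule 2)
qed

text \<open>The hypothesis \<open>p \<le> k\<close> of the previous lemma is removed by absorbing the factor
  \<open>fock_mean \<alpha> \<infinity> f r powr (k - p)\<close>, using a weighted supremum \<open>U\<close> over \<open>|r - R| < 1\<close>
  with weight vanishing at the end points.\<close>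

lemma fock_mean_infinity_le:
  assumes p: "p > 0" and a: "\<alpha> > 0"
  shows "\<exists>C>0. \<forall>f R S. f holomorphic_on UNIV \<longrightarrow> R \<ge> 3 \<longrightarrow> 
      (\<forall>r. \<bar>r - R\<bar> \<le> 1 \<longrightarrow> fock_mean \<alpha> (ereal p) f r \<le> S) \<longrightarrow> fock_mean \<alpha> \<infinity> f R \<le> C * R powr (1 / p) * S"
proof -
  define k where "k = nat \<lceil>p\<rceil>"
  have k: "p \<le> real k" unfolding k_def by linarith
  define K where "K = 8 * exp (5 * (k * \<alpha>) / 2)"
  define B where "B = (2 * K * 2 ^ k * 2 powr (k / p)) powr (1 / p)"
  have K: "K > 0" by (simp add: K_def)
  have "fock_mean \<alpha> \<infinity> f R \<le> (2 * B) * R powr (1 / p) * S"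
    if hol: "f holomorphic_on UNIV" and R: "R \<ge> 3" and S: "\<And>r. \<bar>r - R\<bar> \<le> 1 \<Longrightarrow> fock_mean \<alpha> (ereal p) f r \<le> S" for f R S
  proof -
    \<comment> \<open>The exponent 1/p makes all powers of d cancel below: d^(-1) from the factor r0
      / d and d powr (- (k - p) / p) from \<open>far\<close> combine to d powr (- k / p), which the
      k-th power of the weight removes.\<close>
    define g where "g r = (1 - \<bar>r - R\<bar>) powr (1 / p) * fock_mean \<alpha> \<infinity> f r" for r
    let ?I = "{R - 1<..<R + 1}"
    define U where "U = (SUP r\<in>?I. g r)"
    have S0: "S \<ge> 0" using order_trans[OF fock_mean_nonneg[OF hol, of R \<alpha> p] S[of R]] R by simp
    have g_le: "g r \<le> integral_mean \<infinity> f (R + 1)" if "r \<in> ?I" for r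
    proof -
      have "g r \<le> 1 * fock_mean \<alpha> \<infinity> f r"
        unfolding g_def using p that R by (intro mult_right_mono powr_le1 fock_mean_nonneg hol) auto
      also have "\<dots> \<le> integral_mean \<infinity> f r * 1"
        unfolding fock_mean_def mult_1 using that a R by (intro mult_left_mono integral_mean_nonneg hol) auto
      also have "\<dots> \<le> integral_mean \<infinity> f (R + 1)"
        using that R by (simp add: integral_mean_infinity_mono hol)
      finally show ?thesis .
    qed
    \<comment> \<open>Finiteness of U is essential, as \<open>U powr (k - p)\<close> is cancelled
      from both sides at the end.\<close>
    have bdd: "bdd_above (g ` ?I)" using g_le by (rule bdd_aboveI2)
    have gU: "g r \<le> U" if "r \<in> ?I" for r unfolding U_def by (rule cSUP_upper[OF that bdd])
    have RU: "fock_mean \<alpha> \<infinity> f R \<le> U" using gU[of R] by (simp add: g_def)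
    have U0: "U \<ge> 0" using order_trans[OF fock_mean_nonneg[OF hol] RU] R by simp
    show ?thesis
    proof (cases "U = 0")
      case True
      then show ?thesis using RU S0 by (auto simp: B_def intro!: order_trans[OF RU] mult_nonneg_nonneg)
    next
      case False
      then have U: "U > 0" using U0 by simp
      then obtain r0 where r0: "r0 \<in> ?I" "U / 2 < g r0"
        using less_cSUP_iff[OF _ bdd, of "U / 2"] by (auto simp: U_def)
      \<comment> \<open>Half the distance from r0 to the nearer end: the circles of radii r0 - d and
        r0 + d stay in the window at distance at least d from its ends, so their weight is at least
        d powr (1/p).\<close>
      define d where "d = (1 - \<bar>r0 - R\<bar>) / 2"
      have d: "0 < d" "d \<le> 1" "2 * d = 1 - \<bar>r0 - R\<bar>" using r0(1) by (auto simp: d_def)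
      have far: "fock_mean \<alpha> \<infinity> f r \<le> U * d powr (- 1 / p)" if "r = r0 - d \<or> r = r0 + d" for r
      proof -
        have r: "d \<le> 1 - \<bar>r - R\<bar>" using that d by auto
        have "d powr (1 / p) * fock_mean \<alpha> \<infinity> f r \<le> g r"
          unfolding g_def using r d p R by (intro mult_right_mono powr_mono2 fock_mean_nonneg hol) auto
        also have "\<dots> \<le> U" using r d by (intro gU) auto
        finally show ?thesis using d by (simp add: powr_minus field_simps)
      qed
      have "fock_mean \<alpha> \<infinity> f r0 ^ k \<le> K * (r0 / d) * ((U * d powr (- 1 / p)) powr (k - p) * S powr p)"
        unfolding K_def using r0 R d
        by (intro fock_mean_infinity_power_le hol p k a far S) auto
      also have "\<dots> = K * r0 * U powr (k - p) * S powr p * (d powr (- 1) * d powr (- (k - p) / p))"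
      proof -
        have "(U * d powr (- 1 / p)) powr (k - p) = U powr (k - p) * d powr (- 1 / p * (k - p))"
          using U by (simp only: powr_mult powr_powr less_imp_le powr_ge_zero)
        moreover have "- 1 / p * (k - p) = - (k - p) / p" by (simp add: diff_divide_distrib)
        moreover have "r0 / d = r0 * d powr (- 1)" using d by (simp add: powr_minus divide_inverse)
        ultimately show ?thesis by (simp only: mult_ac)
      qed
      also have "d powr (- 1) * d powr (- (k - p) / p) = d powr (- k / p)"
        unfolding powr_add[symmetric] using p by (simp add: field_simps)
      finally have 1: "fock_mean \<alpha> \<infinity> f r0 ^ k \<le> K * r0 * U powr (k - p) * S powr p * d powr (- k / p)" .
      have "(U / 2) ^ k \<le> g r0 ^ k" using r0 U by (intro power_mono) auto
      also have "\<dots> = (2 * d) powr (k / p) * fock_mean \<alpha> \<infinity> f r0 ^ k"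
        unfolding d(3) using d by (simp add: g_def power_mult_distrib powr_power)
      also have "\<dots> \<le> (2 * d) powr (k / p) * (K * r0 * U powr (k - p) * S powr p * d powr (- k / p))"
        by (intro mult_left_mono 1) auto
      also have "\<dots> = (2 powr (k / p) * (K * r0 * U powr (k - p) * S powr p)) * (d powr (k / p) * d powr (- k / p))"
        using d(1,2) by (simp add: powr_mult mult_ac)
      also have "d powr (k / p) * d powr (- k / p) = 1"
        using d(1) unfolding powr_add[symmetric] by simp
      finally have 2: "(U / 2) ^ k \<le> 2 powr (k / p) * (K * r0 * U powr (k - p) * S powr p)" by simp
      have "U powr (k - p) * U powr p = U powr k" unfolding powr_add[symmetric] by simp
      also have "\<dots> = (U / 2) ^ k * 2 ^ k" using U by (simp add: power_divide powr_realpow)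
      also have "\<dots> \<le> (2 powr (k / p) * (K * r0 * U powr (k - p) * S powr p)) * 2 ^ k"
        by (intro mult_right_mono 2) auto
      also have "\<dots> = U powr (k - p) * (K * 2 ^ k * 2 powr (k / p) * r0 * S powr p)" by (simp add: mult_ac)
      finally have "U powr p \<le> K * 2 ^ k * 2 powr (k / p) * r0 * S powr p" using U by simp
      also have "\<dots> \<le> K * 2 ^ k * 2 powr (k / p) * (2 * R) * S powr p"
        using r0 R K by (intro mult_left_mono mult_right_mono) auto
      finally have "(U powr p) powr (1 / p) \<le> (K * 2 ^ k * 2 powr (k / p) * (2 * R) * S powr p) powr (1 / p)"
        using p by (intro powr_mono2) auto
      also have "\<dots> = B * R powr (1 / p) * S"
        using p R K S0 by (simp add: B_def powr_mult powr_powr)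
      finally have "U \<le> B * R powr (1 / p) * S" using U p by (simp add: powr_powr)
      also have "\<dots> \<le> (2 * B) * R powr (1 / p) * S" using S0 by (intro mult_right_mono) (auto simp: B_def)
      finally show ?thesis using RU by simp
    qed
  qed
  moreover have "2 * B > 0" using K by (simp add: B_def)
  ultimately show ?thesis by blast
qed

section \<open>Change of the inner exponent at the cost of a power of the radius\<close>

definition inv_exp :: "ereal \<Rightarrow> real" where
  "inv_exp p = real_of_ereal (1 / p)"

lemma inv_exp_simps [simp]: "inv_exp \<infinity> = 0" "s > 0 \<Longrightarrow> inv_exp (ereal s) = 1 / s"
  by (auto simp: inv_exp_def one_ereal_def)

text \<open>For p2 \<le> p1 nothing is lost in R. For p2 = \<infinity> this is
  \<open>fock_mean_infinity_le\<close>. For p1 < p2 < \<infinity> interpolation between p1 and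
  \<infinity> raises the loss R powr (1/p1) to the power 1 - p1/p2, which gives exactly R powr (1/p1
  - 1/p2).\<close>

lemma fock_mean_change_exponent:
  assumes p: "p1 > 0" "p2 > 0" and a: "\<alpha> > 0" and \<kappa>: "\<kappa> \<ge> 0" "\<kappa> \<ge> inv_exp p1 - inv_exp p2"
  shows "\<exists>C>0. \<forall>f R S. f holomorphic_on UNIV \<longrightarrow> R \<ge> 3 \<longrightarrow> 
      (\<forall>r. \<bar>r - R\<bar> \<le> 1 \<longrightarrow> fock_mean \<alpha> p1 f r \<le> S) \<longrightarrow> fock_mean \<alpha> p2 f R \<le> C * R powr \<kappa> * S"
proof (cases p1)
  case PInf
  have "fock_mean \<alpha> p2 f R \<le> 1 * R powr \<kappa> * S"
    if hol: "f holomorphic_on UNIV" and R: "R \<ge> 3" and S: "\<And>r. \<bar>r - R\<bar> \<le> 1 \<Longrightarrow> fock_mean \<alpha> p1 f r \<le> S" for f R S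
  proof -
    have S0: "S \<ge> 0" using order_trans[OF fock_mean_nonneg[OF hol, of R \<alpha> p1] S[of R]] R by simp
    have "fock_mean \<alpha> p2 f R \<le> fock_mean \<alpha> \<infinity> f R"
      unfolding fock_mean_def using R by (intro mult_right_mono integral_mean_le_infinity hol p) auto
    also have "\<dots> \<le> 1 * S" using S[of R] PInf by simp
    also have "\<dots> \<le> R powr \<kappa> * S" using R \<kappa> S0 by (intro mult_right_mono ge_one_powr_ge_zero) auto
    finally show ?thesis by simp
  qed
  then show ?thesis by (intro exI[of _ 1]) auto
next
  case (real s1)
  have s1: "s1 > 0" using p real by simp
  obtain C where C: "C > 0" "\<And>f R S. f holomorphic_on UNIV \<Longrightarrow> R \<ge> 3 \<Longrightarrow> 
      (\<And>r. \<bar>r - R\<bar> \<le> 1 \<Longrightarrow> fock_mean \<alpha> p1 f r \<le> S) \<Longrightarrow> fock_mean \<alpha> \<infinity> f R \<le> C * R powr (1 / s1) * S"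
    using fock_mean_infinity_le[OF s1 a] real by blast
  show ?thesis
  proof (cases p2)
    case PInf
    have "fock_mean \<alpha> p2 f R \<le> C * R powr \<kappa> * S"
      if hol: "f holomorphic_on UNIV" and R: "R \<ge> 3" and S: "\<And>r. \<bar>r - R\<bar> \<le> 1 \<Longrightarrow> fock_mean \<alpha> p1 f r \<le> S" for f R S
    proof -
      have S0: "S \<ge> 0" using order_trans[OF fock_mean_nonneg[OF hol, of R \<alpha> p1] S[of R]] R by simp
      have "R powr (1 / s1) \<le> R powr \<kappa>" using \<kappa> R s1 by (intro powr_mono) (auto simp: real PInf)
      then have "C * R powr (1 / s1) * S \<le> C * R powr \<kappa> * S"
        using C(1) S0 by (intro mult_right_mono mult_left_mono) auto
      with C(2)[OF hol R S] show ?thesis by (simp add: PInf)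
    qed
    with C(1) show ?thesis by blast
  next
    case (real s2)
    note p2 = real
    have s2: "s2 > 0" using p real by simp
    show ?thesis
    proof (cases "s2 \<le> s1")
      case True
      have "fock_mean \<alpha> p2 f R \<le> 2 powr (1 / s2) * R powr \<kappa> * S"
        if hol: "f holomorphic_on UNIV" and R: "R \<ge> 3" and S: "\<And>r. \<bar>r - R\<bar> \<le> 1 \<Longrightarrow> fock_mean \<alpha> p1 f r \<le> S" for f R S
      proof -
        have S0: "S \<ge> 0" using order_trans[OF fock_mean_nonneg[OF hol, of R \<alpha> p1] S[of R]] R by simp
        have "fock_mean \<alpha> p2 f R \<le> 2 powr (1 / s2) * fock_mean \<alpha> p1 f R"
          unfolding fock_mean_def mult.assoc[symmetric] p2 \<open>p1 = ereal s1\<close>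
          using R by (intro mult_right_mono integral_mean_power_mono hol s2 True) auto
        also have "\<dots> \<le> 2 powr (1 / s2) * (1 * S)" using S[of R] by (intro mult_left_mono) auto
        also have "\<dots> \<le> 2 powr (1 / s2) * (R powr \<kappa> * S)"
          using R \<kappa> S0 by (intro mult_left_mono mult_right_mono ge_one_powr_ge_zero) auto
        finally show ?thesis by simp
      qed
      then show ?thesis by (intro exI[of _ "2 powr (1 / s2)"]) auto
    next
      case False
      have "fock_mean \<alpha> p2 f R \<le> C powr ((s2 - s1) / s2) * R powr \<kappa> * S"
        if hol: "f holomorphic_on UNIV" and R: "R \<ge> 3" and S: "\<And>r. \<bar>r - R\<bar> \<le> 1 \<Longrightarrow> fock_mean \<alpha> p1 f r \<le> S" for f R S
      proof -
        have S0: "S \<ge> 0" using order_trans[OF fock_mean_nonneg[OF hol, of R \<alpha> p1] S[of R]] R by simp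
        have R0: "R \<ge> 0" using R by simp
        note nn = integral_mean_nonneg[OF hol R0]
        have "fock_mean \<alpha> p2 f R powr s2 = circle_mean s2 f R / (2 * pi) * exp (- (\<alpha> / 2) * R\<^sup>2) powr s2"
          using nn by (simp add: fock_mean_def powr_mult p2 integral_mean_powr[OF hol s2])
        also have "\<dots> \<le> integral_mean \<infinity> f R powr (s2 - s1) * integral_mean s1 f R powr s1 * exp (- (\<alpha> / 2) * R\<^sup>2) powr s2"
          using circle_mean_interpolation[OF hol s1, of s2 R] False R0
          by (intro mult_right_mono) (auto simp: integral_mean_powr[OF hol s1] divide_right_mono)
        also have "exp (- (\<alpha> / 2) * R\<^sup>2) powr s2 = exp (- (\<alpha> / 2) * R\<^sup>2) powr (s2 - s1) * exp (- (\<alpha> / 2) * R\<^sup>2) powr s1"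
          unfolding powr_add[symmetric] by simp
        also have "integral_mean \<infinity> f R powr (s2 - s1) * integral_mean s1 f R powr s1 * \<dots>
           = fock_mean \<alpha> \<infinity> f R powr (s2 - s1) * fock_mean \<alpha> p1 f R powr s1"
          using nn by (simp add: fock_mean_def \<open>p1 = ereal s1\<close> powr_mult mult_ac)
        also have "\<dots> \<le> (C * R powr (1 / s1) * S) powr (s2 - s1) * S powr s1"
          using False s1 R by (intro mult_mono powr_mono2 C(2)[OF hol R] S fock_mean_nonneg hol) auto
        also have "\<dots> = C powr (s2 - s1) * R powr ((s2 - s1) / s1) * (S powr (s2 - s1) * S powr s1)"
          using C(1) S0 R by (simp add: powr_mult powr_powr)
        also have "S powr (s2 - s1) * S powr s1 = S powr s2" unfolding powr_add[symmetric] by simp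
        finally have "(fock_mean \<alpha> p2 f R powr s2) powr (1 / s2) \<le> (C powr (s2 - s1) * R powr ((s2 - s1) / s1) * S powr s2) powr (1 / s2)"
          using s2 by (intro powr_mono2) auto
        then have "fock_mean \<alpha> p2 f R \<le> C powr ((s2 - s1) / s2) * R powr ((s2 - s1) / s1 / s2) * S"
          using s2 S0 fock_mean_nonneg[OF hol R0] by (simp add: powr_powr powr_mult)
        also have "\<dots> \<le> C powr ((s2 - s1) / s2) * R powr \<kappa> * S"
          using S0 R \<kappa> s1 s2 by (intro mult_right_mono mult_left_mono powr_mono)
            (auto simp: p2 \<open>p1 = ereal s1\<close> field_simps)
        finally show ?thesis .
      qed
      with C(1) show ?thesis by (intro exI[of _ "C powr ((s2 - s1) / s2)"]) auto
    qed
  qed (use p in auto)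
qed (use p in auto)

section \<open>Norm estimates and sufficiency\<close>

text \<open>For A = {0..} this is the s-th power of the norm divided by \<alpha> s; smaller sets A
  give the contribution of an annulus.\<close>

definition fock_integral :: "real \<Rightarrow> ereal \<Rightarrow> real \<Rightarrow> real set \<Rightarrow> (complex \<Rightarrow> complex) \<Rightarrow> ennreal" where
  "fock_integral \<alpha> p s A f = (\<integral>\<^sup>+ r\<in>A. ennreal (fock_mean \<alpha> p f r powr s * r) \<partial>lborel)"

lemma borel_measurable_fock_mean [measurable]:
  assumes "f holomorphic_on UNIV" "p > 0"
  shows "fock_mean \<alpha> p f \<in> borel_measurable borel"
proof -
  note [measurable] = borel_measurable_integral_mean[OF assms]
  show ?thesis unfolding fock_mean_def[abs_def] by measurable
qed

lemma ennreal_powr_le_iff: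
  assumes s: "s > 0" and K: "K \<ge> 0"
  shows "ennreal_powr x (1 / s) \<le> ennreal K \<longleftrightarrow> x \<le> ennreal (K powr s)"
proof (cases x)
  case (real y)
  have "y powr (1 / s) \<le> K \<longleftrightarrow> y \<le> K powr s"
  proof
    assume "y powr (1 / s) \<le> K"
    then have "(y powr (1 / s)) powr s \<le> K powr s" using s by (intro powr_mono2) auto
    then show "y \<le> K powr s" using s real by (simp add: powr_powr)
  next
    assume "y \<le> K powr s"
    then have "y powr (1 / s) \<le> (K powr s) powr (1 / s)" using s real by (intro powr_mono2) auto
    then show "y powr (1 / s) \<le> K" using s K by (simp add: powr_powr)
  qed
  then show ?thesis using real K by (simp add: ennreal_powr_def)
next
  case top
  then show ?thesis by (simp add: ennreal_powr_def top_unique)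
qed

text \<open>Norms with finite q are estimated only through this equivalence with a real bound K, so
  that roots of extended reals need not be computed with.\<close>

lemma fock_norm_finite_le_iff:
  assumes hol: "f holomorphic_on UNIV" and p: "p > 0" and s: "s > 0" and a: "\<alpha> > 0" and K: "K \<ge> 0"
  shows "fock_norm \<alpha> p (ereal s) f \<le> ennreal K \<longleftrightarrow> fock_integral \<alpha> p s {0..} f \<le> ennreal (K powr s / (\<alpha> * s))"
proof -
  note [measurable] = borel_measurable_fock_mean[OF hol p]
  have pt: "ennreal (integral_mean p f r powr s * \<alpha> * s * exp (- (\<alpha> * s / 2) * r\<^sup>2) * r) * indicator {0..} r
      = ennreal (\<alpha> * s) * (ennreal (fock_mean \<alpha> p f r powr s * r) * indicator {0..} r)" for r
  proof (cases "r \<ge> 0")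
    case True
    have "exp (- (\<alpha> / 2) * r\<^sup>2) powr s = exp (- (\<alpha> * s / 2) * r\<^sup>2)" by (simp add: powr_def)
    then have "fock_mean \<alpha> p f r powr s = integral_mean p f r powr s * exp (- (\<alpha> * s / 2) * r\<^sup>2)"
      using integral_mean_nonneg[OF hol True] by (simp add: fock_mean_def powr_mult)
    then show ?thesis using a s True by (simp add: ennreal_mult[symmetric] mult_ac)
  qed simp
  have "(\<integral>\<^sup>+ r\<in>{0..}. ennreal (integral_mean p f r powr s * \<alpha> * s * exp (- (\<alpha> * s / 2) * r\<^sup>2) * r) \<partial>lborel)
     = ennreal (\<alpha> * s) * fock_integral \<alpha> p s {0..} f"
    unfolding pt fock_integral_def by (intro nn_integral_cmult) measurable
  then have "fock_norm \<alpha> p (ereal s) f = ennreal_powr (ennreal (\<alpha> * s) * fock_integral \<alpha> p s {0..} f) (1 / s)"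
    by (simp add: fock_norm_def)
  then have 1: "fock_norm \<alpha> p (ereal s) f \<le> ennreal K \<longleftrightarrow> ennreal (\<alpha> * s) * fock_integral \<alpha> p s {0..} f \<le> ennreal (K powr s)"
    using ennreal_powr_le_iff[OF s K] by simp
  have as: "\<alpha> * s > 0" using a s by simp
  have 2: "ennreal (\<alpha> * s) * x \<le> ennreal (K powr s) \<longleftrightarrow> x \<le> ennreal (K powr s / (\<alpha> * s))" for x
  proof (cases x)
    case (real y)
    then show ?thesis using as by (simp add: ennreal_mult[symmetric] pos_le_divide_eq mult.commute)
  next
    case top
    then have "ennreal (\<alpha> * s) * x = top" using a s by (simp add: ennreal_mult_eq_top_iff)
    then show ?thesis by (simp add: top top_unique)
  qed
  show ?thesis unfolding 1 2 ..
qed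

lemma fock_norm_infinity_le_iff:
  assumes "K \<ge> 0"
  shows "fock_norm \<alpha> p \<infinity> f \<le> ennreal K \<longleftrightarrow> (\<forall>r\<ge>0. fock_mean \<alpha> p f r \<le> K)"
  using assms by (auto simp: fock_norm_def fock_mean_def SUP_le_iff ennreal_le_iff)

text \<open>The bound by the maximum of the values at r - t and r + t is integrated over t in
  [0, 1]; both translates stay in the window of half-width 2. The freedom of r within distance 1 of
  R supplies the uniform bound S that \<open>fock_mean_change_exponent\<close> asks for. In the
  constant, 4 is 2 * 2: one factor from comparing R with r \<plusminus> t, the other from the two
  translates.\<close>

lemma local_integral_bound:
  assumes p: "p > 0" and s: "s > 0" and a: "\<alpha> > 0"
  shows "\<exists>C>0. \<forall>f R r. f holomorphic_on UNIV \<longrightarrow> R \<ge> 4 \<longrightarrow> \<bar>r - R\<bar> \<le> 1 \<longrightarrow>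
     ennreal (R * fock_mean \<alpha> p f r powr s) \<le> ennreal C * fock_integral \<alpha> p s {R - 2..R + 2} f"
proof -
  define K where "K = 2 * exp (5 * \<alpha> / 2)"
  define C where "C = 4 * K powr s"
  have K: "K > 0" by (simp add: K_def)
  have "ennreal (R * fock_mean \<alpha> p f r powr s) \<le> ennreal C * fock_integral \<alpha> p s {R - 2..R + 2} f"
    if hol: "f holomorphic_on UNIV" and R: "R \<ge> 4" and r: "\<bar>r - R\<bar> \<le> 1" for f R r
  proof -
    note [measurable] = borel_measurable_fock_mean[OF hol p]
    define w where "w x = ennreal (fock_mean \<alpha> p f x powr s * x) * indicator {R - 2..R + 2} x" for x
    have [measurable]: "w \<in> borel_measurable borel" unfolding w_def[abs_def] by measurable
    have shift: "(\<integral>\<^sup>+ t. w (r + t) \<partial>lborel) = integral\<^sup>N lborel w" "(\<integral>\<^sup>+ t. w (r - t) \<partial>lborel) = integral\<^sup>N lborel w"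
      using nn_integral_real_affine[of w 1 r] nn_integral_real_affine[of w "-1" r] by simp_all
    have pt: "ennreal (R * fock_mean \<alpha> p f r powr s) * indicator {0..1} t
       \<le> ennreal (2 * K powr s) * (w (r - t) + w (r + t))" for t
    proof (cases "0 \<le> t \<and> t \<le> 1")
      case True
      let ?\<phi> = "fock_mean \<alpha> p f"
      have nn: "?\<phi> (r - t) \<ge> 0" "?\<phi> (r + t) \<ge> 0" "?\<phi> r \<ge> 0" using True r R by (auto intro!: fock_mean_nonneg hol)
      have "?\<phi> r powr s \<le> (K * max (?\<phi> (r - t)) (?\<phi> (r + t))) powr s"
        unfolding K_def using True r R s nn by (intro powr_mono2 fock_mean_le_max hol p a) auto
      also have "\<dots> = K powr s * max (?\<phi> (r - t)) (?\<phi> (r + t)) powr s"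
        using K nn by (simp add: powr_mult)
      also have "\<dots> \<le> K powr s * (?\<phi> (r - t) powr s + ?\<phi> (r + t) powr s)"
        by (intro mult_left_mono) (auto simp: max_def)
      finally have "R * ?\<phi> r powr s \<le> R * (K powr s * (?\<phi> (r - t) powr s + ?\<phi> (r + t) powr s))"
        using R by (intro mult_left_mono) auto
      also have "\<dots> = K powr s * (R * ?\<phi> (r - t) powr s + R * ?\<phi> (r + t) powr s)"
        by (simp add: algebra_simps)
      \<comment> \<open>Here R \<le> 2 (r \<plusminus> t), because r \<plusminus> t \<ge> R - 2 and
        R \<ge> 4.\<close>
      also have "\<dots> \<le> K powr s * ((2 * (r - t)) * ?\<phi> (r - t) powr s + (2 * (r + t)) * ?\<phi> (r + t) powr s)"
        using r True R by (intro mult_left_mono add_mono mult_right_mono) auto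
      also have "\<dots> = 2 * K powr s * (?\<phi> (r - t) powr s * (r - t) + ?\<phi> (r + t) powr s * (r + t))"
        by (simp add: algebra_simps)
      finally have "ennreal (R * ?\<phi> r powr s) \<le> ennreal (2 * K powr s * (?\<phi> (r - t) powr s * (r - t) + ?\<phi> (r + t) powr s * (r + t)))"
        by (rule ennreal_leI)
      also have "\<dots> = ennreal (2 * K powr s) * (w (r - t) + w (r + t))"
      proof -
        have *: "ennreal (2 * K powr s * (x + y)) = ennreal (2 * K powr s) * (ennreal x + ennreal y)"
          if "x \<ge> 0" "y \<ge> 0" for x y
          using that by (simp add: ennreal_mult del: ennreal_plus flip: ennreal_plus)
        have w: "w (r - t) = ennreal (?\<phi> (r - t) powr s * (r - t))" "w (r + t) = ennreal (?\<phi> (r + t) powr s * (r + t))"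
          unfolding w_def using r True R by (auto simp: abs_le_iff)
        show ?thesis unfolding w using r True R by (intro *) auto
      qed
      finally show ?thesis using True by simp
    qed simp
    have "ennreal (R * fock_mean \<alpha> p f r powr s) = (\<integral>\<^sup>+ t. ennreal (R * fock_mean \<alpha> p f r powr s) * indicator {0..1::real} t \<partial>lborel)"
      by (simp add: nn_integral_cmult_indicator)
    also have "\<dots> \<le> (\<integral>\<^sup>+ t. ennreal (2 * K powr s) * (w (r - t) + w (r + t)) \<partial>lborel)"
      by (intro nn_integral_mono pt)
    also have "\<dots> = ennreal (2 * K powr s) * (integral\<^sup>N lborel w + integral\<^sup>N lborel w)"
      by (simp add: nn_integral_cmult nn_integral_add shift)
    also have "\<dots> = ennreal C * integral\<^sup>N lborel w"
    proof -
      have "integral\<^sup>N lborel w + integral\<^sup>N lborel w = ennreal 2 * integral\<^sup>N lborel w"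
        by (simp add: mult_2)
      moreover have "ennreal C = ennreal (2 * K powr s) * ennreal 2"
        by (subst ennreal_mult[symmetric]) (simp_all add: C_def)
      ultimately show ?thesis by (simp add: mult.assoc)
    qed
    finally show ?thesis by (simp add: fock_integral_def w_def[abs_def])
  qed
  moreover have "C > 0" using K by (simp add: C_def)
  ultimately show ?thesis by blast
qed

text \<open>The exponent - 1/s is the gain from the density r of the radial measure. The integral is
  kept local because \<open>fock_norm_le_of_eq\<close> integrates it over R once more. The
  finiteness premise guards against \<open>enn2real\<close> sending \<infinity> to 0.\<close>

lemma fock_mean_le_local_integral:
  assumes p: "p1 > 0" "p2 > 0" and s: "s > 0" and a: "\<alpha> > 0" and \<kappa>: "\<kappa> \<ge> 0" "\<kappa> \<ge> inv_exp p1 - inv_exp p2"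
  shows "\<exists>C>0. \<forall>f R. f holomorphic_on UNIV \<longrightarrow> R \<ge> 4 \<longrightarrow> fock_integral \<alpha> p1 s {R - 2..R + 2} f < \<infinity> \<longrightarrow>
     fock_mean \<alpha> p2 f R \<le> C * R powr (\<kappa> - 1 / s) * enn2real (fock_integral \<alpha> p1 s {R - 2..R + 2} f) powr (1 / s)"
proof -
  obtain C1 where C1: "C1 > 0" "\<And>f R r. f holomorphic_on UNIV \<Longrightarrow> R \<ge> 4 \<Longrightarrow> \<bar>r - R\<bar> \<le> 1 \<Longrightarrow>
     ennreal (R * fock_mean \<alpha> p1 f r powr s) \<le> ennreal C1 * fock_integral \<alpha> p1 s {R - 2..R + 2} f"
    using local_integral_bound[OF p(1) s a] by blast
  obtain C2 where C2: "C2 > 0" "\<And>f R S. f holomorphic_on UNIV \<Longrightarrow> R \<ge> 3 \<Longrightarrow> 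
      (\<And>r. \<bar>r - R\<bar> \<le> 1 \<Longrightarrow> fock_mean \<alpha> p1 f r \<le> S) \<Longrightarrow> fock_mean \<alpha> p2 f R \<le> C2 * R powr \<kappa> * S"
    using fock_mean_change_exponent[OF p a \<kappa>] by blast
  have "fock_mean \<alpha> p2 f R \<le> (C2 * C1 powr (1 / s)) * R powr (\<kappa> - 1 / s) * enn2real (fock_integral \<alpha> p1 s {R - 2..R + 2} f) powr (1 / s)"
    if hol: "f holomorphic_on UNIV" and R: "R \<ge> 4" and fin: "fock_integral \<alpha> p1 s {R - 2..R + 2} f < \<infinity>" for f R
  proof -
    define j where "j = enn2real (fock_integral \<alpha> p1 s {R - 2..R + 2} f)"
    have j: "fock_integral \<alpha> p1 s {R - 2..R + 2} f = ennreal j" "j \<ge> 0"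
      using fin by (simp_all add: j_def)
    have "fock_mean \<alpha> p1 f r \<le> (C1 * j / R) powr (1 / s)" if "\<bar>r - R\<bar> \<le> 1" for r
    proof -
      have nn: "fock_mean \<alpha> p1 f r \<ge> 0" using that R by (intro fock_mean_nonneg hol) auto
      have "R * fock_mean \<alpha> p1 f r powr s \<le> C1 * j"
        using C1(2)[OF hol R that] C1(1) j R by (simp add: ennreal_mult[symmetric] ennreal_le_iff)
      then have "fock_mean \<alpha> p1 f r powr s \<le> C1 * j / R" using R by (simp add: field_simps)
      then have "(fock_mean \<alpha> p1 f r powr s) powr (1 / s) \<le> (C1 * j / R) powr (1 / s)"
        using s by (intro powr_mono2) auto
      then show ?thesis using s nn by (simp add: powr_powr)
    qed
    then have "fock_mean \<alpha> p2 f R \<le> C2 * R powr \<kappa> * (C1 * j / R) powr (1 / s)"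
      using R by (intro C2(2) hol) auto
    also have "\<dots> = (C2 * C1 powr (1 / s)) * R powr (\<kappa> - 1 / s) * j powr (1 / s)"
      using R C1(1) j by (simp add: powr_mult powr_divide powr_diff)
    finally show ?thesis by (simp add: j_def)
  qed
  moreover have "C2 * C1 powr (1 / s) > 0" using C1(1) C2(1) by simp
  ultimately show ?thesis by blast
qed

lemma fock_integral_mono: "A \<subseteq> B \<Longrightarrow> fock_integral \<alpha> p s A f \<le> fock_integral \<alpha> p s B f"
  unfolding fock_integral_def by (intro nn_integral_mono mult_left_mono) (auto simp: indicator_def)

lemma fock_mean_le_norm:
  assumes p: "p1 > 0" "p2 > 0" and q: "q > 0" and a: "\<alpha> > 0" and \<kappa>: "\<kappa> \<ge> 0" "\<kappa> \<ge> inv_exp p1 - inv_exp p2"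
  shows "\<exists>C>0. \<forall>f N R. f holomorphic_on UNIV \<longrightarrow> N \<ge> 0 \<longrightarrow> fock_norm \<alpha> p1 q f \<le> ennreal N \<longrightarrow> R \<ge> 4 \<longrightarrow>
     fock_mean \<alpha> p2 f R \<le> C * R powr (\<kappa> - inv_exp q) * N"
proof (cases q)
  case PInf
  obtain C where C: "C > 0" "\<And>f R S. f holomorphic_on UNIV \<Longrightarrow> R \<ge> 3 \<Longrightarrow> 
      (\<And>r. \<bar>r - R\<bar> \<le> 1 \<Longrightarrow> fock_mean \<alpha> p1 f r \<le> S) \<Longrightarrow> fock_mean \<alpha> p2 f R \<le> C * R powr \<kappa> * S"
    using fock_mean_change_exponent[OF p a \<kappa>] by blast
  have "fock_mean \<alpha> p2 f R \<le> C * R powr (\<kappa> - inv_exp q) * N"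
    if hol: "f holomorphic_on UNIV" and N: "N \<ge> 0" "fock_norm \<alpha> p1 q f \<le> ennreal N" and R: "R \<ge> 4" for f N R
    using C(2)[OF hol, of R N] R N(2) fock_norm_infinity_le_iff[OF N(1)] by (simp add: PInf)
  with C(1) show ?thesis by blast
next
  case (real s)
  have s: "s > 0" using real q by simp
  obtain C where C: "C > 0" "\<And>f R. f holomorphic_on UNIV \<Longrightarrow> R \<ge> 4 \<Longrightarrow> fock_integral \<alpha> p1 s {R - 2..R + 2} f < \<infinity> \<Longrightarrow>
     fock_mean \<alpha> p2 f R \<le> C * R powr (\<kappa> - 1 / s) * enn2real (fock_integral \<alpha> p1 s {R - 2..R + 2} f) powr (1 / s)"
    using fock_mean_le_local_integral[OF p s a \<kappa>] by blast
  have "fock_mean \<alpha> p2 f R \<le> (C * (1 / (\<alpha> * s)) powr (1 / s)) * R powr (\<kappa> - inv_exp q) * N"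
    if hol: "f holomorphic_on UNIV" and N: "N \<ge> 0" "fock_norm \<alpha> p1 q f \<le> ennreal N" and R: "R \<ge> 4" for f N R
  proof -
    let ?J = "fock_integral \<alpha> p1 s {R - 2..R + 2} f"
    have "?J \<le> fock_integral \<alpha> p1 s {0..} f" using R by (intro fock_integral_mono) auto
    also have "\<dots> \<le> ennreal (N powr s / (\<alpha> * s))"
      using N fock_norm_finite_le_iff[OF hol p(1) s a N(1)] by (simp add: real)
    finally have J: "?J \<le> ennreal (N powr s / (\<alpha> * s))" .
    then have fin: "?J < \<infinity>" by (simp add: le_less_trans)
    have "enn2real ?J \<le> N powr s / (\<alpha> * s)" using J a s by (intro enn2real_leI) auto
    then have "enn2real ?J powr (1 / s) \<le> (N powr s / (\<alpha> * s)) powr (1 / s)"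
      using s by (intro powr_mono2) auto
    also have "\<dots> = (1 / (\<alpha> * s)) powr (1 / s) * N"
      using N(1) s a by (simp add: powr_powr powr_divide powr_mult)
    finally have "C * R powr (\<kappa> - 1 / s) * enn2real ?J powr (1 / s) \<le> C * R powr (\<kappa> - 1 / s) * ((1 / (\<alpha> * s)) powr (1 / s) * N)"
      using C(1) by (intro mult_left_mono) auto
    with C(2)[OF hol R fin] show ?thesis using s by (simp add: real mult_ac)
  qed
  moreover have "C * (1 / (\<alpha> * s)) powr (1 / s) > 0" using C(1) a s by simp
  ultimately show ?thesis by blast
qed (use q in auto)

text \<open>Small radii are out of reach of the comparison with monomials, so the estimate is
  carried inward from the circle of radius 4 by the monotonicity of the maximum modulus. It is
  stated without a weight so that any target weight may be inserted.\<close>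

lemma integral_mean_le_norm:
  assumes p: "p1 > 0" "p2 > 0" and q: "q > 0" and a: "\<alpha> > 0"
  shows "\<exists>C>0. \<forall>f N R. f holomorphic_on UNIV \<longrightarrow> N \<ge> 0 \<longrightarrow> fock_norm \<alpha> p1 q f \<le> ennreal N \<longrightarrow> 0 \<le> R \<longrightarrow> R \<le> 4 \<longrightarrow>
     integral_mean p2 f R \<le> C * N"
proof -
  have ip: "inv_exp p1 \<ge> 0" using p by (cases p1) auto
  obtain C where C: "C > 0" "\<And>f N R. f holomorphic_on UNIV \<Longrightarrow> N \<ge> 0 \<Longrightarrow> fock_norm \<alpha> p1 q f \<le> ennreal N \<Longrightarrow> R \<ge> 4 \<Longrightarrow>
     fock_mean \<alpha> \<infinity> f R \<le> C * R powr (inv_exp p1 - inv_exp q) * N"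
    using fock_mean_le_norm[OF p(1) _ q a ip, of \<infinity>] by auto
  define D where "D = C * 4 powr (inv_exp p1 - inv_exp q) * exp (\<alpha> / 2 * 4\<^sup>2)"
  have "integral_mean p2 f R \<le> D * N"
    if hol: "f holomorphic_on UNIV" and N: "N \<ge> 0" "fock_norm \<alpha> p1 q f \<le> ennreal N" and R: "0 \<le> R" "R \<le> 4" for f N R
  proof -
    have "integral_mean p2 f R \<le> integral_mean \<infinity> f R" by (rule integral_mean_le_infinity[OF hol p(2) R(1)])
    also have "\<dots> \<le> integral_mean \<infinity> f 4" by (rule integral_mean_infinity_mono[OF hol R])
    also have "\<dots> = fock_mean \<alpha> \<infinity> f 4 * exp (\<alpha> / 2 * 4\<^sup>2)"
      unfolding fock_mean_def mult.assoc exp_add[symmetric] by simp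
    also have "\<dots> \<le> (C * 4 powr (inv_exp p1 - inv_exp q) * N) * exp (\<alpha> / 2 * 4\<^sup>2)"
      by (intro mult_right_mono C(2) hol N) auto
    finally show ?thesis by (simp add: D_def mult_ac)
  qed
  moreover have "D > 0" using C(1) by (simp add: D_def)
  ultimately show ?thesis by blast
qed

section \<open>Norms of functions concentrated around one radius\<close>

lemma powr_gaussian_le_exp:
  fixes k \<delta> x :: real
  assumes \<delta>: "\<delta> > 0"
  shows "(1 + \<bar>x\<bar>) powr k * exp (- \<delta> * x\<^sup>2) \<le> exp ((\<bar>k\<bar> + 1)\<^sup>2 / (4 * \<delta>)) * exp (- \<bar>x\<bar>)"
proof -
  define y where "y = \<bar>x\<bar>"
  have y: "y \<ge> 0" by (simp add: y_def)
  have "k * ln (1 + y) \<le> \<bar>k\<bar> * y"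
    using y ln_add_one_self_le_self[OF y] by (intro mult_mono) auto
  \<comment> \<open>Completing the square leaves the maximum of (|k| + 1) y - \<delta> y^2; the
    extra 1 provides the integrable factor exp(- y).\<close>
  moreover have "0 \<le> (2 * \<delta> * y - (\<bar>k\<bar> + 1))\<^sup>2 / (4 * \<delta>)" using \<delta> by simp
  then have "(\<bar>k\<bar> + 1) * y - \<delta> * y\<^sup>2 \<le> (\<bar>k\<bar> + 1)\<^sup>2 / (4 * \<delta>)"
    using \<delta> by (simp add: power2_eq_square field_simps)
  ultimately have "k * ln (1 + y) - \<delta> * y\<^sup>2 \<le> (\<bar>k\<bar> + 1)\<^sup>2 / (4 * \<delta>) - y"
    by (simp add: algebra_simps)
  then have "exp (k * ln (1 + y) + - \<delta> * y\<^sup>2) \<le> exp ((\<bar>k\<bar> + 1)\<^sup>2 / (4 * \<delta>) + - y)" by simp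
  then have "(1 + y) powr k * exp (- \<delta> * y\<^sup>2) \<le> exp ((\<bar>k\<bar> + 1)\<^sup>2 / (4 * \<delta>)) * exp (- y)"
    unfolding exp_add using y by (simp add: powr_def)
  then show ?thesis by (simp add: y_def)
qed

lemma nn_integral_exp_abs: "(\<integral>\<^sup>+ x. ennreal (exp (- \<bar>x - a\<bar>)) \<partial>lborel) \<le> ennreal 2"
proof -
  let ?g = "\<lambda>x::real. ennreal (exp (- x)) * indicator {0..} x"
  have g: "integral\<^sup>N lborel ?g = 1"
  proof -
    have "((\<lambda>x::real. - exp (- x)) \<longlongrightarrow> - 0) at_top"
      by (intro tendsto_intros filterlim_compose[OF exp_at_bot] filterlim_uminus_at_bot_at_top)
    then have "integral\<^sup>N lborel ?g = ennreal (- 0 - (- exp (- 0)))"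
      by (intro nn_integral_FTC_atLeast) (auto intro!: derivative_eq_intros)
    then show ?thesis by simp
  qed
  have "(\<integral>\<^sup>+ x. ennreal (exp (- \<bar>x - a\<bar>)) \<partial>lborel) \<le> (\<integral>\<^sup>+ x. ?g (- a + 1 * x) + ?g (a + (- 1) * x) \<partial>lborel)"
    by (intro nn_integral_mono) (auto simp: abs_if indicator_def)
  also have "\<dots> = (\<integral>\<^sup>+ x. ?g (- a + 1 * x) \<partial>lborel) + (\<integral>\<^sup>+ x. ?g (a + (- 1) * x) \<partial>lborel)"
    by (intro nn_integral_add) auto
  also have "\<dots> = integral\<^sup>N lborel ?g + integral\<^sup>N lborel ?g"
    using nn_integral_real_affine[of ?g 1 "- a"] nn_integral_real_affine[of ?g "-1" a] by simp
  also have "\<dots> = ennreal 2" unfolding g by (simp flip: ennreal_plus ennreal_1)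
  finally show ?thesis .
qed

text \<open>The point is that C does not depend on the centre c; the only trace of c is the mass (1
  + c) powr (1/q) of a unit annulus there. It serves the case \<alpha> < \<beta> with c = 0, and the
  exponentials and monomials with large c.\<close>

lemma fock_norm_le_gaussian:
  assumes \<delta>: "\<delta> > 0" and p: "p > 0" and q: "q > 0" and a: "\<alpha> > 0"
  shows "\<exists>C>0. \<forall>f c P. f holomorphic_on UNIV \<longrightarrow> c \<ge> 0 \<longrightarrow> P \<ge> 0 \<longrightarrow>
     (\<forall>r\<ge>0. fock_mean \<alpha> p f r \<le> P * ((1 + \<bar>r - c\<bar>) powr k * exp (- \<delta> * (r - c)\<^sup>2))) \<longrightarrow>
     fock_norm \<alpha> p q f \<le> ennreal (C * P * (1 + c) powr inv_exp q)"
proof (cases q)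
  case PInf
  define B where "B = exp ((\<bar>k\<bar> + 1)\<^sup>2 / (4 * \<delta>))"
  have "fock_norm \<alpha> p q f \<le> ennreal (B * P * (1 + c) powr inv_exp q)"
    if "f holomorphic_on UNIV" and c: "c \<ge> 0" and P: "P \<ge> 0"
      and bd: "\<And>r. r \<ge> 0 \<Longrightarrow> fock_mean \<alpha> p f r \<le> P * ((1 + \<bar>r - c\<bar>) powr k * exp (- \<delta> * (r - c)\<^sup>2))" for f c P
  proof -
    have "fock_mean \<alpha> p f r \<le> B * P" if "r \<ge> 0" for r
    proof -
      have "(1 + \<bar>r - c\<bar>) powr k * exp (- \<delta> * (r - c)\<^sup>2) \<le> B * 1"
        using powr_gaussian_le_exp[OF \<delta>, of "r - c" k] 
        by (rule order_trans) (auto simp: B_def)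
      then show ?thesis using order_trans[OF bd[OF that] mult_left_mono[OF _ P]] by (simp add: mult.commute)
    qed
    then show ?thesis using P c unfolding PInf by (subst fock_norm_infinity_le_iff) (auto simp: B_def)
  qed
  then show ?thesis by (intro exI[of _ B]) (auto simp: B_def)
next
  case (real s)
  have s: "s > 0" using real q by simp
  define B where "B = exp ((\<bar>k * s + 1\<bar> + 1)\<^sup>2 / (4 * (\<delta> * s)))"
  define C where "C = (2 * B * (\<alpha> * s)) powr (1 / s)"
  have B: "B > 0" by (simp add: B_def)
  have "fock_norm \<alpha> p q f \<le> ennreal (C * P * (1 + c) powr inv_exp q)"
    if hol: "f holomorphic_on UNIV" and c: "c \<ge> 0" and P: "P \<ge> 0"
      and bd: "\<And>r. r \<ge> 0 \<Longrightarrow> fock_mean \<alpha> p f r \<le> P * ((1 + \<bar>r - c\<bar>) powr k * exp (- \<delta> * (r - c)\<^sup>2))" for f c P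
  proof -
    define D where "D = P powr s * (1 + c) * B"
    have D: "D \<ge> 0" using c B by (simp add: D_def)
    have pt: "ennreal (fock_mean \<alpha> p f r powr s * r) * indicator {0..} r \<le> ennreal D * ennreal (exp (- \<bar>r - c\<bar>))" for r
    proof (cases "r \<ge> 0")
      case True
      let ?x = "r - c"
      have "fock_mean \<alpha> p f r powr s * r \<le> (P * ((1 + \<bar>?x\<bar>) powr k * exp (- \<delta> * ?x\<^sup>2))) powr s * r"
        using True s by (intro mult_right_mono powr_mono2 bd fock_mean_nonneg hol) auto
      also have "\<dots> \<le> (P * ((1 + \<bar>?x\<bar>) powr k * exp (- \<delta> * ?x\<^sup>2))) powr s * ((1 + c) * (1 + \<bar>?x\<bar>))"
      proof (intro mult_left_mono)
        \<comment> \<open>The density r splits into the mass 1 + c at the centre and a factor 1 + |r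
          - c|, which raises the polynomial degree from k s to k s + 1.\<close>
        have "r \<le> (1 + c) + 1 * \<bar>?x\<bar>" using c abs_ge_self[of ?x] unfolding mult_1 by linarith
        also have "\<dots> \<le> (1 + c) + (1 + c) * \<bar>?x\<bar>"
          using c by (intro add_left_mono mult_right_mono) auto
        finally show "r \<le> (1 + c) * (1 + \<bar>?x\<bar>)" by (simp add: distrib_left)
      qed auto
      also have "\<dots> = P powr s * (1 + c) * ((1 + \<bar>?x\<bar>) powr (k * s + 1) * exp (- (\<delta> * s) * ?x\<^sup>2))"
      proof -
        have "exp (- \<delta> * ?x\<^sup>2) powr s = exp (- (\<delta> * s) * ?x\<^sup>2)" by (simp add: powr_def)
        moreover have "(1 + \<bar>?x\<bar>) powr (k * s + 1) = ((1 + \<bar>?x\<bar>) powr k) powr s * (1 + \<bar>?x\<bar>)"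
          by (simp add: powr_add powr_powr)
        ultimately show ?thesis using P by (simp add: powr_mult mult_ac)
      qed
      also have "\<dots> \<le> P powr s * (1 + c) * (B * exp (- \<bar>?x\<bar>))"
        unfolding B_def using c s \<delta> by (intro mult_left_mono powr_gaussian_le_exp) auto
      finally have "fock_mean \<alpha> p f r powr s * r \<le> D * exp (- \<bar>?x\<bar>)" by (simp add: D_def mult_ac)
      then show ?thesis using True D by (simp add: ennreal_mult[symmetric] ennreal_leI)
    qed simp
    have "fock_integral \<alpha> p s {0..} f \<le> (\<integral>\<^sup>+ r. ennreal D * ennreal (exp (- \<bar>r - c\<bar>)) \<partial>lborel)"
      unfolding fock_integral_def by (intro nn_integral_mono pt)
    also have "\<dots> = ennreal D * (\<integral>\<^sup>+ r. ennreal (exp (- \<bar>r - c\<bar>)) \<partial>lborel)"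
      by (rule nn_integral_cmult) measurable
    also have "\<dots> \<le> ennreal D * ennreal 2" by (intro mult_left_mono nn_integral_exp_abs) auto
    also have "\<dots> = ennreal (D * 2)" using D by (simp add: ennreal_mult)
    also have "D * 2 = (C * P * (1 + c) powr inv_exp q) powr s / (\<alpha> * s)"
      using P c s a B by (simp add: C_def D_def real powr_mult powr_powr)
    finally show ?thesis
      using c P unfolding real
      by (subst fock_norm_finite_le_iff[OF hol p s a]) (auto simp: C_def)
  qed
  moreover have "C > 0" using B a s by (simp add: C_def)
  ultimately show ?thesis by blast
qed (use q in auto)

text \<open>The surplus weight exp(- (\<beta> - \<alpha>) r^2 / 2) absorbs the polynomial growth r
  powr \<kappa>, whatever the exponents are.\<close>

lemma fock_norm_le_of_less:
  assumes p: "p1 > 0" "p2 > 0" and q: "q1 > 0" "q2 > 0" and a: "0 < \<alpha>" "\<alpha> < \<beta>"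
  shows "\<exists>C>0. \<forall>f N. f holomorphic_on UNIV \<longrightarrow> N \<ge> 0 \<longrightarrow> fock_norm \<alpha> p1 q1 f \<le> ennreal N \<longrightarrow>
    fock_norm \<beta> p2 q2 f \<le> ennreal (C * N)"
proof -
  define \<kappa> where "\<kappa> = max 0 (inv_exp p1 - inv_exp p2)"
  define \<delta> where "\<delta> = (\<beta> - \<alpha>) / 2"
  have \<kappa>: "\<kappa> \<ge> 0" "\<kappa> \<ge> inv_exp p1 - inv_exp p2" by (auto simp: \<kappa>_def)
  have \<delta>: "\<delta> > 0" using a by (simp add: \<delta>_def)
  have iq: "inv_exp q1 \<ge> 0" using q by (cases q1) auto
  obtain C1 where C1: "C1 > 0" "\<And>f N R. f holomorphic_on UNIV \<Longrightarrow> N \<ge> 0 \<Longrightarrow> fock_norm \<alpha> p1 q1 f \<le> ennreal N \<Longrightarrow> R \<ge> 4 \<Longrightarrow>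
     fock_mean \<alpha> p2 f R \<le> C1 * R powr (\<kappa> - inv_exp q1) * N"
    using fock_mean_le_norm[OF p q(1) a(1) \<kappa>] by blast
  obtain C2 where C2: "C2 > 0" "\<And>f N R. f holomorphic_on UNIV \<Longrightarrow> N \<ge> 0 \<Longrightarrow> fock_norm \<alpha> p1 q1 f \<le> ennreal N \<Longrightarrow> 0 \<le> R \<Longrightarrow> R \<le> 4 \<Longrightarrow>
     integral_mean p2 f R \<le> C2 * N"
    using integral_mean_le_norm[OF p q(1) a(1)] by blast
  have b: "\<beta> > 0" using a by simp
  obtain C3 where C3: "C3 > 0" "\<And>f c P. f holomorphic_on UNIV \<Longrightarrow> c \<ge> 0 \<Longrightarrow> P \<ge> 0 \<Longrightarrow>
     (\<And>r. r\<ge>0 \<Longrightarrow> fock_mean \<beta> p2 f r \<le> P * ((1 + \<bar>r - c\<bar>) powr \<kappa> * exp (- \<delta> * (r - c)\<^sup>2))) \<Longrightarrow>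
     fock_norm \<beta> p2 q2 f \<le> ennreal (C3 * P * (1 + c) powr inv_exp q2)"
    using fock_norm_le_gaussian[OF \<delta> p(2) q(2) b, of \<kappa>] by blast
  \<comment> \<open>On r \<le> 4 the surplus weight is at least exp(- 16 \<delta>), so this factor
    gives small and large radii one common majorant.\<close>
  define C where "C = C1 + C2 * exp (\<delta> * 16)"
  have "fock_norm \<beta> p2 q2 f \<le> ennreal ((C3 * C) * N)"
    if hol: "f holomorphic_on UNIV" and N: "N \<ge> 0" "fock_norm \<alpha> p1 q1 f \<le> ennreal N" for f N
  proof -
    have "fock_mean \<beta> p2 f r \<le> (C * N) * ((1 + \<bar>r - 0\<bar>) powr \<kappa> * exp (- \<delta> * (r - 0)\<^sup>2))" if r: "r \<ge> 0" for r
    proof (cases "r \<le> 4")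
      case True
      have "fock_mean \<beta> p2 f r \<le> integral_mean p2 f r * 1"
        unfolding fock_mean_def using b r by (intro mult_left_mono integral_mean_nonneg hol) auto
      also have "\<dots> \<le> C2 * N" using C2(2)[OF hol N r True] by simp
      also have "\<dots> \<le> C2 * N * ((1 + r) powr \<kappa> * exp (\<delta> * 16 - \<delta> * r\<^sup>2))"
      proof -
        have "r\<^sup>2 \<le> 4\<^sup>2" using True r by (intro power_mono) auto
        then have "\<delta> * r\<^sup>2 \<le> \<delta> * 16" using \<delta> by simp
        then have "1 * 1 \<le> (1 + r) powr \<kappa> * exp (\<delta> * 16 - \<delta> * r\<^sup>2)"
          using r \<kappa> by (intro mult_mono ge_one_powr_ge_zero) auto
        then show ?thesis using C2(1) N mult_left_mono[of 1 "(1 + r) powr \<kappa> * exp (\<delta> * 16 - \<delta> * r\<^sup>2)" "C2 * N"] by simp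
      qed
      also have "exp (\<delta> * 16 - \<delta> * r\<^sup>2) = exp (\<delta> * 16) * exp (- \<delta> * r\<^sup>2)" by (simp flip: exp_add)
      also have "C2 * N * ((1 + r) powr \<kappa> * (exp (\<delta> * 16) * exp (- \<delta> * r\<^sup>2)))
          = ((C2 * exp (\<delta> * 16)) * N) * ((1 + r) powr \<kappa> * exp (- \<delta> * r\<^sup>2))" by simp
      also have "\<dots> \<le> (C * N) * ((1 + r) powr \<kappa> * exp (- \<delta> * r\<^sup>2))"
        using C1(1) N by (intro mult_right_mono) (auto simp: C_def)
      finally show ?thesis using r by simp
    next
      case False
      have "fock_mean \<beta> p2 f r = fock_mean \<alpha> p2 f r * exp (- \<delta> * r\<^sup>2)"
        unfolding fock_mean_def mult.assoc exp_add[symmetric] by (simp add: \<delta>_def field_simps)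
      also have "\<dots> \<le> (C1 * r powr (\<kappa> - inv_exp q1) * N) * exp (- \<delta> * r\<^sup>2)"
        using False by (intro mult_right_mono C1(2) hol N) auto
      also have "\<dots> \<le> (C * (1 + r) powr \<kappa> * N) * exp (- \<delta> * r\<^sup>2)"
      proof (intro mult_right_mono mult_mono)
        have "r powr (\<kappa> - inv_exp q1) \<le> r powr \<kappa>" using False iq by (intro powr_mono) auto
        also have "\<dots> \<le> (1 + r) powr \<kappa>" using r \<kappa> by (intro powr_mono2) auto
        finally show "r powr (\<kappa> - inv_exp q1) \<le> (1 + r) powr \<kappa>" .
      qed (use C1(1) C2(1) N in \<open>auto simp: C_def\<close>)
      finally show ?thesis using r by (simp add: mult_ac)
    qed
    from C3(2)[OF hol _ _ this] show ?thesis using C1(1) C2(1) N by (simp add: C_def mult_ac)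
  qed
  moreover have "C3 * C > 0" using C1(1) C2(1) C3(1) by (simp add: C_def add_pos_pos)
  ultimately show ?thesis by blast
qed

text \<open>Tonelli: a fixed x lies in the window around R only for R in an interval of length
  4.\<close>

lemma fock_integral_sliding:
  assumes hol: "f holomorphic_on UNIV" and p: "p > 0"
  shows "(\<integral>\<^sup>+ R\<in>{4..}. fock_integral \<alpha> p s {R - 2..R + 2} f \<partial>lborel) \<le> ennreal 4 * fock_integral \<alpha> p s {0..} f"
proof -
  note [measurable] = borel_measurable_fock_mean[OF hol p]
  define w where "w x = ennreal (fock_mean \<alpha> p f x powr s * x) * indicator {0..} x" for x
  have [measurable]: "w \<in> borel_measurable borel" unfolding w_def[abs_def] by measurable
  have "(\<integral>\<^sup>+ R\<in>{4..}. fock_integral \<alpha> p s {R - 2..R + 2} f \<partial>lborel) \<le> (\<integral>\<^sup>+ R. \<integral>\<^sup>+ x. w x * indicator {x - 2..x + 2} R \<partial>lborel \<partial>lborel)"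
  proof (intro nn_integral_mono)
    fix R :: real
    show "fock_integral \<alpha> p s {R - 2..R + 2} f * indicator {4..} R \<le> (\<integral>\<^sup>+ x. w x * indicator {x - 2..x + 2} R \<partial>lborel)"
      unfolding fock_integral_def
      by (cases "R \<ge> 4") (auto intro!: nn_integral_mono simp: w_def indicator_def)
  qed
  also have "\<dots> = (\<integral>\<^sup>+ x. \<integral>\<^sup>+ R. w x * indicator {x - 2..x + 2} R \<partial>lborel \<partial>lborel)"
  proof (rule lborel_pair.Fubini')
    \<comment> \<open>An indicator whose interval moves with x is rewritten as that of a fixed
      region in the plane, which makes joint measurability visible.\<close>
    have "(\<lambda>(x, R). w x * indicator {z. fst z - 2 \<le> snd z \<and> snd z \<le> fst z + 2} (x, R)) \<in> borel_measurable (lborel \<Otimes>\<^sub>M lborel)"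
      by measurable
    then show "(\<lambda>(x, R). w x * indicator {x - 2..x + 2} R) \<in> borel_measurable (lborel \<Otimes>\<^sub>M lborel)"
      by (rule back_subst[where P = "\<lambda>g. g \<in> _"]) (auto simp: fun_eq_iff indicator_def)
  qed
  also have "\<dots> = (\<integral>\<^sup>+ x. ennreal 4 * w x \<partial>lborel)"
    by (simp add: nn_integral_cmult_indicator mult.commute)
  also have "\<dots> = ennreal 4 * integral\<^sup>N lborel w" by (rule nn_integral_cmult) measurable
  finally show ?thesis by (simp add: fock_integral_def w_def[abs_def])
qed

text \<open>For finite q2 this is a continuous form of the inclusion of l^q1 in l^q2. The q2-th
  power of the mean is at most a power of the local integral j, of which one factor is integrated
  over R while the others are bounded by the full integral.\<close>

lemma fock_norm_le_of_eq:
  assumes p: "p1 > 0" "p2 > 0" and q: "q1 > 0" "q2 > 0" and a: "0 < \<alpha>"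
    and le: "inv_exp q2 \<le> inv_exp q1" "inv_exp q2 - inv_exp p2 \<le> inv_exp q1 - inv_exp p1"
  shows "\<exists>C>0. \<forall>f N. f holomorphic_on UNIV \<longrightarrow> N \<ge> 0 \<longrightarrow> fock_norm \<alpha> p1 q1 f \<le> ennreal N \<longrightarrow>
    fock_norm \<alpha> p2 q2 f \<le> ennreal (C * N)"
proof -
  define \<kappa> where "\<kappa> = max 0 (inv_exp p1 - inv_exp p2)"
  have \<kappa>: "\<kappa> \<ge> 0" "\<kappa> \<ge> inv_exp p1 - inv_exp p2" "\<kappa> \<le> inv_exp q1 - inv_exp q2"
    using le by (auto simp: \<kappa>_def)
  obtain C1 where C1: "C1 > 0" "\<And>f N R. f holomorphic_on UNIV \<Longrightarrow> N \<ge> 0 \<Longrightarrow> fock_norm \<alpha> p1 q1 f \<le> ennreal N \<Longrightarrow> 0 \<le> R \<Longrightarrow> R \<le> 4 \<Longrightarrow>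
     integral_mean p2 f R \<le> C1 * N"
    using integral_mean_le_norm[OF p q(1) a(1)] by blast
  have small: "fock_mean \<alpha> p2 f R \<le> C1 * N"
    if hol: "f holomorphic_on UNIV" and N: "N \<ge> 0" "fock_norm \<alpha> p1 q1 f \<le> ennreal N" and R: "0 \<le> R" "R \<le> 4" for f N R
  proof -
    have "fock_mean \<alpha> p2 f R \<le> integral_mean p2 f R * 1"
      unfolding fock_mean_def using a R by (intro mult_left_mono integral_mean_nonneg hol) auto
    then show ?thesis using C1(2)[OF hol N R] by simp
  qed
  show ?thesis
  proof (cases q2)
    case PInf
    obtain C2 where C2: "C2 > 0" "\<And>f N R. f holomorphic_on UNIV \<Longrightarrow> N \<ge> 0 \<Longrightarrow> fock_norm \<alpha> p1 q1 f \<le> ennreal N \<Longrightarrow> R \<ge> 4 \<Longrightarrow>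
       fock_mean \<alpha> p2 f R \<le> C2 * R powr (\<kappa> - inv_exp q1) * N"
      using fock_mean_le_norm[OF p q(1) a(1) \<kappa>(1,2)] by blast
    have "fock_norm \<alpha> p2 q2 f \<le> ennreal ((C1 + C2) * N)"
      if hol: "f holomorphic_on UNIV" and N: "N \<ge> 0" "fock_norm \<alpha> p1 q1 f \<le> ennreal N" for f N
    proof -
      have "fock_mean \<alpha> p2 f R \<le> (C1 + C2) * N" if R: "R \<ge> 0" for R
      proof (cases "R \<le> 4")
        case True
        have "C1 * N \<le> (C1 + C2) * N" using C2(1) N by (intro mult_right_mono) auto
        then show ?thesis using small[OF hol N R True] by linarith
      next
        case False
        have "R powr (\<kappa> - inv_exp q1) \<le> R powr 0" using False \<kappa> by (intro powr_mono) (auto simp: PInf)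
        then have "C2 * R powr (\<kappa> - inv_exp q1) * N \<le> C2 * 1 * N"
          using C2(1) N False by (intro mult_right_mono mult_left_mono) auto
        also have "\<dots> \<le> (C1 + C2) * N" using C1(1) N by (simp add: algebra_simps)
        finally show ?thesis using C2(2)[OF hol N, of R] False by simp
      qed
      then show ?thesis using C1(1) C2(1) N unfolding PInf by (subst fock_norm_infinity_le_iff) auto
    qed
    moreover have "C1 + C2 > 0" using C1(1) C2(1) by simp
    ultimately show ?thesis by blast
  next
    case (real s2)
    have s2: "s2 > 0" using real q by simp
    obtain s1 where q1: "q1 = ereal s1" "s1 > 0"
      using le(1) q s2 by (cases q1) (auto simp: real zero_less_divide_iff)
    have s12: "1 \<le> s2 / s1" using le(1) s2 q1 by (simp add: real field_simps)
    obtain C2 where C2: "C2 > 0" "\<And>f R. f holomorphic_on UNIV \<Longrightarrow> R \<ge> 4 \<Longrightarrow> fock_integral \<alpha> p1 s1 {R - 2..R + 2} f < \<infinity> \<Longrightarrow>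
       fock_mean \<alpha> p2 f R \<le> C2 * R powr (\<kappa> - 1 / s1) * enn2real (fock_integral \<alpha> p1 s1 {R - 2..R + 2} f) powr (1 / s1)"
      using fock_mean_le_local_integral[OF p q1(2) a \<kappa>(1,2)] by blast
    define L where "L = 1 / (\<alpha> * s1)"
    \<comment> \<open>The first summand is from radii below 4, with 16 = 4 * 4 for the length of the
      interval and the bound on r; the factor 4 of the second is the window length in
      \<open>fock_integral_sliding\<close>.\<close>
    define E where "E = 16 * C1 powr s2 + 4 * C2 powr s2 * L powr (s2 / s1)"
    define C where "C = (E * (\<alpha> * s2)) powr (1 / s2)"
    have L: "L > 0" using a q1 by (simp add: L_def)
    have E: "E > 0" using C1(1) C2(1) L by (simp add: E_def add_pos_pos)
    have "fock_norm \<alpha> p2 q2 f \<le> ennreal (C * N)"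
      if hol: "f holomorphic_on UNIV" and N: "N \<ge> 0" "fock_norm \<alpha> p1 q1 f \<le> ennreal N" for f N
    proof -
      note [measurable] = borel_measurable_fock_mean[OF hol p(1)] borel_measurable_fock_mean[OF hol p(2)]
      let ?J = "\<lambda>R. fock_integral \<alpha> p1 s1 {R - 2..R + 2} f"
      let ?w = "\<lambda>r. ennreal (fock_mean \<alpha> p2 f r powr s2 * r)"
      have I: "fock_integral \<alpha> p1 s1 {0..} f \<le> ennreal (N powr s1 * L)"
        using N fock_norm_finite_le_iff[OF hol p(1) q1(2) a N(1)] by (simp add: q1 L_def)
      define T where "T = N powr s1 * L"
      have T: "T \<ge> 0" using L by (simp add: T_def)
      have low: "?w R * indicator {0..4} R \<le> ennreal (4 * (C1 * N) powr s2) * indicator {0..4} R" for R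
      proof (cases "0 \<le> R \<and> R \<le> 4")
        case True
        have "fock_mean \<alpha> p2 f R powr s2 * R \<le> (C1 * N) powr s2 * 4"
          using True s2 by (intro mult_mono powr_mono2 small hol N fock_mean_nonneg) auto
        then show ?thesis using True by (simp add: mult.commute ennreal_leI)
      qed simp
      have high: "?w R * indicator {4..} R \<le> ennreal (C2 powr s2 * T powr (s2 / s1 - 1)) * (?J R * indicator {4..} R)" for R
      proof (cases "R \<ge> 4")
        case True
        have "?J R \<le> fock_integral \<alpha> p1 s1 {0..} f" using True by (intro fock_integral_mono) auto
        with I have JT: "?J R \<le> ennreal T" by (simp add: T_def)
        then have fin: "?J R < \<infinity>" by (simp add: le_less_trans)
        define j where "j = enn2real (?J R)"
        have j: "?J R = ennreal j" "j \<ge> 0" using fin by (simp_all add: j_def)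
        have jT: "j \<le> T" using JT j T by (simp add: ennreal_le_iff)
        have "fock_mean \<alpha> p2 f R powr s2 * R \<le> (C2 * R powr (\<kappa> - 1 / s1) * j powr (1 / s1)) powr s2 * R"
          unfolding j_def using True s2 by (intro mult_right_mono powr_mono2 C2(2) hol fin fock_mean_nonneg) auto
        also have "\<dots> = C2 powr s2 * (R powr ((\<kappa> - 1 / s1) * s2) * R powr 1) * j powr (s2 / s1)"
          using C2(1) True j by (simp add: powr_mult powr_powr)
        also have "R powr ((\<kappa> - 1 / s1) * s2) * R powr 1 = R powr ((\<kappa> - 1 / s1) * s2 + 1)"
          by (simp only: powr_add)
        \<comment> \<open>This is where \<kappa> \<le> 1/q1 - 1/q2 enters: it makes \<kappa> - 1/s1
          at most - 1/s2, which balances the summand 1 coming from the density R.\<close>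
        also have "\<dots> \<le> R powr 0"
        proof (rule powr_mono)
          have "(\<kappa> - 1 / s1) * s2 \<le> (- 1 / s2) * s2"
            using \<kappa>(3) s2 q1 by (intro mult_right_mono) (auto simp: real)
          then show "(\<kappa> - 1 / s1) * s2 + 1 \<le> 0" using s2 by simp
        qed (use True in auto)
        \<comment> \<open>The remaining exponent s2/s1 - 1 is nonnegative because q1 \<le> q2, so
          this power of j may be replaced by that of T.\<close>
        also have "j powr (s2 / s1) = j powr (s2 / s1 - 1) * j"
          using j by (cases "j = 0") (auto simp: powr_diff)
        also have "C2 powr s2 * R powr 0 * (j powr (s2 / s1 - 1) * j) \<le> C2 powr s2 * 1 * (T powr (s2 / s1 - 1) * j)"
          using True s12 jT j by (intro mult_mono mult_left_mono mult_right_mono powr_mono2) auto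
        finally have "fock_mean \<alpha> p2 f R powr s2 * R \<le> C2 powr s2 * T powr (s2 / s1 - 1) * j"
          using C2(1) j by (simp add: mult_right_mono mult_left_mono mult_ac)
        then show ?thesis using True j by (simp add: j ennreal_mult[symmetric] ennreal_leI)
      qed simp
      have "fock_integral \<alpha> p2 s2 {0..} f \<le> (\<integral>\<^sup>+ R. ?w R * indicator {0..4} R + ?w R * indicator {4..} R \<partial>lborel)"
        unfolding fock_integral_def by (intro nn_integral_mono) (auto simp: indicator_def)
      also have "\<dots> = (\<integral>\<^sup>+ R. ?w R * indicator {0..4} R \<partial>lborel) + (\<integral>\<^sup>+ R. ?w R * indicator {4..} R \<partial>lborel)"
        by (intro nn_integral_add) measurable
      also have "(\<integral>\<^sup>+ R. ?w R * indicator {0..4} R \<partial>lborel) \<le> (\<integral>\<^sup>+ R. ennreal (4 * (C1 * N) powr s2) * indicator {0..4::real} R \<partial>lborel)"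
        by (intro nn_integral_mono low)
      also have "\<dots> = ennreal (4 * (C1 * N) powr s2) * ennreal 4"
        by (simp add: nn_integral_cmult_indicator)
      also have "\<dots> = ennreal (16 * (C1 * N) powr s2)" by (subst ennreal_mult[symmetric]) auto
      also have "(\<integral>\<^sup>+ R. ?w R * indicator {4..} R \<partial>lborel)
          \<le> (\<integral>\<^sup>+ R. ennreal (C2 powr s2 * T powr (s2 / s1 - 1)) * (?J R * indicator {4..} R) \<partial>lborel)"
        by (intro nn_integral_mono high)
      also have "\<dots> = ennreal (C2 powr s2 * T powr (s2 / s1 - 1)) * (\<integral>\<^sup>+ R\<in>{4..}. ?J R \<partial>lborel)"
      proof (rule nn_integral_cmult)
        have "(\<lambda>(R, x). ennreal (fock_mean \<alpha> p1 f x powr s1 * x) * indicator {z. fst z - 2 \<le> snd z \<and> snd z \<le> fst z + 2} (R, x))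
            \<in> borel_measurable (borel \<Otimes>\<^sub>M lborel)"
          by measurable
        then have "(\<lambda>(R, x). ennreal (fock_mean \<alpha> p1 f x powr s1 * x) * indicator {R - 2..R + 2} x)
            \<in> borel_measurable (borel \<Otimes>\<^sub>M lborel)"
          by (rule back_subst[where P = "\<lambda>g. g \<in> _"]) (auto simp: fun_eq_iff indicator_def)
        from lborel.borel_measurable_nn_integral[OF this]
        have [measurable]: "?J \<in> borel_measurable borel" by (simp add: fock_integral_def)
        show "(\<lambda>R. ?J R * indicator {4..} R) \<in> borel_measurable lborel" by measurable
      qed
      also have "\<dots> \<le> ennreal (C2 powr s2 * T powr (s2 / s1 - 1)) * (ennreal 4 * ennreal T)"
        using I by (intro mult_left_mono order_trans[OF fock_integral_sliding[OF hol p(1)]]) (auto simp: T_def)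
      also have "\<dots> = ennreal (4 * C2 powr s2 * (T powr (s2 / s1 - 1) * T))"
        using T by (simp add: ennreal_mult[symmetric] mult_ac del: ennreal_numeral)
      also have "T powr (s2 / s1 - 1) * T = T powr (s2 / s1)"
        using T by (cases "T = 0") (auto simp: powr_diff)
      also have "\<dots> = N powr s2 * L powr (s2 / s1)"
        using N q1 L by (simp add: T_def powr_mult powr_powr)
      also have "ennreal (16 * (C1 * N) powr s2) + ennreal (4 * C2 powr s2 * (N powr s2 * L powr (s2 / s1)))
         = ennreal (16 * (C1 * N) powr s2 + 4 * C2 powr s2 * (N powr s2 * L powr (s2 / s1)))"
        by (subst ennreal_plus) auto
      also have "16 * (C1 * N) powr s2 + 4 * C2 powr s2 * (N powr s2 * L powr (s2 / s1)) = E * N powr s2"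
        using C1(1) N by (simp add: E_def powr_mult algebra_simps)
      also have "\<dots> = (C * N) powr s2 / (\<alpha> * s2)"
        using N E a s2 by (simp add: C_def powr_mult powr_powr)
      finally have "fock_integral \<alpha> p2 s2 {0..} f \<le> ennreal ((C * N) powr s2 / (\<alpha> * s2))"
        by (simp add: add_mono)
      then show ?thesis unfolding real
        using N by (subst fock_norm_finite_le_iff[OF hol p(2) s2 a]) (auto simp: C_def)
    qed
    moreover have "C > 0" using E a s2 by (simp add: C_def)
    ultimately show ?thesis by blast
  qed (use q in auto)
qed

section \<open>Test functions and necessity\<close>

text \<open>Equal to 2 pi exp(-x) I_0(x) with the modified Bessel function I_0. It is of order x
  powr (-1/2), and this decay is the source of the exponent - 1/p in the norms of
  exponentials.\<close>

definition bessel_mean :: "real \<Rightarrow> real" where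
  "bessel_mean x = integral {0..2*pi} (\<lambda>\<theta>. exp (- (x * (1 - cos \<theta>))))"

lemma bessel_mean_integrable: "(\<lambda>\<theta>. exp (- (x * (1 - cos \<theta>)))) integrable_on {a..b::real}"
  by (intro integrable_continuous_interval continuous_intros)

lemma one_minus_cos: "1 - cos \<theta> = 2 * (sin (\<theta> / 2))\<^sup>2" for \<theta> :: real
  using cos_double_sin[of "\<theta> / 2"] by simp

lemma one_minus_cos_le: "1 - cos \<theta> \<le> \<theta>\<^sup>2 / 2" for \<theta> :: real
proof -
  have "(sin (\<theta> / 2))\<^sup>2 \<le> (\<theta> / 2)\<^sup>2"
    using abs_sin_x_le_abs_x[of "\<theta> / 2"] by (simp only: abs_le_square_iff)
  then show ?thesis unfolding one_minus_cos by (simp add: power_divide)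
qed

text \<open>With y = \<theta> / 2 \<le> 2 one has sin y \<ge> y - y^3 / 6 \<ge> y / 3, and 1 - cos
  \<theta> is 2 (sin y)^2.\<close>

lemma one_minus_cos_ge: 
  fixes \<theta> :: real
  assumes "0 \<le> \<theta>" "\<theta> \<le> pi"
  shows "\<theta>\<^sup>2 / 18 \<le> 1 - cos \<theta>"
proof -
  define y where "y = \<theta> / 2"
  have y: "0 \<le> y" "y \<le> 2" using assms pi_less_4 by (auto simp: y_def)
  have "\<bar>sin y - y\<bar> \<le> y ^ 3 / 6"
    using Maclaurin_sin_bound[of y 3] y by (simp add: sin_coeff_def eval_nat_numeral)
  moreover have "y ^ 3 \<le> y * 4"
  proof -
    have "y\<^sup>2 \<le> 2\<^sup>2" using y by (intro power_mono) auto
    then have "y * y\<^sup>2 \<le> y * 4" using y by (intro mult_left_mono) auto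
    then show ?thesis by (simp add: eval_nat_numeral)
  qed
  ultimately have "y / 3 \<le> sin y" by linarith
  then have "(y / 3)\<^sup>2 \<le> (sin y)\<^sup>2" using y by (intro power_mono) auto
  then show ?thesis unfolding one_minus_cos y_def[symmetric] by (simp add: y_def power_divide)
qed

lemma bessel_mean_nonneg: "bessel_mean x \<ge> 0"
  unfolding bessel_mean_def by (intro integral_nonneg bessel_mean_integrable) auto

text \<open>Only the arc of length x powr (-1/2) is kept; on it the exponent stays above -
  1/2.\<close>

lemma bessel_mean_ge:
  assumes x: "x \<ge> 1"
  shows "exp (- 1 / 2) * x powr (- 1 / 2) \<le> bessel_mean x"
proof -
  define t where "t = x powr (- 1 / 2)"
  have t: "0 \<le> t" "t \<le> 2 * pi"
  proof -
    have "x powr (- 1 / 2) \<le> x powr 0" using x by (intro powr_mono) auto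
    then show "t \<le> 2 * pi" using x pi_gt3 by (simp add: t_def)
  qed (simp add: t_def)
  have xt: "x * t\<^sup>2 = 1" using x unfolding t_def
    by (simp add: powr_power powr_minus field_simps)
  have "integral {0..t} (\<lambda>_. exp (- 1 / 2)) \<le> integral {0..t} (\<lambda>\<theta>. exp (- (x * (1 - cos \<theta>))))"
  proof (intro integral_le bessel_mean_integrable)
    fix \<theta> assume \<theta>: "\<theta> \<in> {0..t}"
    have "x * (1 - cos \<theta>) \<le> x * (\<theta>\<^sup>2 / 2)" using x one_minus_cos_le by (intro mult_left_mono) auto
    also have "\<dots> \<le> x * (t\<^sup>2 / 2)" using \<theta> x by (intro mult_left_mono divide_right_mono power_mono) auto
    also have "\<dots> = 1 / 2" using xt by simp
    finally show "exp (- 1 / 2) \<le> exp (- (x * (1 - cos \<theta>)))" by simp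
  qed auto
  also have "\<dots> \<le> bessel_mean x"
    unfolding bessel_mean_def using t by (intro integral_subset_le bessel_mean_integrable) auto
  finally show ?thesis using t by (simp add: t_def mult.commute)
qed

text \<open>Trades the Gaussian for an exponential, which has an elementary antiderivative.\<close>

lemma exp_minus_square_le: "exp (- (u\<^sup>2)) \<le> exp (1 / 4) * exp (- u)" for u :: real
proof -
  have "0 \<le> (u - 1 / 2)\<^sup>2" by simp
  then have "- (u\<^sup>2) \<le> 1 / 4 + - u" by (simp add: power2_eq_square algebra_simps)
  then show ?thesis by (simp flip: exp_add)
qed

text \<open>For x \<ge> 1 the integrand is dominated by exponentials of rate sqrt(x / 18) decaying
  from both ends of the period, where the cosine is 1. For x < 1 the trivial bound suffices, and 1 +
  x in place of x unites the cases.\<close>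

lemma bessel_mean_le: "\<exists>M>0. \<forall>x\<ge>0. bessel_mean x / (2 * pi) \<le> M * (1 + x) powr (- 1 / 2)"
proof -
  have large: "bessel_mean x \<le> 2 * exp (1 / 4) * sqrt 18 * x powr (- 1 / 2)" if x: "x \<ge> 1" for x
  proof -
    define k where "k = sqrt (x / 18)"
    have k: "k > 0" "k\<^sup>2 = x / 18" using x by (auto simp: k_def)
    have e: "exp (- (x * y\<^sup>2 / 18)) \<le> exp (1 / 4) * exp (- (k * y))" for y
      using exp_minus_square_le[of "k * y"] k by (simp add: power_mult_distrib)
    define F where "F \<theta> = exp (1 / 4) * ((exp (- (k * (2 * pi - \<theta>))) - exp (- (k * \<theta>))) / k)" for \<theta>
    have F: "((\<lambda>\<theta>. exp (1 / 4) * (exp (- (k * \<theta>)) + exp (- (k * (2 * pi - \<theta>))))) has_integral (F (2 * pi) - F 0)) {0..2*pi}"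
      unfolding F_def using k
      by (intro fundamental_theorem_of_calculus)
        (auto intro!: derivative_eq_intros simp: field_simps simp flip: has_real_derivative_iff_has_vector_derivative)
    have "bessel_mean x \<le> integral {0..2*pi} (\<lambda>\<theta>. exp (1 / 4) * (exp (- (k * \<theta>)) + exp (- (k * (2 * pi - \<theta>)))))"
      unfolding bessel_mean_def
    proof (intro integral_le bessel_mean_integrable has_integral_integrable[OF F])
      fix \<theta> assume \<theta>: "\<theta> \<in> {0..2*pi}"
      have *: "exp (- (x * (1 - cos \<phi>))) \<le> exp (1 / 4) * exp (- (k * \<phi>))" if "0 \<le> \<phi>" "\<phi> \<le> pi" for \<phi>
      proof -
        have "x * (\<phi>\<^sup>2 / 18) \<le> x * (1 - cos \<phi>)" using x that one_minus_cos_ge by (intro mult_left_mono) auto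
        then have "exp (- (x * (1 - cos \<phi>))) \<le> exp (- (x * \<phi>\<^sup>2 / 18))" by simp
        also note e[of \<phi>]
        finally show ?thesis .
      qed
      show "exp (- (x * (1 - cos \<theta>))) \<le> exp (1 / 4) * (exp (- (k * \<theta>)) + exp (- (k * (2 * pi - \<theta>))))"
      proof (cases "\<theta> \<le> pi")
        case True
        then show ?thesis using *[of \<theta>] \<theta> by (simp add: distrib_left add_increasing2)
      next
        case False
        then show ?thesis using *[of "2 * pi - \<theta>"] \<theta> by (simp add: distrib_left add_increasing cos_diff)
      qed
    qed
    also have "\<dots> = exp (1 / 4) * (2 * (1 - exp (- (k * (2 * pi)))) / k)"
      unfolding integral_unique[OF F] using k by (simp add: F_def field_simps)
    also have "\<dots> \<le> exp (1 / 4) * (2 * 1 / k)"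
      using k by (intro mult_left_mono divide_right_mono) auto
    also have "\<dots> = 2 * exp (1 / 4) * sqrt 18 * x powr (- 1 / 2)"
      using x by (simp add: k_def real_sqrt_divide powr_minus powr_half_sqrt field_simps)
    finally show ?thesis .
  qed
  have small: "bessel_mean x \<le> 2 * pi" if "x \<ge> 0" for x
  proof -
    have "bessel_mean x \<le> integral {0..2*pi} (\<lambda>_. 1)"
      unfolding bessel_mean_def using that by (intro integral_le bessel_mean_integrable) auto
    then show ?thesis by simp
  qed
  define M where "M = 2 powr (1 / 2) * (1 + 2 * exp (1 / 4) * sqrt 18)"
  have "bessel_mean x / (2 * pi) \<le> M * (1 + x) powr (- 1 / 2)" if x: "x \<ge> 0" for x
  proof (cases "x \<ge> 1")
    case True
    have "bessel_mean x / (2 * pi) \<le> bessel_mean x / 1"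
      using bessel_mean_nonneg pi_gt3 by (intro divide_left_mono) auto
    also have "\<dots> \<le> 2 * exp (1 / 4) * sqrt 18 * x powr (- 1 / 2)" using large[OF True] by simp
    also have "x powr (- 1 / 2) = 2 powr (1 / 2) * (2 * x) powr (- 1 / 2)"
      using True by (simp add: powr_mult powr_minus)
    also have "\<dots> \<le> 2 powr (1 / 2) * (1 + x) powr (- 1 / 2)"
      using True by (intro mult_left_mono powr_mono2') auto
    also have "2 * exp (1 / 4) * sqrt 18 * (2 powr (1 / 2) * (1 + x) powr (- 1 / 2)) \<le> M * (1 + x) powr (- 1 / 2)"
      by (simp add: M_def algebra_simps)
    finally show ?thesis by simp
  next
    case False
    have "bessel_mean x / (2 * pi) \<le> 1" using small[OF x] by simp
    also have "1 = 2 powr (1 / 2) * 2 powr (- 1 / 2 :: real)" unfolding powr_add[symmetric] by simp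
    also have "\<dots> \<le> 2 powr (1 / 2) * (1 + x) powr (- 1 / 2)"
      using False x by (intro mult_left_mono powr_mono2') auto
    also have "\<dots> \<le> M * (1 + x) powr (- 1 / 2)" by (intro mult_right_mono) (auto simp: M_def)
    finally show ?thesis .
  qed
  moreover have "M > 0" by (simp add: M_def add_pos_pos)
  ultimately show ?thesis by blast
qed

section \<open>Exponentials as test functions\<close>

lemma exp_holomorphic: "(\<lambda>z. exp (of_real b * z)) holomorphic_on A"
  by (intro holomorphic_intros)

lemma integral_mean_exp_infinity:
  assumes "b \<ge> 0" "r \<ge> 0"
  shows "integral_mean \<infinity> (\<lambda>z. exp (of_real b * z)) r = exp (b * r)"
proof (rule antisym)
  show "integral_mean \<infinity> (\<lambda>z. exp (of_real b * z)) r \<le> exp (b * r)"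
  proof (rule integral_mean_infinity_le)
    fix z :: complex assume "cmod z = \<bar>r\<bar>"
    then have "Re z \<le> r" using complex_Re_le_cmod[of z] assms by simp
    then show "cmod (exp (of_real b * z)) \<le> exp (b * r)" using assms by (simp add: mult_left_mono)
  qed
  show "exp (b * r) \<le> integral_mean \<infinity> (\<lambda>z. exp (of_real b * z)) r"
    using norm_le_integral_mean_infinity[OF exp_holomorphic, of "of_real r" r b] assms by simp
qed

lemma integral_mean_exp_finite:
  assumes p: "p > 0" and "b \<ge> 0" "r \<ge> 0"
  shows "integral_mean (ereal p) (\<lambda>z. exp (of_real b * z)) r
    = exp (b * r) * (bessel_mean (p * b * r) / (2 * pi)) powr (1 / p)"
proof -
  have "circle_mean p (\<lambda>z. exp (of_real b * z)) r = integral {0..2*pi} (\<lambda>\<theta>. exp (p * b * r) * exp (- (p * b * r * (1 - cos \<theta>))))"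
    unfolding circle_mean_def by (intro integral_cong) (simp add: powr_def algebra_simps flip: exp_add)
  also have "\<dots> = exp (p * b * r) * bessel_mean (p * b * r)"
    by (simp add: bessel_mean_def)
  finally show ?thesis using p bessel_mean_nonneg[of "p * b * r"]
    unfolding integral_mean_finite[OF exp_holomorphic p]
    by (simp add: powr_mult powr_divide) (simp add: powr_def)
qed

text \<open>The reason for writing the exponential as exp(\<alpha> c z): its Gaussian-weighted
  maximum modulus peaks at radius c.\<close>

lemma gaussian_square:
  fixes \<alpha> c r :: real
  shows "exp (\<alpha> * c * r) * exp (- (\<alpha> / 2) * r\<^sup>2) = exp (\<alpha> * c\<^sup>2 / 2) * exp (- (\<alpha> / 2) * (r - c)\<^sup>2)"
  unfolding exp_add[symmetric] by (simp add: power2_eq_square algebra_simps)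

text \<open>Near r = c the Bessel argument is of order c^2, which gives the factor c powr (- 1/p).
  Away from the peak this decay fails, but only by a power of 1 + |r - c|, which the Gaussian
  tolerates.\<close>

lemma fock_mean_exp_le:
  assumes p: "p > 0" and a: "\<alpha> > 0"
  shows "\<exists>C>0. \<forall>c\<ge>1. \<forall>r\<ge>0. fock_mean \<alpha> p (\<lambda>z. exp (of_real (\<alpha> * c) * z)) r
    \<le> C * exp (\<alpha> * c\<^sup>2 / 2) * c powr (- inv_exp p) * ((1 + \<bar>r - c\<bar>) powr inv_exp p * exp (- (\<alpha> / 2) * (r - c)\<^sup>2))"
proof (cases p)
  case PInf
  have "fock_mean \<alpha> p (\<lambda>z. exp (of_real (\<alpha> * c) * z)) r = exp (\<alpha> * c\<^sup>2 / 2) * exp (- (\<alpha> / 2) * (r - c)\<^sup>2)"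
    if "c \<ge> 1" "r \<ge> 0" for c r
  proof -
    have "0 \<le> \<alpha> * c" using a that by simp
    from integral_mean_exp_infinity[OF this that(2)] show ?thesis
      unfolding fock_mean_def PInf by (simp only: gaussian_square)
  qed
  then show ?thesis by (intro exI[of _ 1]) (auto simp: PInf)
next
  case (real s)
  have s: "s > 0" using p real by simp
  obtain M where M: "M > 0" "\<And>x. x \<ge> 0 \<Longrightarrow> bessel_mean x / (2 * pi) \<le> M * (1 + x) powr (- 1 / 2)"
    using bessel_mean_le by blast
  \<comment> \<open>Chosen so that m (1 + c r) \<le> 1 + x for the Bessel argument x = s \<alpha> c
    r.\<close>
  define m where "m = min 1 (s * \<alpha>)"
  define D where "D = M * (m / 4) powr (- 1 / 2)"
  have m: "m > 0" using s a by (simp add: m_def)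
  have D: "D > 0" using M(1) m by (simp add: D_def)
  have "fock_mean \<alpha> p (\<lambda>z. exp (of_real (\<alpha> * c) * z)) r
     \<le> D powr (1 / s) * exp (\<alpha> * c\<^sup>2 / 2) * c powr (- inv_exp p) * ((1 + \<bar>r - c\<bar>) powr inv_exp p * exp (- (\<alpha> / 2) * (r - c)\<^sup>2))"
    if c: "c \<ge> 1" and r: "r \<ge> 0" for c r
  proof -
    define x where "x = s * (\<alpha> * c) * r"
    define y where "y = 1 + \<bar>r - c\<bar>"
    have x: "x \<ge> 0" using s a c r by (simp add: x_def)
    have y: "y \<ge> 1" by (simp add: y_def)
    have "c\<^sup>2 \<le> 4 * y\<^sup>2 * (1 + c * r)"
    \<comment> \<open>Either r is comparable to c, and then c r \<ge> c^2 / 2, or |r - c| > c / 2,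
      and then y is comparable to c.\<close>
    proof (cases "r \<ge> c / 2")
      case True
      have "c * (c / 2) \<le> c * r" using True c by (intro mult_left_mono) auto
      then have "c * c \<le> 2 * (c * r)" by simp
      moreover have "0 \<le> c * r" using c r by simp
      moreover have "2 * t \<le> 4 * 1 * (1 + t)" if "0 \<le> t" for t :: real using that by simp
      ultimately have "c\<^sup>2 \<le> 4 * 1 * (1 + c * r)" unfolding power2_eq_square by (meson order_trans)
      also have "\<dots> \<le> 4 * y\<^sup>2 * (1 + c * r)"
        using y c r by (intro mult_right_mono mult_left_mono) auto
      finally show ?thesis .
    next
      case False
      then have "c \<le> 2 * y" using abs_ge_minus_self[of "r - c"] by (simp add: y_def)
      then have "c\<^sup>2 \<le> (2 * y)\<^sup>2" using c by (intro power_mono) auto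
      also have "\<dots> = 4 * y\<^sup>2 * 1" by (simp add: power_mult_distrib)
      also have "\<dots> \<le> 4 * y\<^sup>2 * (1 + c * r)" using c r by (intro mult_left_mono) auto
      finally show ?thesis .
    qed
    moreover have "m * (1 + c * r) \<le> 1 + x"
    proof -
      have "m * (c * r) \<le> (s * \<alpha>) * (c * r)" using c r by (intro mult_right_mono) (auto simp: m_def)
      moreover have "m * 1 \<le> 1" by (simp add: m_def)
      ultimately show ?thesis by (simp add: x_def algebra_simps)
    qed
    then have "4 * y\<^sup>2 * (1 + c * r) * (m / 4) \<le> y\<^sup>2 * (1 + x)"
      using y mult_left_mono[of "m * (1 + c * r)" "1 + x" "y\<^sup>2"] by (simp add: mult_ac)
    ultimately have "c\<^sup>2 * (m / 4) \<le> y\<^sup>2 * (1 + x)"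
      using m mult_right_mono[of "c\<^sup>2" "4 * y\<^sup>2 * (1 + c * r)" "m / 4"] by linarith
    then have "(c / y)\<^sup>2 * (m / 4) \<le> 1 + x"
      using y by (simp add: power_divide field_simps)
    then have "(1 + x) powr (- 1 / 2) \<le> ((c / y)\<^sup>2 * (m / 4)) powr (- 1 / 2)"
      using m c y by (intro powr_mono2') auto
    also have "\<dots> = ((c / y)\<^sup>2) powr (- 1 / 2) * (m / 4) powr (- 1 / 2)"
      by (rule powr_mult)
    also have "((c / y)\<^sup>2) powr (- 1 / 2) = (c / y) powr (- 1)"
      using c y by (simp add: powr_powr flip: powr_numeral)
    also have "\<dots> = y / c" using c y by (simp add: powr_minus)
    finally have "M * (1 + x) powr (- 1 / 2) \<le> M * (y / c * (m / 4) powr (- 1 / 2))"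
      using M(1) by (intro mult_left_mono) auto
    with M(2)[OF x] have "bessel_mean x / (2 * pi) \<le> D * (y / c)" by (simp add: D_def mult_ac)
    then have "(bessel_mean x / (2 * pi)) powr (1 / s) \<le> (D * (y / c)) powr (1 / s)"
      using s bessel_mean_nonneg by (intro powr_mono2) auto
    also have "\<dots> = D powr (1 / s) * c powr (- inv_exp p) * y powr inv_exp p"
      using D c y s by (simp add: real powr_mult powr_divide powr_minus field_simps)
    finally have B: "(bessel_mean x / (2 * pi)) powr (1 / s) \<le> D powr (1 / s) * c powr (- inv_exp p) * y powr inv_exp p" .
    have "0 \<le> \<alpha> * c" using a c by simp
    from integral_mean_exp_finite[OF s this r]
    have "fock_mean \<alpha> p (\<lambda>z. exp (of_real (\<alpha> * c) * z)) r = exp (\<alpha> * c * r) * exp (- (\<alpha> / 2) * r\<^sup>2) * (bessel_mean x / (2 * pi)) powr (1 / s)"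
      by (simp only: fock_mean_def real x_def) (simp only: mult_ac)
    also have "\<dots> \<le> exp (\<alpha> * c * r) * exp (- (\<alpha> / 2) * r\<^sup>2) * (D powr (1 / s) * c powr (- inv_exp p) * y powr inv_exp p)"
      by (intro mult_left_mono B) auto
    finally show ?thesis unfolding gaussian_square by (simp add: y_def mult_ac)
  qed
  moreover have "D powr (1 / s) > 0" using D by simp
  ultimately show ?thesis by blast
qed (use p in auto)

lemma fock_mean_exp_ge:
  assumes p: "p > 0" and a: "\<alpha> > 0"
  shows "\<exists>C>0. \<exists>c0\<ge>1. \<forall>c\<ge>c0. \<forall>r. c \<le> r \<longrightarrow> r \<le> c + 1 \<longrightarrow>
    C * exp (\<alpha> * c\<^sup>2 / 2) * c powr (- inv_exp p) \<le> fock_mean \<alpha> p (\<lambda>z. exp (of_real (\<alpha> * c) * z)) r"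
proof -
  have near: "exp (- (\<alpha> / 2)) \<le> exp (- (\<alpha> / 2) * (r - c)\<^sup>2)" if "c \<le> r" "r \<le> c + 1" for c r
  proof -
    have "(r - c)\<^sup>2 \<le> 1\<^sup>2" using that by (intro power_mono) auto
    then show ?thesis using a by simp
  qed
  show ?thesis
  proof (cases p)
    case PInf
    have "exp (- (\<alpha> / 2)) * exp (\<alpha> * c\<^sup>2 / 2) * c powr (- inv_exp p) \<le> fock_mean \<alpha> p (\<lambda>z. exp (of_real (\<alpha> * c) * z)) r"
      if c: "c \<ge> 1" and r: "c \<le> r" "r \<le> c + 1" for c r
    proof -
      have "0 \<le> \<alpha> * c" "0 \<le> r" using a c r by auto
      from integral_mean_exp_infinity[OF this]
      have "fock_mean \<alpha> p (\<lambda>z. exp (of_real (\<alpha> * c) * z)) r = exp (\<alpha> * c * r) * exp (- (\<alpha> / 2) * r\<^sup>2)"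
        by (simp only: fock_mean_def PInf)
      then show ?thesis unfolding gaussian_square using near[OF r] c by (simp add: PInf mult.commute)
    qed
    then show ?thesis by (intro exI[of _ "exp (- (\<alpha> / 2))"] conjI exI[of _ 1]) auto
  next
    case (real s)
    have s: "s > 0" using p real by simp
    \<comment> \<open>From c0 on the Bessel argument is at least 1, as \<open>bessel_mean_ge\<close>
      requires.\<close>
    define c0 where "c0 = max 1 (1 / (s * \<alpha>))"
    define D where "D = exp (- 1 / 2) * (2 * s * \<alpha>) powr (- 1 / 2) / (2 * pi)"
    have D: "D > 0" using s a by (simp add: D_def)
    have "exp (- (\<alpha> / 2)) * D powr (1 / s) * exp (\<alpha> * c\<^sup>2 / 2) * c powr (- inv_exp p) \<le> fock_mean \<alpha> p (\<lambda>z. exp (of_real (\<alpha> * c) * z)) r"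
      if c: "c \<ge> c0" and r: "c \<le> r" "r \<le> c + 1" for c r
    proof -
      define x where "x = s * (\<alpha> * c) * r"
      have c1: "c \<ge> 1" "c * (s * \<alpha>) \<ge> 1" using c s a by (auto simp: c0_def field_simps)
      have "1 * 1 \<le> (c * (s * \<alpha>)) * r" using c1 r s a by (intro mult_mono) auto
      then have x: "x \<ge> 1" by (simp add: x_def mult_ac)
      have "x \<le> s * (\<alpha> * c) * (2 * c)" unfolding x_def using c1 r s a by (intro mult_left_mono) auto
      also have "\<dots> = 2 * s * \<alpha> * c\<^sup>2" by (simp add: power2_eq_square)
      finally have "(2 * s * \<alpha> * c\<^sup>2) powr (- 1 / 2) \<le> x powr (- 1 / 2)"
        using x by (intro powr_mono2') auto
      moreover have "(2 * s * \<alpha> * c\<^sup>2) powr (- 1 / 2) = (2 * s * \<alpha>) powr (- 1 / 2) * c powr (- 1)"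
        using s a c1 by (simp add: powr_mult powr_powr flip: powr_numeral)
      ultimately have "exp (- 1 / 2) * ((2 * s * \<alpha>) powr (- 1 / 2) * c powr (- 1)) \<le> exp (- 1 / 2) * x powr (- 1 / 2)"
        by (intro mult_left_mono) auto
      also note bessel_mean_ge[OF x]
      finally have "exp (- 1 / 2) * ((2 * s * \<alpha>) powr (- 1 / 2) * c powr (- 1)) / (2 * pi) \<le> bessel_mean x / (2 * pi)"
        by (rule divide_right_mono) simp
      moreover have "D * c powr (- 1) = exp (- 1 / 2) * ((2 * s * \<alpha>) powr (- 1 / 2) * c powr (- 1)) / (2 * pi)"
        by (simp add: D_def)
      ultimately have "D * c powr (- 1) \<le> bessel_mean x / (2 * pi)" by simp
      then have "(D * c powr (- 1)) powr (1 / s) \<le> (bessel_mean x / (2 * pi)) powr (1 / s)"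
        using D s by (intro powr_mono2) auto
      moreover have "(D * c powr (- 1)) powr (1 / s) = D powr (1 / s) * c powr (- inv_exp p)"
        unfolding powr_mult powr_powr using s by (simp add: real)
      ultimately have B: "D powr (1 / s) * c powr (- inv_exp p) \<le> (bessel_mean x / (2 * pi)) powr (1 / s)" by simp
      have "0 \<le> \<alpha> * c" "0 \<le> r" using a c1 r by auto
      from integral_mean_exp_finite[OF s this]
      have eq: "fock_mean \<alpha> p (\<lambda>z. exp (of_real (\<alpha> * c) * z)) r = exp (\<alpha> * c * r) * exp (- (\<alpha> / 2) * r\<^sup>2) * (bessel_mean x / (2 * pi)) powr (1 / s)"
        by (simp only: fock_mean_def real x_def) (simp only: mult_ac)
      have "exp (- (\<alpha> / 2)) * D powr (1 / s) * exp (\<alpha> * c\<^sup>2 / 2) * c powr (- inv_exp p)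
          = exp (\<alpha> * c\<^sup>2 / 2) * exp (- (\<alpha> / 2)) * (D powr (1 / s) * c powr (- inv_exp p))" by simp
      also have "\<dots> \<le> exp (\<alpha> * c\<^sup>2 / 2) * exp (- (\<alpha> / 2) * (r - c)\<^sup>2) * (bessel_mean x / (2 * pi)) powr (1 / s)"
        by (intro mult_mono mult_left_mono near r B) auto
      finally show ?thesis unfolding eq gaussian_square .
    qed
    moreover have "exp (- (\<alpha> / 2)) * D powr (1 / s) > 0" using D by simp
    moreover have "c0 \<ge> 1" by (simp add: c0_def)
    ultimately show ?thesis by blast
  qed (use p in auto)
qed

text \<open>The converse of \<open>fock_norm_le_gaussian\<close> for a function that is large on one
  annulus: the interval [c, c + 1] has radial mass at least c.\<close>

lemma fock_norm_lower_bound: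
  assumes p: "p > 0" and q: "q > 0" and a: "\<alpha> > 0"
  shows "\<exists>C>0. \<forall>f N P c. f holomorphic_on UNIV \<longrightarrow> N \<ge> 0 \<longrightarrow> fock_norm \<alpha> p q f \<le> ennreal N \<longrightarrow> P \<ge> 0 \<longrightarrow> c \<ge> 0 \<longrightarrow>
     (\<forall>r. c \<le> r \<longrightarrow> r \<le> c + 1 \<longrightarrow> P \<le> fock_mean \<alpha> p f r) \<longrightarrow> P * c powr inv_exp q \<le> C * N"
proof (cases q)
  case PInf
  have "P * c powr inv_exp q \<le> 1 * N"
    if N: "N \<ge> 0" "fock_norm \<alpha> p q f \<le> ennreal N" and P: "P \<ge> 0" "c \<ge> 0" and le: "\<And>r. c \<le> r \<Longrightarrow> r \<le> c + 1 \<Longrightarrow> P \<le> fock_mean \<alpha> p f r" for f N P c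
    using N(2) le[of c] P unfolding PInf fock_norm_infinity_le_iff[OF N(1)] by (cases "c = 0") (auto simp: N(1) intro: order_trans)
  then show ?thesis by (intro exI[of _ 1]) auto
next
  case (real s)
  have s: "s > 0" using real q by simp
  have "P * c powr inv_exp q \<le> (1 / (\<alpha> * s)) powr (1 / s) * N"
    if hol: "f holomorphic_on UNIV" and N: "N \<ge> 0" "fock_norm \<alpha> p q f \<le> ennreal N" and P: "P \<ge> 0" "c \<ge> 0"
      and le: "\<And>r. c \<le> r \<Longrightarrow> r \<le> c + 1 \<Longrightarrow> P \<le> fock_mean \<alpha> p f r" for f N P c
  proof -
    have "ennreal (P powr s * c) = (\<integral>\<^sup>+ r. ennreal (P powr s * c) * indicator {c..c + 1} r \<partial>lborel)"
      by (simp add: nn_integral_cmult_indicator)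
    also have "\<dots> \<le> fock_integral \<alpha> p s {0..} f"
      unfolding fock_integral_def
    proof (intro nn_integral_mono)
      fix r :: real
      show "ennreal (P powr s * c) * indicator {c..c + 1} r \<le> ennreal (fock_mean \<alpha> p f r powr s * r) * indicator {0..} r"
      proof (cases "c \<le> r \<and> r \<le> c + 1")
        case True
        then have "P powr s * c \<le> fock_mean \<alpha> p f r powr s * r"
          using P s by (intro mult_mono powr_mono2 le) auto
        then show ?thesis using True P by (simp add: ennreal_leI)
      qed simp
    qed
    also have "\<dots> \<le> ennreal (N powr s / (\<alpha> * s))"
      using N fock_norm_finite_le_iff[OF hol p s a N(1)] by (simp add: real)
    finally have "P powr s * c \<le> N powr s * (1 / (\<alpha> * s))"
      using a s by (simp add: ennreal_le_iff)
    then have "(P powr s * c) powr (1 / s) \<le> (N powr s * (1 / (\<alpha> * s))) powr (1 / s)"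
      using s P by (intro powr_mono2) auto
    also have "\<dots> = (N powr s) powr (1 / s) * (1 / (\<alpha> * s)) powr (1 / s)"
      using a s by (intro powr_mult) 
    also have "(P powr s * c) powr (1 / s) = (P powr s) powr (1 / s) * c powr (1 / s)"
      using P by (intro powr_mult)
    finally show ?thesis using P N s by (simp add: real powr_powr mult.commute)
  qed
  moreover have "(1 / (\<alpha> * s)) powr (1 / s) > 0" using a s by simp
  ultimately show ?thesis by blast
qed (use q in auto)

lemma fock_norm_exp_le:
  assumes p: "p > 0" and q: "q > 0" and a: "\<alpha> > 0"
  shows "\<exists>C>0. \<forall>c\<ge>1. fock_norm \<alpha> p q (\<lambda>z. exp (of_real (\<alpha> * c) * z))
    \<le> ennreal (C * (exp (\<alpha> * c\<^sup>2 / 2) * c powr (inv_exp q - inv_exp p)))"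
proof -
  have a2: "\<alpha> / 2 > 0" using a by simp
  have iq: "inv_exp q \<ge> 0" using q by (cases q) auto
  obtain C1 where C1: "C1 > 0" "\<And>c r. c \<ge> 1 \<Longrightarrow> r \<ge> 0 \<Longrightarrow> fock_mean \<alpha> p (\<lambda>z. exp (of_real (\<alpha> * c) * z)) r
    \<le> C1 * exp (\<alpha> * c\<^sup>2 / 2) * c powr (- inv_exp p) * ((1 + \<bar>r - c\<bar>) powr inv_exp p * exp (- (\<alpha> / 2) * (r - c)\<^sup>2))"
    using fock_mean_exp_le[OF p a] by blast
  obtain C2 where C2: "C2 > 0" "\<And>f c P. f holomorphic_on UNIV \<Longrightarrow> c \<ge> 0 \<Longrightarrow> P \<ge> 0 \<Longrightarrow>
     (\<And>r. r\<ge>0 \<Longrightarrow> fock_mean \<alpha> p f r \<le> P * ((1 + \<bar>r - c\<bar>) powr inv_exp p * exp (- (\<alpha> / 2) * (r - c)\<^sup>2))) \<Longrightarrow>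
     fock_norm \<alpha> p q f \<le> ennreal (C2 * P * (1 + c) powr inv_exp q)"
    using fock_norm_le_gaussian[OF a2 p q a, of "inv_exp p"] by blast
  have "fock_norm \<alpha> p q (\<lambda>z. exp (of_real (\<alpha> * c) * z))
    \<le> ennreal ((C2 * C1 * 2 powr inv_exp q) * (exp (\<alpha> * c\<^sup>2 / 2) * c powr (inv_exp q - inv_exp p)))"
    if c: "c \<ge> 1" for c
  proof -
    define P where "P = C1 * exp (\<alpha> * c\<^sup>2 / 2) * c powr (- inv_exp p)"
    have P: "P \<ge> 0" using C1(1) by (simp add: P_def)
    have c0: "c \<ge> 0" using c by simp
    have "fock_norm \<alpha> p q (\<lambda>z. exp (of_real (\<alpha> * c) * z)) \<le> ennreal (C2 * P * (1 + c) powr inv_exp q)"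
      unfolding P_def by (rule C2(2)[OF exp_holomorphic c0 _ C1(2)[OF c]]) (use C1(1) in simp_all)
    also have "\<dots> \<le> ennreal (C2 * P * (2 * c) powr inv_exp q)"
      using C2(1) P c iq by (intro ennreal_leI mult_left_mono powr_mono2) auto
    also have "C2 * P * (2 * c) powr inv_exp q = (C2 * C1 * 2 powr inv_exp q) * (exp (\<alpha> * c\<^sup>2 / 2) * c powr (inv_exp q - inv_exp p))"
    proof -
      have "c powr (inv_exp q - inv_exp p) = c powr (- inv_exp p) * c powr inv_exp q"
        unfolding powr_add[symmetric] by simp
      then show ?thesis by (simp only: P_def powr_mult mult_ac)
    qed
    finally show ?thesis .
  qed
  moreover have "C2 * C1 * 2 powr inv_exp q > 0" using C1(1) C2(1) by simp
  ultimately show ?thesis by blast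
qed

lemma fock_norm_exp_ge:
  assumes p: "p > 0" and q: "q > 0" and a: "\<alpha> > 0"
  shows "\<exists>C>0. \<exists>c0\<ge>1. \<forall>c\<ge>c0. \<forall>N\<ge>0. fock_norm \<alpha> p q (\<lambda>z. exp (of_real (\<alpha> * c) * z)) \<le> ennreal N \<longrightarrow>
    exp (\<alpha> * c\<^sup>2 / 2) * c powr (inv_exp q - inv_exp p) \<le> C * N"
proof -
  obtain C1 c0 where C1: "C1 > 0" "c0 \<ge> 1" "\<And>c r. c \<ge> c0 \<Longrightarrow> c \<le> r \<Longrightarrow> r \<le> c + 1 \<Longrightarrow>
    C1 * exp (\<alpha> * c\<^sup>2 / 2) * c powr (- inv_exp p) \<le> fock_mean \<alpha> p (\<lambda>z. exp (of_real (\<alpha> * c) * z)) r"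
    using fock_mean_exp_ge[OF p a] by blast
  obtain C2 where C2: "C2 > 0" "\<And>f N P c. f holomorphic_on UNIV \<Longrightarrow> N \<ge> 0 \<Longrightarrow> fock_norm \<alpha> p q f \<le> ennreal N \<Longrightarrow> P \<ge> 0 \<Longrightarrow> c \<ge> 0 \<Longrightarrow>
     (\<And>r. c \<le> r \<Longrightarrow> r \<le> c + 1 \<Longrightarrow> P \<le> fock_mean \<alpha> p f r) \<Longrightarrow> P * c powr inv_exp q \<le> C2 * N"
    using fock_norm_lower_bound[OF p q a] by blast
  have "exp (\<alpha> * c\<^sup>2 / 2) * c powr (inv_exp q - inv_exp p) \<le> (C2 / C1) * N"
    if c: "c \<ge> c0" and N: "N \<ge> 0" "fock_norm \<alpha> p q (\<lambda>z. exp (of_real (\<alpha> * c) * z)) \<le> ennreal N" for c N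
  proof -
    have c0: "c \<ge> 0" using c C1(2) by simp
    have "C1 * exp (\<alpha> * c\<^sup>2 / 2) * c powr (- inv_exp p) * c powr inv_exp q \<le> C2 * N"
      by (rule C2(2)[OF exp_holomorphic N _ c0 C1(3)[OF c]]) (use C1(1) in simp_all)
    moreover have "c powr (inv_exp q - inv_exp p) = c powr (- inv_exp p) * c powr inv_exp q"
      unfolding powr_add[symmetric] by simp
    ultimately have "C1 * (exp (\<alpha> * c\<^sup>2 / 2) * c powr (inv_exp q - inv_exp p)) \<le> C2 * N"
      by (simp only: mult.assoc)
    then show ?thesis using C1(1) by (simp add: pos_le_divide_eq mult.commute)
  qed
  moreover have "C2 / C1 > 0" using C1(1) C2(1) by simp
  ultimately show ?thesis using C1(2) by blast
qed

lemma exp_square_not_bounded: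
  fixes d k :: real
  assumes "\<And>b. b \<ge> b0 \<Longrightarrow> exp (d * b\<^sup>2) * b powr k \<le> C"
  shows "d \<le> 0" and "d = 0 \<Longrightarrow> k \<le> 0"
proof -
  have ev: "\<forall>\<^sub>F b in at_top. exp (d * b\<^sup>2) * b powr k \<le> C"
    using eventually_ge_at_top[of b0] by eventually_elim (rule assms)
  have no: False if "filterlim (\<lambda>b. exp (d * b\<^sup>2) * b powr k) at_top at_top"
  proof -
    have "\<forall>\<^sub>F b in at_top. C + 1 \<le> exp (d * b\<^sup>2) * b powr k"
      using that by (simp add: filterlim_at_top)
    with ev have "\<forall>\<^sub>F b in at_top :: real filter. False" by eventually_elim simp
    then show False by simp
  qed
  show "d \<le> 0"
  proof (rule ccontr)
    assume "\<not> d \<le> 0"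
    then have "d > 0" by simp
    then have "filterlim (\<lambda>b. exp (d * b\<^sup>2) * b powr k) at_top at_top" by real_asymp
    then show False by (rule no)
  qed
  show "k \<le> 0" if "d = 0"
  proof (rule ccontr)
    assume "\<not> k \<le> 0"
    then have "k > 0" by simp
    then have "filterlim (\<lambda>b. exp (d * b\<^sup>2) * b powr k) at_top at_top" unfolding that by simp real_asymp
    then show False by (rule no)
  qed
qed

text \<open>Letting N range over all finite upper bounds of the source norm turns inclusion and
  continuity into one statement: a finite source norm forces a finite target norm.\<close>

definition fock_bounded :: "real \<Rightarrow> ereal \<Rightarrow> ereal \<Rightarrow> real \<Rightarrow> ereal \<Rightarrow> ereal \<Rightarrow> bool" where
  "fock_bounded \<alpha> p1 q1 \<beta> p2 q2 \<longleftrightarrow> (\<exists>C\<ge>0. \<forall>f N. f holomorphic_on UNIV \<longrightarrow> N \<ge> 0 \<longrightarrow>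
    fock_norm \<alpha> p1 q1 f \<le> ennreal N \<longrightarrow> fock_norm \<beta> p2 q2 f \<le> ennreal (C * N))"

text \<open>One exponential is measured in both norms. The quotient is of order exp(d c^2) c powr
  (k2 - k1) with d = \<beta> (\<alpha> - \<beta>) / (2 \<alpha>). Boundedness gives d \<le> 0, that
  is \<alpha> \<le> \<beta>; for \<alpha> = \<beta> the Gaussian factor disappears and the powers
  decide.\<close>

lemma fock_bounded_exp:
  assumes pq: "p1 > 0" "p2 > 0" "q1 > 0" "q2 > 0" and ab: "\<alpha> > 0" "\<beta> > 0"
    and bd: "fock_bounded \<alpha> p1 q1 \<beta> p2 q2"
  shows "\<alpha> \<le> \<beta>" and "\<alpha> = \<beta> \<Longrightarrow> inv_exp q2 - inv_exp p2 \<le> inv_exp q1 - inv_exp p1"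
proof -
  obtain C where C: "C \<ge> 0" "\<And>f N. f holomorphic_on UNIV \<Longrightarrow> N \<ge> 0 \<Longrightarrow>
    fock_norm \<alpha> p1 q1 f \<le> ennreal N \<Longrightarrow> fock_norm \<beta> p2 q2 f \<le> ennreal (C * N)"
    using bd unfolding fock_bounded_def by blast
  obtain C1 where C1: "C1 > 0" "\<And>c. c\<ge>1 \<Longrightarrow> fock_norm \<alpha> p1 q1 (\<lambda>z. exp (of_real (\<alpha> * c) * z))
    \<le> ennreal (C1 * (exp (\<alpha> * c\<^sup>2 / 2) * c powr (inv_exp q1 - inv_exp p1)))"
    using fock_norm_exp_le[OF pq(1,3) ab(1)] by blast
  obtain C2 c0 where C2: "C2 > 0" "c0 \<ge> 1" "\<And>c N. c\<ge>c0 \<Longrightarrow> N \<ge> 0 \<Longrightarrow> fock_norm \<beta> p2 q2 (\<lambda>z. exp (of_real (\<beta> * c) * z)) \<le> ennreal N \<Longrightarrow>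
    exp (\<beta> * c\<^sup>2 / 2) * c powr (inv_exp q2 - inv_exp p2) \<le> C2 * N"
    using fock_norm_exp_ge[OF pq(2,4) ab(2)] by blast
  define k1 k2 where "k1 = inv_exp q1 - inv_exp p1" and "k2 = inv_exp q2 - inv_exp p2"
  define d where "d = \<beta> / 2 - \<beta>\<^sup>2 / (2 * \<alpha>)"
  define D where "D = C2 * C * C1 * (\<beta> / \<alpha>) powr k1"
  have main: "exp (d * c\<^sup>2) * c powr (k2 - k1) \<le> D" if c: "c \<ge> max c0 (\<alpha> / \<beta>)" for c
  proof -
    \<comment> \<open>The function exp(\<beta> c z) peaks at radius c for the weight \<beta>, but at
      radius e for the weight \<alpha>.\<close>
    define e where "e = \<beta> * c / \<alpha>"
    have e: "e \<ge> 1" "\<alpha> * e = \<beta> * c" using c ab by (auto simp: e_def field_simps)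
    have c1: "c \<ge> c0" "c > 0" using c C2(2) by auto
    define X where "X = C1 * (exp (\<alpha> * e\<^sup>2 / 2) * e powr k1)"
    have X: "X \<ge> 0" using C1(1) by (simp add: X_def)
    have "fock_norm \<alpha> p1 q1 (\<lambda>z. exp (of_real (\<beta> * c) * z)) \<le> ennreal X"
      using C1(2)[OF e(1)] unfolding e(2) X_def k1_def .
    from C(2)[OF exp_holomorphic X this]
    have "exp (\<beta> * c\<^sup>2 / 2) * c powr k2 \<le> C2 * (C * X)"
      unfolding k2_def using C(1) X by (intro C2(3) c1) auto
    also have "\<dots> = D * (exp (\<alpha> * e\<^sup>2 / 2) * c powr k1)"
    proof -
      have "e powr k1 = (\<beta> / \<alpha>) powr k1 * c powr k1"
        unfolding e_def by (simp flip: powr_mult)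
      then show ?thesis by (simp add: X_def D_def)
    qed
    also have "\<alpha> * e\<^sup>2 / 2 = \<beta>\<^sup>2 / (2 * \<alpha>) * c\<^sup>2" using ab by (simp add: e_def power2_eq_square field_simps)
    finally have "exp (\<beta> * c\<^sup>2 / 2) * c powr k2 \<le> D * (exp (\<beta>\<^sup>2 / (2 * \<alpha>) * c\<^sup>2) * c powr k1)" .
    then have "exp (\<beta> * c\<^sup>2 / 2) * c powr k2 / (exp (\<beta>\<^sup>2 / (2 * \<alpha>) * c\<^sup>2) * c powr k1) \<le> D"
      using c1 by (subst pos_divide_le_eq) auto
    moreover have "exp (d * c\<^sup>2) = exp (\<beta> * c\<^sup>2 / 2) / exp (\<beta>\<^sup>2 / (2 * \<alpha>) * c\<^sup>2)"
      unfolding exp_diff[symmetric] by (simp add: d_def algebra_simps)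
    ultimately show ?thesis by (simp add: powr_diff)
  qed
  note unbounded = exp_square_not_bounded[of "max c0 (\<alpha> / \<beta>)" d "k2 - k1" D]
  have d: "d \<le> 0" using main by (rule unbounded(1))
  have k: "k2 - k1 \<le> 0" if "d = 0" using main that by (rule unbounded(2))
  show "\<alpha> \<le> \<beta>"
  proof -
    have "d * (2 * \<alpha>) = \<beta> * (\<alpha> - \<beta>)" using ab by (simp add: d_def power2_eq_square field_simps)
    moreover have "d * (2 * \<alpha>) \<le> 0" using d ab by (simp add: mult_nonpos_nonneg)
    ultimately show ?thesis using ab by (simp add: mult_le_0_iff)
  qed
  show "inv_exp q2 - inv_exp p2 \<le> inv_exp q1 - inv_exp p1" if "\<alpha> = \<beta>"
    using k ab that by (simp add: d_def k1_def k2_def power2_eq_square)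
qed

section \<open>Monomials as test functions\<close>

lemma integral_mean_monomial:
  assumes p: "p > 0" and r: "r \<ge> 0"
  shows "integral_mean p (\<lambda>z. z ^ n) r = r ^ n"
proof (cases p)
  case (real s)
  have s: "s > 0" using real p by simp
  have h: "(\<lambda>z. z ^ n) holomorphic_on UNIV" by (intro holomorphic_intros)
  have "circle_mean s (\<lambda>z. z ^ n) r = 2 * pi * (r ^ n) powr s"
    using r by (simp add: circle_mean_def norm_power norm_mult)
  then show ?thesis using s r by (simp add: real integral_mean_finite[OF h s] powr_powr)
next
  case PInf
  then show ?thesis using r by (simp add: integral_mean_def norm_power norm_mult)
qed (use p in auto)

text \<open>The radius c = sqrt(n / \<alpha>) maximises r^n exp(- \<alpha> r^2 / 2). The upper bound
  comes from ln x \<le> x - 1 at x = r / c, the lower one from ln(1 + u) \<ge> u - u^2.\<close>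

lemma fock_mean_monomial:
  assumes p: "p > 0" and a: "\<alpha> > 0" and n: "n > 0" and c: "c \<ge> 1" "real n = \<alpha> * c\<^sup>2"
  shows "r \<ge> 0 \<Longrightarrow> fock_mean \<alpha> p (\<lambda>z. z ^ n) r \<le> fock_mean \<alpha> p (\<lambda>z. z ^ n) c * exp (- (\<alpha> / 2) * (r - c)\<^sup>2)"
    and "c \<le> r \<Longrightarrow> r \<le> c + 1 \<Longrightarrow> fock_mean \<alpha> p (\<lambda>z. z ^ n) c * exp (- (3 * \<alpha> / 2)) \<le> fock_mean \<alpha> p (\<lambda>z. z ^ n) r"
proof -
  have fm: "fock_mean \<alpha> p (\<lambda>z. z ^ n) r = exp (\<alpha> * c\<^sup>2 * ln r - \<alpha> / 2 * r\<^sup>2)" if "r > 0" for r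
  proof -
    have "r ^ n = exp (\<alpha> * c\<^sup>2 * ln r)" 
      using that by (simp add: powr_def flip: powr_realpow c(2))
    then show ?thesis using that by (simp add: fock_mean_def integral_mean_monomial[OF p] flip: exp_add)
  qed
  have c0: "c > 0" using c by simp
  show "fock_mean \<alpha> p (\<lambda>z. z ^ n) r \<le> fock_mean \<alpha> p (\<lambda>z. z ^ n) c * exp (- (\<alpha> / 2) * (r - c)\<^sup>2)" if "r \<ge> 0"
  proof (cases "r = 0")
    case True
    have "fock_mean \<alpha> p (\<lambda>z. z ^ n) r = 0"
      using True n by (simp add: fock_mean_def integral_mean_monomial[OF p])
    then show ?thesis by (simp add: fm[OF c0])
  next
    case False
    then have r: "r > 0" using that by simp
    have "ln (r / c) \<le> r / c - 1" using r c0 by (intro ln_le_minus_one) simp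
    then have "\<alpha> * c\<^sup>2 * ln (r / c) \<le> \<alpha> * c\<^sup>2 * (r / c - 1)" using a by (intro mult_left_mono) auto
    also have "\<dots> = \<alpha> * c * r - \<alpha> * c\<^sup>2" using c0 by (simp add: power2_eq_square field_simps)
    finally have "\<alpha> * c\<^sup>2 * ln r - \<alpha> / 2 * r\<^sup>2 \<le> \<alpha> * c\<^sup>2 * ln c - \<alpha> / 2 * c\<^sup>2 + - (\<alpha> / 2) * (r - c)\<^sup>2"
      using r c0 by (simp add: ln_div power2_eq_square algebra_simps)
    then have "exp (\<alpha> * c\<^sup>2 * ln r - \<alpha> / 2 * r\<^sup>2) \<le> exp (\<alpha> * c\<^sup>2 * ln c - \<alpha> / 2 * c\<^sup>2 + - (\<alpha> / 2) * (r - c)\<^sup>2)" by simp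
    then show ?thesis unfolding fm[OF c0] fm[OF r] exp_add .
  qed
  show "fock_mean \<alpha> p (\<lambda>z. z ^ n) c * exp (- (3 * \<alpha> / 2)) \<le> fock_mean \<alpha> p (\<lambda>z. z ^ n) r" if "c \<le> r" "r \<le> c + 1"
  proof -
    \<comment> \<open>Since c u \<le> 1, the quadratic term of the logarithm costs at most \<alpha>
      and that of r^2 at most \<alpha> / 2, together 3 \<alpha> / 2.\<close>
    define u where "u = (r - c) / c"
    have r: "r > 0" "r = c * (1 + u)" using that c0 by (auto simp: u_def field_simps)
    have u: "0 \<le> u" "u \<le> 1" using that c c0 by (auto simp: u_def field_simps)
    have cu: "(c * u)\<^sup>2 \<le> 1\<^sup>2" using that c0 by (intro power_mono) (auto simp: u_def)
    have "\<alpha> * c\<^sup>2 * (u - u\<^sup>2) \<le> \<alpha> * c\<^sup>2 * ln (1 + u)"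
      using a u ln_one_plus_pos_lower_bound by (intro mult_left_mono) auto
    also have "ln (1 + u) = ln r - ln c" using c0 u by (simp add: r(2) ln_mult)
    finally have "\<alpha> * c\<^sup>2 * u - \<alpha> * (c * u)\<^sup>2 \<le> \<alpha> * c\<^sup>2 * ln r - \<alpha> * c\<^sup>2 * ln c"
      by (simp add: algebra_simps power_mult_distrib)
    moreover have "\<alpha> * (c * u)\<^sup>2 \<le> \<alpha> * 1" using a cu by (intro mult_left_mono) auto
    moreover have "\<alpha> / 2 * r\<^sup>2 = \<alpha> / 2 * c\<^sup>2 + \<alpha> * c\<^sup>2 * u + \<alpha> * (c * u)\<^sup>2 / 2"
      unfolding r(2) by (simp add: power2_eq_square field_simps)
    ultimately have "\<alpha> * c\<^sup>2 * ln c - \<alpha> / 2 * c\<^sup>2 + - (3 * \<alpha> / 2) \<le> \<alpha> * c\<^sup>2 * ln r - \<alpha> / 2 * r\<^sup>2"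
      by linarith
    then have "exp (\<alpha> * c\<^sup>2 * ln c - \<alpha> / 2 * c\<^sup>2 + - (3 * \<alpha> / 2)) \<le> exp (\<alpha> * c\<^sup>2 * ln r - \<alpha> / 2 * r\<^sup>2)" by simp
    then show ?thesis unfolding fm[OF c0] fm[OF r(1)] exp_add .
  qed
qed

text \<open>The means of a monomial do not depend on p, so only the annulus mass c powr (1/q)
  distinguishes the two norms, and c tends to infinity with n.\<close>

lemma fock_bounded_monomial:
  assumes pq: "p1 > 0" "p2 > 0" "q1 > 0" "q2 > 0" and a: "\<alpha> > 0"
    and bd: "fock_bounded \<alpha> p1 q1 \<alpha> p2 q2"
  shows "inv_exp q2 \<le> inv_exp q1"
proof -
  have a2: "\<alpha> / 2 > 0" using a by simp
  have iq: "inv_exp q1 \<ge> 0" using pq by (cases q1) auto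
  obtain C where C: "C \<ge> 0" "\<And>f N. f holomorphic_on UNIV \<Longrightarrow> N \<ge> 0 \<Longrightarrow>
    fock_norm \<alpha> p1 q1 f \<le> ennreal N \<Longrightarrow> fock_norm \<alpha> p2 q2 f \<le> ennreal (C * N)"
    using bd unfolding fock_bounded_def by blast
  obtain C1 where C1: "C1 > 0" "\<And>f c P. f holomorphic_on UNIV \<Longrightarrow> c \<ge> 0 \<Longrightarrow> P \<ge> 0 \<Longrightarrow>
     (\<And>r. r\<ge>0 \<Longrightarrow> fock_mean \<alpha> p1 f r \<le> P * ((1 + \<bar>r - c\<bar>) powr 0 * exp (- (\<alpha> / 2) * (r - c)\<^sup>2))) \<Longrightarrow>
     fock_norm \<alpha> p1 q1 f \<le> ennreal (C1 * P * (1 + c) powr inv_exp q1)"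
    using fock_norm_le_gaussian[OF a2 pq(1,3) a, of 0] by blast
  obtain C2 where C2: "C2 > 0" "\<And>f N P c. f holomorphic_on UNIV \<Longrightarrow> N \<ge> 0 \<Longrightarrow> fock_norm \<alpha> p2 q2 f \<le> ennreal N \<Longrightarrow> P \<ge> 0 \<Longrightarrow> c \<ge> 0 \<Longrightarrow>
     (\<And>r. c \<le> r \<Longrightarrow> r \<le> c + 1 \<Longrightarrow> P \<le> fock_mean \<alpha> p2 f r) \<Longrightarrow> P * c powr inv_exp q2 \<le> C2 * N"
    using fock_norm_lower_bound[OF pq(2,4) a] by blast
  define D where "D = C2 * C * C1 * 2 powr inv_exp q1 / exp (- (3 * \<alpha> / 2))"
  have main: "sqrt (real n / \<alpha>) powr (inv_exp q2 - inv_exp q1) \<le> D" if n: "real n \<ge> max 1 \<alpha>" for n :: nat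
  proof -
    define c where "c = sqrt (real n / \<alpha>)"
    have n0: "n > 0" using n by (cases n) auto
    have c: "c \<ge> 1" "real n = \<alpha> * c\<^sup>2" using n a by (auto simp: c_def)
    have c0: "c \<ge> 0" "c > 0" using c by auto
    define f :: "complex \<Rightarrow> complex" where "f = (\<lambda>z. z ^ n)"
    have hol: "f holomorphic_on UNIV" unfolding f_def by (intro holomorphic_intros)
    define P where "P = c ^ n * exp (- (\<alpha> / 2) * c\<^sup>2)"
    have P: "P > 0" using c0 by (simp add: P_def)
    have Pe: "fock_mean \<alpha> p f c = P" if "p > 0" for p
      using c0 integral_mean_monomial[OF that] by (simp add: fock_mean_def f_def P_def)
    define X where "X = C1 * P * (1 + c) powr inv_exp q1"
    have X: "X \<ge> 0" using C1(1) P by (simp add: X_def)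
    \<comment> \<open>The Gaussian estimate is used with k = 0; as \<open>0 powr 0 = 0\<close>, the
      base has to be seen to be nonzero.\<close>
    have one: "(1 + \<bar>r - c\<bar>) powr 0 = 1" for r
    proof -
      have "1 + \<bar>r - c\<bar> \<noteq> 0" using abs_ge_zero[of "r - c"] by linarith
      then show ?thesis by simp
    qed
    have 1: "fock_norm \<alpha> p1 q1 f \<le> ennreal X"
      unfolding X_def
      by (rule C1(2)[OF hol c0(1) less_imp_le[OF P]])
        (use fock_mean_monomial(1)[OF pq(1) a n0 c, folded f_def] Pe[OF pq(1)] in \<open>simp add: one del: powr_zero_eq_one\<close>)
    have "P * exp (- (3 * \<alpha> / 2)) * c powr inv_exp q2 \<le> C2 * (C * X)"
      by (rule C2(2)[OF hol _ C(2)[OF hol X 1] _ c0(1)])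
        (use fock_mean_monomial(2)[OF pq(2) a n0 c, folded f_def] Pe[OF pq(2)] C(1) X P in simp_all)
    also have "\<dots> \<le> C2 * (C * (C1 * P * (2 * c) powr inv_exp q1))"
      unfolding X_def using C2(1) C(1) C1(1) P c iq by (intro mult_left_mono powr_mono2) auto
    also have "\<dots> = P * exp (- (3 * \<alpha> / 2)) * (D * c powr inv_exp q1)"
      by (simp add: D_def powr_mult)
    finally have "c powr inv_exp q2 \<le> D * c powr inv_exp q1"
      using P by (simp only: mult.assoc mult_le_cancel_left_pos exp_gt_zero)
    then have "c powr inv_exp q2 / c powr inv_exp q1 \<le> D" using c0 by (simp add: pos_divide_le_eq)
    then show ?thesis by (simp add: powr_diff c_def)
  qed
  show ?thesis
  proof (rule ccontr)
    assume "\<not> inv_exp q2 \<le> inv_exp q1"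
    then have k: "inv_exp q2 - inv_exp q1 > 0" by simp
    have "filterlim (\<lambda>n. sqrt (real n / \<alpha>) powr (inv_exp q2 - inv_exp q1)) at_top at_top"
      using k a by real_asymp
    then have "\<forall>\<^sub>F n in sequentially. D + 1 \<le> sqrt (real n / \<alpha>) powr (inv_exp q2 - inv_exp q1)"
      by (simp add: filterlim_at_top)
    moreover have "\<forall>\<^sub>F n in sequentially. real n \<ge> max 1 \<alpha>"
      by real_asymp
    ultimately have "\<forall>\<^sub>F n in sequentially. False"
      by eventually_elim (use main in force)
    then show False by simp
  qed
qed

section \<open>Translation to real reciprocals and the equivalence\<close>

lemma ereal_one_divide: "p > 0 \<Longrightarrow> 1 / p = ereal (inv_exp p)" for p :: ereal
  by (cases p) (auto simp: one_ereal_def)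

lemma inv_exp_le_iff: "p > 0 \<Longrightarrow> q > 0 \<Longrightarrow> inv_exp q \<le> inv_exp p \<longleftrightarrow> p \<le> q"
  by (cases p; cases q) (auto simp: field_simps)

lemma continuous_inclusion_iff_fock_bounded:
  "(fock_space \<alpha> p1 q1 \<subseteq> fock_space \<beta> p2 q2 \<and>
     (\<exists>C::real. 0 \<le> C \<and> (\<forall>f\<in>fock_space \<alpha> p1 q1. fock_norm \<beta> p2 q2 f \<le> ennreal C * fock_norm \<alpha> p1 q1 f)))
   \<longleftrightarrow> fock_bounded \<alpha> p1 q1 \<beta> p2 q2" (is "?L \<longleftrightarrow> ?R")
proof
  assume ?L
  then obtain C where C: "C \<ge> 0" "\<And>f. f \<in> fock_space \<alpha> p1 q1 \<Longrightarrow> fock_norm \<beta> p2 q2 f \<le> ennreal C * fock_norm \<alpha> p1 q1 f"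
    by blast
  have "fock_norm \<beta> p2 q2 f \<le> ennreal (C * N)"
    if hol: "f holomorphic_on UNIV" and N: "N \<ge> 0" "fock_norm \<alpha> p1 q1 f \<le> ennreal N" for f N
  proof -
    have "fock_norm \<alpha> p1 q1 f < \<infinity>" using N(2) by (simp add: le_less_trans)
    then have "fock_norm \<beta> p2 q2 f \<le> ennreal C * fock_norm \<alpha> p1 q1 f"
      using hol by (intro C(2)) (simp add: fock_space_def)
    also have "\<dots> \<le> ennreal C * ennreal N" by (intro mult_left_mono N) auto
    finally show ?thesis using C(1) N(1) by (simp add: ennreal_mult)
  qed
  then show ?R unfolding fock_bounded_def using C(1) by blast
next
  assume ?R
  then obtain C where C: "C \<ge> 0" "\<And>f N. f holomorphic_on UNIV \<Longrightarrow> N \<ge> 0 \<Longrightarrow>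
    fock_norm \<alpha> p1 q1 f \<le> ennreal N \<Longrightarrow> fock_norm \<beta> p2 q2 f \<le> ennreal (C * N)"
    unfolding fock_bounded_def by blast
  have *: "fock_norm \<beta> p2 q2 f \<le> ennreal C * fock_norm \<alpha> p1 q1 f" "f \<in> fock_space \<beta> p2 q2"
    if f: "f \<in> fock_space \<alpha> p1 q1" for f
  proof -
    have hol: "f holomorphic_on UNIV" and fin: "fock_norm \<alpha> p1 q1 f < \<infinity>" using f by (auto simp: fock_space_def)
    define N where "N = enn2real (fock_norm \<alpha> p1 q1 f)"
    have N: "N \<ge> 0" "fock_norm \<alpha> p1 q1 f = ennreal N" using fin by (simp_all add: N_def)
    have le: "fock_norm \<beta> p2 q2 f \<le> ennreal (C * N)" by (intro C(2) hol N(1)) (simp add: N(2))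
    then show "fock_norm \<beta> p2 q2 f \<le> ennreal C * fock_norm \<alpha> p1 q1 f"
      using C(1) N by (simp add: ennreal_mult)
    show "f \<in> fock_space \<beta> p2 q2"
      using hol le by (simp add: fock_space_def le_less_trans)
  qed
  then show ?L using C(1) by blast
qed

theorem theorem1p2:
  fixes \<alpha> \<beta> :: real and p1 p2 q1 q2 :: ereal
  assumes "0 < \<alpha>" and "0 < \<beta>"
    and "0 < p1" and "0 < p2" and "0 < q1" and "0 < q2"
  shows "(fock_space \<alpha> p1 q1 \<subseteq> fock_space \<beta> p2 q2 \<and>
          (\<exists>C::real. 0 \<le> C \<and> (\<forall>f\<in>fock_space \<alpha> p1 q1.
             fock_norm \<beta> p2 q2 f \<le> ennreal C * fock_norm \<alpha> p1 q1 f)))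
     \<longleftrightarrow> (\<alpha> < \<beta> \<or> (\<alpha> = \<beta> \<and> q1 \<le> q2 \<and> 1 / q2 - 1 / p2 \<le> 1 / q1 - 1 / p1))"
proof -
  have cond: "1 / q2 - 1 / p2 \<le> 1 / q1 - 1 / p1 \<longleftrightarrow> inv_exp q2 - inv_exp p2 \<le> inv_exp q1 - inv_exp p1"
    "q1 \<le> q2 \<longleftrightarrow> inv_exp q2 \<le> inv_exp q1"
    using assms by (simp_all add: ereal_one_divide inv_exp_le_iff)
  note pq = assms(3-6) and ab = assms(1,2)
  show ?thesis unfolding continuous_inclusion_iff_fock_bounded cond
  proof
    assume bd: "fock_bounded \<alpha> p1 q1 \<beta> p2 q2"
    from fock_bounded_exp[OF pq ab bd] fock_bounded_monomial[OF pq ab(1)] bd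
    show "\<alpha> < \<beta> \<or> (\<alpha> = \<beta> \<and> inv_exp q2 \<le> inv_exp q1 \<and> inv_exp q2 - inv_exp p2 \<le> inv_exp q1 - inv_exp p1)"
      by (cases "\<alpha> = \<beta>") auto
  next
    assume "\<alpha> < \<beta> \<or> (\<alpha> = \<beta> \<and> inv_exp q2 \<le> inv_exp q1 \<and> inv_exp q2 - inv_exp p2 \<le> inv_exp q1 - inv_exp p1)"
    then show "fock_bounded \<alpha> p1 q1 \<beta> p2 q2"
      unfolding fock_bounded_def
      using fock_norm_le_of_less[OF pq ab(1)] fock_norm_le_of_eq[OF pq ab(1)] by (meson less_imp_le)
  qed
qed

end
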